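(* Let $A,B\in\mathbb{B}(\mathscr{H})_+$, $X\in\mathcal{I}$, and let $\alpha\in[1/2,\infty)$. Then for every $\nu$ with $1/4\leq\nu\leq 3/4$, writing $r_0=\min\{\nu,1-\nu\}$, $$F(\nu)\leq (4r_0-1)F(1/2)+2(1-2r_0)G(\alpha)\leq G(\alpha),$$ and moreover $$F(1/2)+2\left(2\int_{1/4}^{3/4}F(\nu)\,d\nu-F(1/2)\right)\leq G(\alpha).$$
   Context: $\mathscr{H}$ is a separable complex Hilbert space, $\mathbb{B}(\mathscr{H})_+$ is the cone of positive (semidefinite) bounded operators on $\mathscr{H}$, and $\mathbb{K}(\mathscr{H})$ is the ideal of compact operators. A unitarily invariant norm $|||\cdot|||:\mathbb{K}(\mathscr{H})\to[0,\infty]$ is a map $|||A|||=g(s(A))$, where $g$ is a symmetric gauge function and $s(A)=(s_1(A),s_2(A),\dots)$ is the sequence of singular values of $A$ (eigenvalues of $|A|=(A^*A)^{1/2}$ in decreasing order with multiplicity). Fix such a norm and put $\mathcal{I}=\{A\in\mathbb{K}(\mathscr{H}):|||A|||<\infty\}$, a two-sided ideal of $\mathbb{B}(\mathscr{H})$. For given $A,B,X$ define $$F(\nu)=\tfrac12\,|||A^{\nu}XB^{1-\nu}+A^{1-\nu}XB^{\nu}|||\quad(\nu\in[0,1]),$$ $$G(\alpha)=\left|\left|\left|(1-\alpha)A^{1/2}XB^{1/2}+\alpha\,\frac{AX+XB}{2}\right|\right|\right|\quad(\alpha\ge 0).$$ *)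

theory Defs
  imports "HOL-Analysis.Analysis" "HOL-Computational_Algebra.Polynomial"
begin

section \<open>Complex Hilbert spaces\<close>

text \<open>
  The real inner product, and with it norm and topology, is the real part of the complex one,
  so that the library of real Hilbert spaces applies. The complex inner product is
  linear in its second argument.
\<close>

class complex_hilbert = real_inner + complete_space +
  fixes scaleC :: "complex \<Rightarrow> 'a \<Rightarrow> 'a"  (infixr \<open>*\<^sub>C\<close> 75)
    and cinner :: "'a \<Rightarrow> 'a \<Rightarrow> complex"
  assumes scaleC_add_right: "c *\<^sub>C (x + y) = c *\<^sub>C x + c *\<^sub>C y"
    and scaleC_add_left: "(c + d) *\<^sub>C x = c *\<^sub>C x + d *\<^sub>C x"
    and scaleC_scaleC: "c *\<^sub>C (d *\<^sub>C x) = (c * d) *\<^sub>C x"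
    and scaleR_eq_scaleC: "scaleR r x = complex_of_real r *\<^sub>C x"
    and cinner_commute: "cinner x y = cnj (cinner y x)"
    and cinner_add_right: "cinner x (y + z) = cinner x y + cinner x z"
    and cinner_scaleC_right: "cinner x (c *\<^sub>C y) = c * cinner x y"
    and inner_eq_Re_cinner: "inner x y = Re (cinner x y)"

instance complex_hilbert \<subseteq> banach ..

global_interpretation complex_vector:
  vector_space "scaleC :: complex \<Rightarrow> 'a \<Rightarrow> 'a::complex_hilbert"
proof
  fix x :: 'a
  show "1 *\<^sub>C x = x"
    using scaleR_eq_scaleC[of 1 x] by simp
qed (simp_all add: scaleC_add_right scaleC_add_left scaleC_scaleC)


section \<open>Bounded operators\<close>

text \<open>
  \<^typ>\<open>'a \<Rightarrow>\<^sub>L 'a\<close> is the space of bounded real-linear maps; the bounded operators on the complex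
  Hilbert space are its complex-linear members. The norm of \<^typ>\<open>'a \<Rightarrow>\<^sub>L 'a\<close> is the usual operator norm.
\<close>

definition bounded_ops :: "('a::complex_hilbert \<Rightarrow>\<^sub>L 'a) set" where
  "bounded_ops = {T. \<forall>c x. blinfun_apply T (c *\<^sub>C x) = c *\<^sub>C blinfun_apply T x}"

definition positive_ops :: "('a::complex_hilbert \<Rightarrow>\<^sub>L 'a) set" where
  "positive_ops = {T \<in> bounded_ops. \<forall>x. cinner x (blinfun_apply T x) \<in> \<real>\<^sub>\<ge>\<^sub>0}"

definition compact_ops :: "('a::complex_hilbert \<Rightarrow>\<^sub>L 'a) set" where
  "compact_ops = {T \<in> bounded_ops. compact (closure (blinfun_apply T ` cball 0 1))}"

definition cadjoint :: "('a::complex_hilbert \<Rightarrow>\<^sub>L 'a) \<Rightarrow> ('a \<Rightarrow>\<^sub>L 'a)" where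
  "cadjoint T = (THE S. \<forall>x y. cinner (blinfun_apply T x) y = cinner x (blinfun_apply S y))"


section \<open>Functional calculus of positive operators\<close>

definition poly_blinfun :: "real poly \<Rightarrow> ('a::complex_hilbert \<Rightarrow>\<^sub>L 'a) \<Rightarrow> ('a \<Rightarrow>\<^sub>L 'a)" where
  "poly_blinfun p T = (\<Sum>i\<le>degree p. coeff p i *\<^sub>R (((\<lambda>S. T o\<^sub>L S) ^^ i) id_blinfun))"

text \<open>
  Continuous functional calculus for positive \<open>T\<close>, whose spectrum is contained in
  \<open>[0, norm T]\<close>: \<open>f(T)\<close> is the operator norm limit of \<open>p\<^sub>n(T)\<close> whenever
  the polynomials \<open>p\<^sub>n\<close> converge to \<open>f\<close> uniformly on that interval.
\<close>

definition fun_calc :: "(real \<Rightarrow> real) \<Rightarrow> ('a::complex_hilbert \<Rightarrow>\<^sub>L 'a) \<Rightarrow> ('a \<Rightarrow>\<^sub>L 'a)" where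
  "fun_calc f T = (THE S. \<forall>p :: nat \<Rightarrow> real poly.
     uniform_limit {0..norm T} (\<lambda>n. poly (p n)) f sequentially \<longrightarrow>
     (\<lambda>n. poly_blinfun (p n) T) \<longlonglongrightarrow> S)"

text \<open>The case distinction is needed because \<open>0 powr 0 = 0\<close>, whereas \<open>T\<^sup>0\<close> is the identity.\<close>

definition op_powr :: "('a::complex_hilbert \<Rightarrow>\<^sub>L 'a) \<Rightarrow> real \<Rightarrow> ('a \<Rightarrow>\<^sub>L 'a)" where
  "op_powr T \<nu> = fun_calc (\<lambda>t. if \<nu> = 0 then 1 else t powr \<nu>) T"

definition op_abs :: "('a::complex_hilbert \<Rightarrow>\<^sub>L 'a) \<Rightarrow> ('a \<Rightarrow>\<^sub>L 'a)" where
  "op_abs T = op_powr (cadjoint T o\<^sub>L T) (1/2)"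


section \<open>Singular values and unitarily invariant norms\<close>

definition eigenspace :: "('a::complex_hilbert \<Rightarrow>\<^sub>L 'a) \<Rightarrow> real \<Rightarrow> 'a set" where
  "eigenspace T \<mu> = {x. blinfun_apply T x = complex_of_real \<mu> *\<^sub>C x}"

text \<open>
  The decreasing enumeration of the positive eigenvalues of \<open>|T|\<close>, each repeated according to its
  complex multiplicity, and continued by zeros if there are only finitely many of them.
\<close>

definition singular_values :: "('a::complex_hilbert \<Rightarrow>\<^sub>L 'a) \<Rightarrow> nat \<Rightarrow> real" where
  "singular_values T = (THE s. decseq s \<and> (\<forall>n. 0 \<le> s n) \<and>
     (\<forall>\<mu>>0. finite {n. s n = \<mu>} \<and>
        card {n. s n = \<mu>} = complex_vector.dim (eigenspace (op_abs T) \<mu>)))"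

definition fin_seqs :: "(nat \<Rightarrow> real) set" where
  "fin_seqs = {x. finite {n. x n \<noteq> 0}}"

text \<open>
  A symmetric gauge function is a norm on the finitely supported sequences that is
  invariant under permutations and sign changes.
\<close>

definition symmetric_gauge :: "((nat \<Rightarrow> real) \<Rightarrow> real) \<Rightarrow> bool" where
  "symmetric_gauge g \<longleftrightarrow>
     (\<forall>x\<in>fin_seqs. 0 \<le> g x \<and> (g x = 0 \<longleftrightarrow> x = (\<lambda>n. 0))) \<and>
     (\<forall>x\<in>fin_seqs. \<forall>c. g (\<lambda>n. c * x n) = \<bar>c\<bar> * g x) \<and>
     (\<forall>x\<in>fin_seqs. \<forall>y\<in>fin_seqs. g (\<lambda>n. x n + y n) \<le> g x + g y) \<and>
     (\<forall>x\<in>fin_seqs. \<forall>\<pi>. bij \<pi> \<longrightarrow> g (\<lambda>n. x (\<pi> n)) = g x) \<and>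
     (\<forall>x\<in>fin_seqs. \<forall>\<epsilon>. (\<forall>n. \<epsilon> n = 1 \<or> \<epsilon> n = -1) \<longrightarrow> g (\<lambda>n. \<epsilon> n * x n) = g x)"

text \<open>The usual extension to arbitrary sequences, as the supremum over all truncations.\<close>

definition gauge_ext :: "((nat \<Rightarrow> real) \<Rightarrow> real) \<Rightarrow> (nat \<Rightarrow> real) \<Rightarrow> ennreal" where
  "gauge_ext g x = (SUP n. ennreal (g (\<lambda>k. if k < n then x k else 0)))"

definition ui_norm :: "((nat \<Rightarrow> real) \<Rightarrow> real) \<Rightarrow> ('a::complex_hilbert \<Rightarrow>\<^sub>L 'a) \<Rightarrow> ennreal" where
  "ui_norm g T = gauge_ext g (singular_values T)"

definition norm_ideal :: "((nat \<Rightarrow> real) \<Rightarrow> real) \<Rightarrow> ('a::complex_hilbert \<Rightarrow>\<^sub>L 'a) set" where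
  "norm_ideal g = {T \<in> compact_ops. ui_norm g T < \<infinity>}"


section \<open>The functions \<open>F\<close> and \<open>G\<close>\<close>

definition F_mean :: "((nat \<Rightarrow> real) \<Rightarrow> real) \<Rightarrow> ('a::complex_hilbert \<Rightarrow>\<^sub>L 'a) \<Rightarrow> ('a \<Rightarrow>\<^sub>L 'a) \<Rightarrow>
    ('a \<Rightarrow>\<^sub>L 'a) \<Rightarrow> real \<Rightarrow> ennreal" where
  "F_mean g A B X \<nu> =
     1/2 * ui_norm g ((op_powr A \<nu> o\<^sub>L X o\<^sub>L op_powr B (1 - \<nu>))
                    + (op_powr A (1 - \<nu>) o\<^sub>L X o\<^sub>L op_powr B \<nu>))"

definition G_mean :: "((nat \<Rightarrow> real) \<Rightarrow> real) \<Rightarrow> ('a::complex_hilbert \<Rightarrow>\<^sub>L 'a) \<Rightarrow> ('a \<Rightarrow>\<^sub>L 'a) \<Rightarrow>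
    ('a \<Rightarrow>\<^sub>L 'a) \<Rightarrow> real \<Rightarrow> ennreal" where
  "G_mean g A B X \<alpha> =
     ui_norm g ((1 - \<alpha>) *\<^sub>R (op_powr A (1/2) o\<^sub>L X o\<^sub>L op_powr B (1/2))
                + \<alpha> *\<^sub>R ((1/2) *\<^sub>R ((A o\<^sub>L X) + (X o\<^sub>L B))))"

end

theory Submission
  imports Defs "HOL-Computational_Algebra.Fundamental_Theorem_Algebra"
begin

text \<open>
  The engine is the arithmetic-geometric mean inequality
  \<open>|||a Y b||| \<le> |||(a\<^sup>2 Y + Y b\<^sup>2) / 2|||\<close> for self-adjoint \<open>a\<close>, \<open>b\<close> and compact \<open>Y\<close> (\<open>ui_norm_agm\<close>).
  With \<open>a = A\<^sup>h\<close> and \<open>b = B\<^sup>h\<close> it says that \<open>F\<close> is midpoint convex (\<open>F_real_midpoint_step\<close>). Since \<open>F\<close> is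
  bounded, it is convex, and being symmetric about \<open>1/2\<close> it lies on \<open>{1/4..1/2}\<close> below the chord from
  \<open>F (1/4)\<close> down to \<open>F (1/2)\<close>. With \<open>a = A\<^sup>1\<^sup>/\<^sup>4\<close>, \<open>b = B\<^sup>1\<^sup>/\<^sup>4\<close> and \<open>Y = A\<^sup>1\<^sup>/\<^sup>2 X + X B\<^sup>1\<^sup>/\<^sup>2\<close> the same inequality
  gives \<open>F (1/4) \<le> G (1/2)\<close>, because
  \<open>(a\<^sup>2 Y + Y b\<^sup>2) / 2\<close> is twice the operator whose norm is \<open>G (1/2)\<close>. Finally \<open>G\<close> is convex and
  \<open>G 0 = F (1/2) \<le> G (1/2)\<close>, hence \<open>G (1/2) \<le> G \<alpha>\<close> for \<open>\<alpha> \<ge> 1/2\<close>. Replacing \<open>F (1/4)\<close> by \<open>G \<alpha>\<close> in the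
  chord gives the pointwise estimate, and integrating the two linear pieces of that estimate gives
  the integral one.

  A unitarily invariant norm is controlled by the Ky Fan norms, the partial sums of the
  singular values: if they are dominated, then so is every symmetric gauge function of the singular
  values (\<open>gauge_weak_majorization\<close>). The Ky Fan norms in turn are maxima of sums
  \<open>\<Sum>j<k. 2 Re \<langle>x j, Z (y j)\<rangle>\<close> over Bessel families \<open>(x j, y j)\<close> of the doubled Hilbert space
  (\<open>sum_Re_cinner_le_ky_fan\<close>), from which the triangle inequality, the ideal property and the
  arithmetic-geometric mean inequality for Ky Fan norms (\<open>ky_fan_agm\<close>) are read off.

  Underneath lie the functional calculus of a positive operator, which rests on the estimate
  of \<open>norm (p(A))\<close> by the maximum of \<open>\<bar>p\<bar>\<close> on \<open>{0..norm A}\<close> (\<open>norm_poly_blinfun_le\<close>), and the spectral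
  theorem for the compact positive operator \<open>op_abs T\<close>, whose eigenvalues are extracted one after the
  other by maximising the norm on the orthogonal complement of the previous eigenvectors.
\<close>

section \<open>Geometry of complex Hilbert spaces\<close>

lemma cinner_add_left: "cinner (x + y) z = cinner x z + cinner y (z::'a::complex_hilbert)"
  by (metis cinner_add_right cinner_commute complex_cnj_add)

lemma cinner_scaleC_left: "cinner (c *\<^sub>C x) (y::'a::complex_hilbert) = cnj c * cinner x y"
  by (metis cinner_commute cinner_scaleC_right complex_cnj_mult)

lemma cinner_zero_right [simp]: "cinner x (0::'a::complex_hilbert) = 0"
  using cinner_add_right[of x 0 0] by simp

lemma cinner_zero_left [simp]: "cinner (0::'a::complex_hilbert) x = 0"
  using cinner_add_left[of 0 0 x] by simp

lemma cinner_minus_right: "cinner x (- y) = - cinner x (y::'a::complex_hilbert)"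
  using cinner_add_right[of x y "- y"] by (simp add: add_eq_0_iff)

lemma cinner_diff_right: "cinner x (y - z) = cinner x y - cinner x (z::'a::complex_hilbert)"
  using cinner_add_right[of x y "- z"] by (simp add: cinner_minus_right)

lemma cinner_sum_right: "cinner x (\<Sum>i\<in>I. f i) = (\<Sum>i\<in>I. cinner x (f i :: 'a::complex_hilbert))"
  by (induction I rule: infinite_finite_induct) (auto simp: cinner_add_right)

lemma cinner_sum_left: "cinner (\<Sum>i\<in>I. f i) x = (\<Sum>i\<in>I. cinner (f i :: 'a::complex_hilbert) x)"
  by (induction I rule: infinite_finite_induct) (auto simp: cinner_add_left)

lemma cinner_scaleR_right: "cinner x (r *\<^sub>R y) = of_real r * cinner x (y::'a::complex_hilbert)"
  by (simp add: scaleR_eq_scaleC cinner_scaleC_right)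

lemma cinner_scaleR_left: "cinner (r *\<^sub>R x) y = of_real r * cinner x (y::'a::complex_hilbert)"
  by (simp add: scaleR_eq_scaleC cinner_scaleC_left)

lemma scaleR_scaleC_commute: "r *\<^sub>R (c *\<^sub>C x) = c *\<^sub>C (r *\<^sub>R (x::'a::complex_hilbert))"
  by (simp add: scaleR_eq_scaleC scaleC_scaleC mult.commute)

lemma cinner_self: "cinner x x = of_real ((norm (x::'a::complex_hilbert))\<^sup>2)"
proof -
  have "Im (cinner x x) = 0"
    using cinner_commute[of x x] by (metis cnj.simps(2) equal_neg_zero)
  moreover have "Re (cinner x x) = (norm x)\<^sup>2"
    by (simp add: inner_eq_Re_cinner[symmetric] power2_norm_eq_inner)
  ultimately show ?thesis by (simp add: complex_eq_iff)
qed

lemma Im_cinner: "Im (cinner x y) = inner (\<i> *\<^sub>C x) (y::'a::complex_hilbert)"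
  by (simp add: inner_eq_Re_cinner cinner_scaleC_left)

lemma cinner_eqI_inner:
  assumes "\<And>y. inner y u = inner y (v::'a::complex_hilbert)"
  shows "u = v"
  using assms by (metis inner_commute vector_eq_rdot)

lemma norm_scaleC: "norm (c *\<^sub>C (x::'a::complex_hilbert)) = cmod c * norm x"
proof -
  have "complex_of_real ((norm (c *\<^sub>C x))\<^sup>2) = (c * cnj c) * of_real ((norm x)\<^sup>2)"
    unfolding cinner_self[symmetric] by (simp add: cinner_scaleC_left cinner_scaleC_right)
  also have "\<dots> = complex_of_real ((cmod c * norm x)\<^sup>2)"
    unfolding complex_norm_square[symmetric] by (simp add: power_mult_distrib)
  finally have "complex_of_real ((norm (c *\<^sub>C x))\<^sup>2) = complex_of_real ((cmod c * norm x)\<^sup>2)" .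
  then have "(norm (c *\<^sub>C x))\<^sup>2 = (cmod c * norm x)\<^sup>2"
    using of_real_eq_iff by blast
  then show ?thesis by (simp add: power2_eq_iff_nonneg)
qed

lemma norm_add_orthogonal:
  assumes "cinner x y = 0"
  shows "(norm (x + y))\<^sup>2 = (norm x)\<^sup>2 + (norm (y::'a::complex_hilbert))\<^sup>2"
proof -
  have "inner x y = 0" using assms by (simp add: inner_eq_Re_cinner)
  then show ?thesis
    by (simp add: power2_norm_eq_inner inner_add_left inner_add_right inner_commute)
qed

instantiation prod :: (complex_hilbert, complex_hilbert) complex_hilbert
begin

definition scaleC_prod_def: "c *\<^sub>C p = (c *\<^sub>C fst p, c *\<^sub>C snd p)"

definition cinner_prod_def: "cinner p q = cinner (fst p) (fst q) + cinner (snd p) (snd q)"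

instance
proof
  fix x y :: "'a \<times> 'b"
  show "cinner x y = cnj (cinner y x)"
    unfolding cinner_prod_def by (metis cinner_commute complex_cnj_add)
qed (simp_all add: scaleC_prod_def cinner_prod_def scaleC_add_right scaleC_add_left
    scaleC_scaleC scaleR_eq_scaleC[symmetric] scaleR_prod_def cinner_add_right
    cinner_scaleC_right inner_prod_def inner_eq_Re_cinner algebra_simps)

end

text \<open>
  Families of vectors are indexed by \<open>nat\<close> and may contain the zero vector; a singular system of
  an operator of finite rank is then padded with zeros, and no case distinction on the rank is
  needed.
\<close>

definition orthonormal0 :: "nat \<Rightarrow> (nat \<Rightarrow> 'a::complex_hilbert) \<Rightarrow> bool" where
  "orthonormal0 k e \<longleftrightarrow> (\<forall>i<k. e i = 0 \<or> norm (e i) = 1) \<and>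
     (\<forall>i<k. \<forall>j<k. i \<noteq> j \<longrightarrow> cinner (e i) (e j) = 0)"

definition bessel_family :: "nat \<Rightarrow> (nat \<Rightarrow> 'a::complex_hilbert) \<Rightarrow> bool" where
  "bessel_family k q \<longleftrightarrow> (\<forall>w. (\<Sum>j<k. (cmod (cinner (q j) w))\<^sup>2) \<le> (norm w)\<^sup>2)"

lemma bessel_familyD:
  "bessel_family k q \<Longrightarrow> (\<Sum>j<k. (cmod (cinner (q j) w))\<^sup>2) \<le> (norm w)\<^sup>2"
  unfolding bessel_family_def by blast

definition proj_away :: "nat \<Rightarrow> (nat \<Rightarrow> 'a::complex_hilbert) \<Rightarrow> 'a \<Rightarrow> 'a" where
  "proj_away k e w = w - (\<Sum>j<k. cinner (e j) w *\<^sub>C e j)"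

lemma cinner_proj_away:
  assumes "orthonormal0 k e" "i < k"
  shows "cinner (e i) (proj_away k e w) = 0"
proof -
  have "cinner (e i) (\<Sum>j<k. cinner (e j) w *\<^sub>C e j) = (\<Sum>j<k. if j = i then cinner (e i) w else 0)"
    unfolding cinner_sum_right
  proof (rule sum.cong)
    fix j assume "j \<in> {..<k}"
    then show "cinner (e i) (cinner (e j) w *\<^sub>C e j) = (if j = i then cinner (e i) w else 0)"
      using assms unfolding orthonormal0_def
      by (cases "e i = 0") (auto simp: cinner_scaleC_right cinner_self)
  qed simp
  with assms(2) show ?thesis
    by (simp add: proj_away_def cinner_diff_right)
qed

lemma norm_proj_away:
  assumes "orthonormal0 k e"
  shows "(norm w)\<^sup>2 = (norm (proj_away k e w))\<^sup>2 + (\<Sum>j<k. (cmod (cinner (e j) w))\<^sup>2)"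
proof -
  have *: "cinner (e j) w = cinner (e j) (\<Sum>j<k. cinner (e j) w *\<^sub>C e j)" if "j < k" for j
    using cinner_proj_away[OF assms that, of w] by (simp add: proj_away_def cinner_diff_right)
  let ?p = "\<Sum>j<k. cinner (e j) w *\<^sub>C e j"
  have "complex_of_real ((norm ?p)\<^sup>2) = cinner ?p ?p"
    by (simp add: cinner_self)
  also have "\<dots> = (\<Sum>j<k. cnj (cinner (e j) w) * cinner (e j) ?p)"
    by (simp add: cinner_sum_left cinner_scaleC_left)
  also have "\<dots> = (\<Sum>j<k. cnj (cinner (e j) w) * cinner (e j) w)"
    using * by (intro sum.cong) auto
  also have "\<dots> = of_real (\<Sum>j<k. (cmod (cinner (e j) w))\<^sup>2)"
    unfolding of_real_sum complex_norm_square by (simp add: mult.commute)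
  finally have 1: "(norm ?p)\<^sup>2 = (\<Sum>j<k. (cmod (cinner (e j) w))\<^sup>2)"
    using of_real_eq_iff by blast
  have "cinner ?p (proj_away k e w) = 0"
    by (simp add: cinner_sum_left cinner_scaleC_left cinner_proj_away[OF assms])
  from norm_add_orthogonal[OF this] 1 show ?thesis
    by (simp add: proj_away_def)
qed

lemma norm_proj_away_le:
  assumes "orthonormal0 k e"
  shows "norm (proj_away k e w) \<le> norm w"
proof -
  have "(norm (proj_away k e w))\<^sup>2 \<le> (norm w)\<^sup>2"
    using norm_proj_away[OF assms, of w] by (simp add: sum_nonneg)
  then show ?thesis by (simp add: power2_le_iff_abs_le)
qed

lemma orthonormal0_imp_bessel_family: "orthonormal0 k e \<Longrightarrow> bessel_family k e"
  unfolding bessel_family_def using norm_proj_away by (metis le_add_same_cancel2 zero_le_power2)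

lemma bessel_family_norm_le:
  assumes "bessel_family k q" "j < k"
  shows "norm (q j) \<le> 1"
proof -
  have "(cmod (cinner (q j) (q j)))\<^sup>2 \<le> (\<Sum>i<k. (cmod (cinner (q i) (q j)))\<^sup>2)"
    using assms(2) by (intro member_le_sum) auto
  also have "\<dots> \<le> (norm (q j))\<^sup>2" using assms(1) by (simp add: bessel_family_def)
  finally have "((norm (q j))\<^sup>2)\<^sup>2 \<le> (norm (q j))\<^sup>2"
    by (simp add: cinner_self norm_power)
  then have "(norm (q j))\<^sup>2 \<le> 1"
    by (cases "norm (q j) = 0") (auto simp: power2_eq_square)
  then show ?thesis by (simp add: abs_square_le_1)
qed

lemma bessel_family_pair:
  fixes u v :: "nat \<Rightarrow> 'a::complex_hilbert"
  assumes "bessel_family k u" "bessel_family k v"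
  shows "bessel_family k (\<lambda>j. (1 / sqrt 2) *\<^sub>R (u j, v j))"
  unfolding bessel_family_def
proof
  fix w :: "'a \<times> 'a"
  have "(cmod (cinner ((1 / sqrt 2) *\<^sub>R (u j, v j)) w))\<^sup>2
      \<le> (cmod (cinner (u j) (fst w)))\<^sup>2 + (cmod (cinner (v j) (snd w)))\<^sup>2" for j
  proof -
    have "(cmod (cinner ((1 / sqrt 2) *\<^sub>R (u j, v j)) w))\<^sup>2
        = (cmod (cinner (u j) (fst w) + cinner (v j) (snd w)))\<^sup>2 / 2"
      unfolding cinner_scaleR_left norm_mult power_mult_distrib
      by (simp add: cinner_prod_def norm_divide power_divide)
    also have "\<dots> \<le> (cmod (cinner (u j) (fst w)) + cmod (cinner (v j) (snd w)))\<^sup>2 / 2"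
      by (intro divide_right_mono power_mono norm_triangle_ineq) auto
    also have "\<dots> \<le> (cmod (cinner (u j) (fst w)))\<^sup>2 + (cmod (cinner (v j) (snd w)))\<^sup>2"
      using sum_squares_bound[of "cmod (cinner (u j) (fst w))" "cmod (cinner (v j) (snd w))"]
      by (simp add: power2_sum)
    finally show ?thesis .
  qed
  then have "(\<Sum>j<k. (cmod (cinner ((1 / sqrt 2) *\<^sub>R (u j, v j)) w))\<^sup>2)
      \<le> (\<Sum>j<k. (cmod (cinner (u j) (fst w)))\<^sup>2) + (\<Sum>j<k. (cmod (cinner (v j) (snd w)))\<^sup>2)"
    unfolding sum.distrib[symmetric] by (intro sum_mono) auto
  also have "\<dots> \<le> (norm (fst w))\<^sup>2 + (norm (snd w))\<^sup>2"
    using assms by (auto simp: bessel_family_def intro!: add_mono)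
  also have "\<dots> = (norm w)\<^sup>2"
    by (simp add: norm_prod_def)
  finally show "(\<Sum>j<k. (cmod (cinner ((1 / sqrt 2) *\<^sub>R (u j, v j)) w))\<^sup>2) \<le> (norm w)\<^sup>2" .
qed

section \<open>Adjoints\<close>

text \<open>
  The representing vector minimises \<open>(norm x)\<^sup>2 - 2 * f x\<close>: by the parallelogram identity
  every minimising sequence is Cauchy.
\<close>

lemma riesz_representation:
  fixes f :: "'a::{real_inner, complete_space} \<Rightarrow> real"
  assumes "bounded_linear f"
  obtains y where "\<And>x. f x = inner y x"
proof -
  interpret f: bounded_linear f by fact
  define J where "J x = (norm x)\<^sup>2 - 2 * f x" for x
  obtain K where K: "\<And>x. \<bar>f x\<bar> \<le> norm x * K"
    using f.bounded by (auto simp: real_norm_def)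
  have J_lower: "- K\<^sup>2 \<le> J x" for x
  proof -
    have "0 \<le> (norm x - K)\<^sup>2" by simp
    moreover have "f x \<le> norm x * K" using K[of x] by simp
    ultimately show ?thesis by (simp add: J_def power2_diff)
  qed
  define m where "m = Inf (range J)"
  have bdd: "bdd_below (range J)" using J_lower by (auto intro!: bdd_belowI)
  have m_le: "m \<le> J x" for x unfolding m_def using bdd by (simp add: cInf_lower)
  have "\<exists>x. J x < m + 1 / (real n + 1)" for n
  proof -
    have "Inf (range J) < m + 1 / (real n + 1)" by (simp add: m_def)
    then show ?thesis by (subst (asm) cInf_less_iff) (use bdd in auto)
  qed
  then obtain X where X: "\<And>n. J (X n) < m + 1 / (real n + 1)" by metis
  have par: "(norm (x - y))\<^sup>2 \<le> 2 * (J x - m) + 2 * (J y - m)" for x y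
  proof -
    have "(norm (x - y))\<^sup>2 = 2 * J x + 2 * J y - 4 * J ((1/2) *\<^sub>R (x + y))"
      by (simp add: J_def f.scaleR f.add power2_norm_eq_inner inner_diff_left inner_diff_right
          inner_add_left inner_add_right inner_commute field_simps)
    with m_le[of "(1/2) *\<^sub>R (x + y)"] show ?thesis by simp
  qed
  have "Cauchy X"
  proof (rule CauchyI)
    fix e :: real assume "0 < e"
    then obtain N where N: "4 / e\<^sup>2 < real N"
      using reals_Archimedean2 by blast
    show "\<exists>M. \<forall>m\<ge>M. \<forall>n\<ge>M. norm (X m - X n) < e"
    proof (intro exI allI impI)
      fix i j assume ij: "N \<le> i" "N \<le> j"
      have small: "J (X n) - m < e\<^sup>2 / 4" if "N \<le> n" for n
      proof -
        have "4 / e\<^sup>2 < real n + 1" using N that by linarith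
        then have "1 / (real n + 1) < e\<^sup>2 / 4" using \<open>0 < e\<close>
          by (simp add: field_simps)
        with X[of n] show ?thesis by linarith
      qed
      have "(norm (X i - X j))\<^sup>2 < e\<^sup>2"
        using par[of "X i" "X j"] small[OF ij(1)] small[OF ij(2)] by argo
      then show "norm (X i - X j) < e" using \<open>0 < e\<close> by (simp add: power2_less_imp_less)
    qed
  qed
  then obtain y where y: "X \<longlonglongrightarrow> y" using Cauchy_convergent convergent_def by blast
  have "(\<lambda>n. J (X n)) \<longlonglongrightarrow> J y"
    unfolding J_def by (intro tendsto_intros y f.tendsto)
  moreover have "(\<lambda>n. m + 1 / (real n + 1)) \<longlonglongrightarrow> m"
    using tendsto_add[OF tendsto_const LIMSEQ_inverse_real_of_nat, of m]
    by (simp add: inverse_eq_divide add.commute)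
  ultimately have "J y \<le> m" using X by (meson LIMSEQ_le less_imp_le)
  then have Jy: "J y \<le> J x" for x using m_le[of x] by linarith
  have "f z = inner y z" for z
  proof (cases "z = 0")
    case False
    define d where "d = inner y z - f z"
    define t where "t = - d / (norm z)\<^sup>2"
    have z: "(norm z)\<^sup>2 \<noteq> 0" using False by simp
    have "J (y + t *\<^sub>R z) = J y + 2 * t * d + t\<^sup>2 * (norm z)\<^sup>2"
      unfolding J_def d_def
      unfolding power2_norm_eq_inner
      by (simp add: f.scaleR f.add inner_add_left inner_add_right
          inner_commute power2_eq_square algebra_simps)
    also have "\<dots> = J y - d\<^sup>2 / (norm z)\<^sup>2"
      unfolding t_def using z by (simp add: field_simps power2_eq_square)
    finally have "d\<^sup>2 / (norm z)\<^sup>2 \<le> 0" using Jy[of "y + t *\<^sub>R z"] by simp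
    then have "d\<^sup>2 \<le> 0" using z by (simp add: divide_le_0_iff)
    then show ?thesis by (simp add: d_def)
  qed (simp add: f.zero)
  then show thesis by (rule that)
qed

lemma cinner_ext:
  assumes "\<And>x. cinner x u = cinner x (v::'a::complex_hilbert)"
  shows "u = v"
  using assms by (intro cinner_eqI_inner) (simp add: inner_eq_Re_cinner)

lemma bounded_opsD: "T \<in> bounded_ops \<Longrightarrow> blinfun_apply T (c *\<^sub>C x) = c *\<^sub>C blinfun_apply T x"
  by (simp add: bounded_ops_def)

lemma adjoint_exists:
  assumes T: "T \<in> bounded_ops"
  obtains S where "S \<in> bounded_ops"
    "\<And>x y. cinner (blinfun_apply T x) y = cinner x (blinfun_apply S y)"
proof -
  have "\<exists>z. \<forall>x. inner (T x) y = inner z x" for y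
    by (rule riesz_representation[of "\<lambda>x. inner (T x) y"])
      (auto intro!: bounded_linear_intros)
  then obtain S where S: "\<And>x y. inner (T x) y = inner (S y) x" by metis
  have S_eqI: "S y = z" if "\<And>x. inner (T x) y = inner x z" for y z
    using S that by (intro cinner_eqI_inner) (simp add: inner_commute)
  have "bounded_linear S"
  proof (rule bounded_linear_intro[where K = "norm T"])
    show "S (x + y) = S x + S y" for x y
      by (rule S_eqI) (simp add: inner_add_right S, simp add: inner_commute)
    show "S (r *\<^sub>R x) = r *\<^sub>R S x" for r x
      by (rule S_eqI) (simp add: S, simp add: inner_commute)
    fix y
    have "(norm (S y))\<^sup>2 = inner (T (S y)) y" by (simp add: S power2_norm_eq_inner)
    also have "\<dots> \<le> norm (T (S y)) * norm y" by (rule norm_cauchy_schwarz)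
    also have "\<dots> \<le> norm T * norm (S y) * norm y"
      by (intro mult_right_mono norm_blinfun) auto
    finally show "norm (S y) \<le> norm y * norm T"
      by (cases "norm (S y) = 0") (simp_all add: power2_eq_square mult_ac)
  qed
  then have ap: "blinfun_apply (Blinfun S) = S" by (rule bounded_linear_Blinfun_apply)
  have adj: "cinner (T x) y = cinner x (S y)" for x y
  proof (rule complex_eqI)
    show "Re (cinner (T x) y) = Re (cinner x (S y))"
      using S[of x y] by (simp add: inner_eq_Re_cinner[symmetric] inner_commute)
    show "Im (cinner (T x) y) = Im (cinner x (S y))"
      using S[of "\<i> *\<^sub>C x" y] by (simp add: Im_cinner bounded_opsD[OF T] inner_commute)
  qed
  have "S (c *\<^sub>C y) = c *\<^sub>C S y" for c y
    by (rule cinner_ext) (simp add: adj[symmetric] cinner_scaleC_right)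
  then have "Blinfun S \<in> bounded_ops" by (simp add: bounded_ops_def ap)
  with adj ap show thesis by (intro that[of "Blinfun S"]) auto
qed

lemma
  assumes T: "T \<in> bounded_ops"
  shows cadjoint_bounded_ops: "cadjoint T \<in> bounded_ops"
    and cinner_cadjoint: "cinner (blinfun_apply T x) y = cinner x (blinfun_apply (cadjoint T) y)"
proof -
  obtain S where S: "S \<in> bounded_ops" "\<And>x y. cinner (T x) y = cinner x (S y)"
    using adjoint_exists[OF T] by metis
  have "cadjoint T = S"
    unfolding cadjoint_def
  proof (rule the_equality)
    fix S' assume S': "\<forall>x y. cinner (blinfun_apply T x) y = cinner x (blinfun_apply S' y)"
    show "S' = S" by (rule blinfun_eqI, rule cinner_ext) (use S' S in simp)
  qed (simp add: S)
  with S show "cadjoint T \<in> bounded_ops" "cinner (T x) y = cinner x (cadjoint T y)" by auto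
qed

lemma cinner_cadjoint': 
  "T \<in> bounded_ops \<Longrightarrow> cinner x (blinfun_apply T y) = cinner (blinfun_apply (cadjoint T) x) y"
  by (metis cinner_cadjoint cinner_commute)

lemma norm_cadjoint_apply_le:
  assumes T: "T \<in> bounded_ops"
  shows "norm (cadjoint T y) \<le> norm T * norm y"
proof -
  let ?z = "cadjoint T y"
  have "(norm ?z)\<^sup>2 = inner (T ?z) y"
    by (simp add: inner_eq_Re_cinner cinner_cadjoint[OF T] cinner_self)
  also have "\<dots> \<le> norm (T ?z) * norm y" by (rule norm_cauchy_schwarz)
  also have "\<dots> \<le> norm T * norm ?z * norm y"
    by (intro mult_right_mono norm_blinfun) auto
  finally show ?thesis
    by (cases "norm ?z = 0") (simp_all add: power2_eq_square mult_ac)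
qed

lemma bounded_ops_compose: "S \<in> bounded_ops \<Longrightarrow> T \<in> bounded_ops \<Longrightarrow> S o\<^sub>L T \<in> bounded_ops"
  by (simp add: bounded_ops_def)

lemma bounded_ops_add: "S \<in> bounded_ops \<Longrightarrow> T \<in> bounded_ops \<Longrightarrow> S + T \<in> bounded_ops"
  by (simp add: bounded_ops_def blinfun.add_left scaleC_add_right)

lemma bounded_ops_scaleR: "T \<in> bounded_ops \<Longrightarrow> r *\<^sub>R T \<in> bounded_ops"
  by (simp add: bounded_ops_def blinfun.scaleR_left scaleR_scaleC_commute)

definition selfadjoint_ops :: "('a::complex_hilbert \<Rightarrow>\<^sub>L 'a) set" where
  "selfadjoint_ops = {T \<in> bounded_ops.
     \<forall>x y. cinner (blinfun_apply T x) y = cinner x (blinfun_apply T y)}"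

lemma selfadjoint_opsD:
  assumes "T \<in> selfadjoint_ops"
  shows "T \<in> bounded_ops" "cinner (blinfun_apply T x) y = cinner x (blinfun_apply T y)"
    "inner (blinfun_apply T x) y = inner x (blinfun_apply T y)"
  using assms by (auto simp: selfadjoint_ops_def inner_eq_Re_cinner)

text \<open>Polarization: a sesquilinear form that vanishes on the diagonal is zero.\<close>

lemma positive_ops_selfadjoint:
  assumes T: "T \<in> positive_ops"
  shows "T \<in> selfadjoint_ops"
proof -
  have Tb: "T \<in> bounded_ops" and pos: "\<And>x. cinner x (T x) \<in> \<real>\<^sub>\<ge>\<^sub>0"
    using T by (auto simp: positive_ops_def)
  define h where "h x y = cinner x (T y) - cinner (T x) y" for x y
  have diag: "h x x = 0" for x
    using pos[of x] cinner_commute[of "T x" x]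
    by (simp add: h_def complex_nonneg_Reals_iff complex_eq_iff)
  have add: "h (x + y) (x + y) = h x x + h x y + h y x + h y y" for x y
    by (simp add: h_def blinfun.add_right cinner_add_left cinner_add_right)
  have 1: "h x y + h y x = 0" for x y using add[of x y] by (simp add: diag)
  have "h x (\<i> *\<^sub>C y) = \<i> * h x y" "h (\<i> *\<^sub>C y) x = - \<i> * h y x" for x y
    by (simp_all add: h_def bounded_opsD[OF Tb] cinner_scaleC_left cinner_scaleC_right
        algebra_simps)
  with 1[of _ "\<i> *\<^sub>C _"] have 2: "\<i> * (h x y - h y x) = 0" for x y
    by (metis (no_types, opaque_lifting) add_uminus_conv_diff mult_minus_left right_diff_distrib)
  have "h x y = 0" for x y
  proof -
    have "h x y = h y x" using 2[of x y] by simp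
    with 1[of x y] show ?thesis by simp
  qed
  then show ?thesis by (simp add: selfadjoint_ops_def Tb h_def)
qed

lemma positive_ops_inner_nonneg:
  assumes "T \<in> positive_ops"
  shows "0 \<le> inner x (blinfun_apply T x)"
  using assms by (auto simp: positive_ops_def inner_eq_Re_cinner complex_nonneg_Reals_iff)

lemma positive_opsI:
  fixes T :: "'a::complex_hilbert \<Rightarrow>\<^sub>L 'a"
  assumes "T \<in> bounded_ops" "\<And>x. \<exists>y::'a. cinner x (blinfun_apply T x) = cinner y y"
  shows "T \<in> positive_ops"
  unfolding positive_ops_def
proof (intro CollectI conjI allI)
  fix x
  obtain y :: 'a where "cinner x (T x) = cinner y y" using assms(2)[of x] by blast
  then show "cinner x (T x) \<in> \<real>\<^sub>\<ge>\<^sub>0" by (simp add: cinner_self complex_nonneg_Reals_iff flip: of_real_power)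
qed (fact assms(1))

section \<open>Functional calculus of positive operators\<close>

lemma poly_blinfun_pCons:
  "poly_blinfun (pCons a p) T = a *\<^sub>R id_blinfun + (T o\<^sub>L poly_blinfun p T)"
proof -
  let ?w = "\<lambda>i. ((\<lambda>S. T o\<^sub>L S) ^^ i) id_blinfun"
  have "poly_blinfun (pCons a p) T = (\<Sum>i\<le>Suc (degree p). coeff (pCons a p) i *\<^sub>R ?w i)"
    unfolding poly_blinfun_def
    by (rule sum.mono_neutral_left)
      (use degree_pCons_le[of a p] in \<open>auto simp: not_le intro: coeff_eq_0\<close>)
  also have "\<dots> = a *\<^sub>R id_blinfun + (\<Sum>i\<le>degree p. coeff p i *\<^sub>R (T o\<^sub>L ?w i))"
    unfolding sum.atMost_Suc_shift by simp
  also have "(\<Sum>i\<le>degree p. coeff p i *\<^sub>R (T o\<^sub>L ?w i)) = T o\<^sub>L poly_blinfun p T"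
    unfolding poly_blinfun_def
    by (simp add: bounded_bilinear.sum_right[OF bounded_bilinear_blinfun_compose]
        bounded_bilinear.scaleR_right[OF bounded_bilinear_blinfun_compose])
  finally show ?thesis .
qed

lemma poly_blinfun_0 [simp]: "poly_blinfun 0 T = 0"
  by (simp add: poly_blinfun_def)

lemma poly_blinfun_pCons_apply:
  "poly_blinfun (pCons a p) T x = a *\<^sub>R x + T (poly_blinfun p T x)"
  by (simp add: poly_blinfun_pCons blinfun.add_left blinfun.scaleR_left)

lemma poly_blinfun_add: "poly_blinfun (p + q) T = poly_blinfun p T + poly_blinfun q T"
  by (induction p q rule: poly_induct2)
    (auto intro!: blinfun_eqI simp: poly_blinfun_pCons_apply blinfun.add_left blinfun.add_right
      scaleR_add_left)

lemma poly_blinfun_smult: "poly_blinfun (smult c p) T = c *\<^sub>R poly_blinfun p T"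
  by (induction p)
    (auto intro!: blinfun_eqI simp: poly_blinfun_pCons_apply blinfun.scaleR_left
      blinfun.scaleR_right scaleR_add_right)

lemma poly_blinfun_diff: "poly_blinfun (p - q) T = poly_blinfun p T - poly_blinfun q T"
  using poly_blinfun_add[of p "smult (-1) q" T] unfolding poly_blinfun_smult by simp

lemma poly_blinfun_mult: "poly_blinfun (p * q) T = poly_blinfun p T o\<^sub>L poly_blinfun q T"
  by (induction p)
    (auto intro!: blinfun_eqI simp: poly_blinfun_add poly_blinfun_smult poly_blinfun_pCons_apply
      blinfun.add_left blinfun.scaleR_left)

lemma poly_blinfun_selfadjoint:
  assumes A: "A \<in> selfadjoint_ops"
  shows "poly_blinfun p A \<in> selfadjoint_ops"
proof -
  note A' = selfadjoint_opsD[OF A]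
  have comm: "A (poly_blinfun p A x) = poly_blinfun p A (A x)" for p x
    by (induction p) (simp_all add: poly_blinfun_pCons_apply blinfun.add_right blinfun.scaleR_right)
  have "poly_blinfun p A \<in> bounded_ops"
    by (induction p)
      (auto simp: bounded_ops_def poly_blinfun_pCons_apply bounded_opsD[OF A'(1)]
        scaleR_scaleC_commute scaleC_add_right)
  moreover have "cinner (poly_blinfun p A x) y = cinner x (poly_blinfun p A y)" for x y
    by (induction p arbitrary: x y)
      (simp_all add: poly_blinfun_pCons_apply cinner_add_left cinner_add_right
        cinner_scaleR_left cinner_scaleR_right A'(2) comm)
  ultimately show ?thesis by (simp add: selfadjoint_ops_def)
qed

lemma poly_of_real_of_real:
  "poly (map_poly complex_of_real p) (of_real x) = of_real (poly p x)"
  by (induction p) (auto simp: map_poly_pCons)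

lemma poly_of_real_add:
  "poly (map_poly complex_of_real (p + q)) z
    = poly (map_poly complex_of_real p) z + poly (map_poly complex_of_real q) z"
  by (induction p q rule: poly_induct2) (auto simp: map_poly_pCons algebra_simps)

lemma poly_of_real_mult:
  "poly (map_poly complex_of_real (p * q)) z
    = poly (map_poly complex_of_real p) z * poly (map_poly complex_of_real q) z"
  by (induction p) (auto simp: map_poly_pCons poly_of_real_add map_poly_smult algebra_simps)

text \<open>
  The spectrum of a positive operator lies in \<open>{0..norm A}\<close>, in the following form: a polynomial
  without zeros there is bounded below on \<open>A\<close>. It suffices to treat its irreducible factors:
  linear ones with a root outside the interval, and quadratic ones \<open>(t - a)\<^sup>2 + b\<^sup>2\<close> with \<open>b \<noteq> 0\<close>,
  for which self-adjointness gives the lower bound \<open>b\<^sup>2\<close>.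
\<close>

lemma poly_blinfun_bounded_below:
  assumes A: "A \<in> positive_ops"
    and q: "\<And>t. 0 \<le> t \<Longrightarrow> t \<le> norm A \<Longrightarrow> poly q t \<noteq> 0"
  shows "\<exists>\<delta>>0. \<forall>x. \<delta> * norm x \<le> norm (poly_blinfun q A x)"
  using q
proof (induction "degree q" arbitrary: q rule: less_induct)
  case less
  note sa = positive_ops_selfadjoint[OF A]
  have prod: "\<exists>\<delta>>0. \<forall>x. \<delta> * norm x \<le> norm (poly_blinfun (d * q') A x)"
    if d: "\<exists>\<delta>>0. \<forall>x. \<delta> * norm x \<le> norm (poly_blinfun d A x)"
      and q': "\<exists>\<delta>>0. \<forall>x. \<delta> * norm x \<le> norm (poly_blinfun q' A x)" for d q'
  proof -
    obtain d1 where 1: "d1 > 0" "\<And>x. d1 * norm x \<le> norm (poly_blinfun d A x)" using d by blast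
    obtain d2 where 2: "d2 > 0" "\<And>x. d2 * norm x \<le> norm (poly_blinfun q' A x)" using q' by blast
    have "d1 * d2 * norm x \<le> norm (poly_blinfun (d * q') A x)" for x
    proof -
      have "d1 * (d2 * norm x) \<le> d1 * norm (poly_blinfun q' A x)"
        using 1 2 by simp
      also have "\<dots> \<le> norm (poly_blinfun (d * q') A x)"
        using 1(2)[of "poly_blinfun q' A x"] by (simp add: poly_blinfun_mult)
      finally show ?thesis by (simp add: mult.assoc)
    qed
    then show ?thesis using 1 2 by (intro exI[of _ "d1 * d2"]) simp
  qed
  have factor: ?case
    if "q = d * q'" "degree d > 0" "\<exists>\<delta>>0. \<forall>x. \<delta> * norm x \<le> norm (poly_blinfun d A x)" for d q'
  proof -
    have "q \<noteq> 0" using less.prems[of 0] by auto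
    then have "degree q' < degree q"
      using that by (auto simp: degree_mult_eq)
    moreover have "poly q' t \<noteq> 0" if "0 \<le> t" "t \<le> norm A" for t
      using less.prems[OF that] \<open>q = d * q'\<close> by auto
    ultimately show ?thesis using less.hyps[of q'] that prod by blast
  qed
  show ?case
  proof (cases "degree q = 0")
    case True
    then obtain c where c: "q = [:c:]" by (meson degree_eq_zeroE)
    moreover have "c \<noteq> 0" using less.prems[of 0] c by simp
    ultimately show ?thesis
      by (intro exI[of _ "\<bar>c\<bar>"]) (simp add: poly_blinfun_pCons_apply)
  next
    case False
    let ?cp = "map_poly complex_of_real q"
    have "degree ?cp \<noteq> 0" using False by (simp add: degree_map_poly)
    then have "\<not> constant (poly ?cp)" by (simp add: constant_degree)
    then obtain z where z: "poly ?cp z = 0" using fundamental_theorem_of_algebra by blast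
    show ?thesis
    proof (cases "Im z = 0")
      case True
      define r where "r = Re z"
      have "z = of_real r" using True by (simp add: r_def complex_eq_iff)
      then have root: "poly q r = 0"
        using z by (simp add: poly_of_real_of_real)
      then obtain q' where q': "q = [:- r, 1:] * q'"
        using poly_eq_0_iff_dvd by (metis dvdE)
      have ap: "poly_blinfun [:- r, 1:] A x = A x - r *\<^sub>R x" for x
        by (simp add: poly_blinfun_pCons_apply)
      have "r < 0 \<or> norm A < r" using less.prems[of r] root by force
      then have "\<exists>\<delta>>0. \<forall>x. \<delta> * norm x \<le> norm (poly_blinfun [:- r, 1:] A x)"
      proof
        assume r: "r < 0"
        have "- r * norm x \<le> norm (A x - r *\<^sub>R x)" for x
        proof (cases "x = 0")
          case False
          have "- r * (norm x * norm x) \<le> inner x (A x - r *\<^sub>R x)"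
            using positive_ops_inner_nonneg[OF A, of x]
            by (simp add: inner_diff_right dot_square_norm power2_eq_square)
          also have "\<dots> \<le> norm x * norm (A x - r *\<^sub>R x)" by (rule norm_cauchy_schwarz)
          finally have "norm x * (- r * norm x) \<le> norm x * norm (A x - r *\<^sub>R x)"
            by (simp add: mult_ac)
          then show ?thesis using False by (metis mult_left_le_imp_le zero_less_norm_iff)
        qed simp
        then show ?thesis unfolding ap using r by (intro exI[of _ "- r"]) auto
      next
        assume r: "norm A < r"
        have "(r - norm A) * norm x \<le> norm (A x - r *\<^sub>R x)" for x
        proof -
          have "0 < r" using r norm_ge_zero[of A] by linarith
          then have "r * norm x = norm (r *\<^sub>R x)" by simp
          also have "\<dots> \<le> norm (A x - r *\<^sub>R x) + norm (A x)"
            by (metis norm_minus_commute norm_triangle_sub add.commute)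
          finally show ?thesis using norm_blinfun[of A x] by (simp add: left_diff_distrib)
        qed
        then show ?thesis unfolding ap using r by (intro exI[of _ "r - norm A"]) auto
      qed
      then show ?thesis using factor[OF q'] by simp
    next
      case False
      define a b where "a = Re z" and "b = Im z"
      define d where "d = [:a\<^sup>2 + b\<^sup>2, - 2 * a, 1:]"
      have dz: "poly (map_poly complex_of_real d) z = 0"
        by (simp add: d_def a_def b_def map_poly_pCons complex_eq_iff power2_eq_square algebra_simps)
      define r where "r = q mod d"
      have "degree r < 2"
        using degree_mod_less[of d q] by (auto simp: r_def d_def)
      then obtain r0 r1 where r: "r = [:r0, r1:]"
        by (metis degree_eq_zeroE less_2_cases_iff degree1_coeffs One_nat_def pCons_0_0)
      have "q = d * (q div d) + r" by (simp add: r_def)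
      then have "poly ?cp z = poly (map_poly complex_of_real (d * (q div d) + r)) z" by simp
      also have "\<dots> = poly (map_poly complex_of_real r) z"
        by (simp add: poly_of_real_add poly_of_real_mult dz)
      finally have "of_real r0 + z * of_real r1 = 0" using z r by (simp add: map_poly_pCons)
      then have "r1 = 0" "r0 = 0" using False by (auto simp: complex_eq_iff)
      with r have q': "q = d * (q div d)" using \<open>q = d * (q div d) + r\<close> by simp
      have "b\<^sup>2 * norm x \<le> norm (poly_blinfun d A x)" for x
      proof (cases "x = 0")
        case False
        have ap: "poly_blinfun d A x = A (A x) - (2 * a) *\<^sub>R A x + (a\<^sup>2 + b\<^sup>2) *\<^sub>R x"
          by (simp add: d_def poly_blinfun_pCons_apply blinfun.add_right blinfun.diff_right
              blinfun.scaleR_right blinfun.minus_right)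
        have "inner x (poly_blinfun d A x) = inner (A x - a *\<^sub>R x) (A x - a *\<^sub>R x) + b\<^sup>2 * inner x x"
          unfolding ap
          by (simp add: inner_diff_left inner_diff_right inner_add_right selfadjoint_opsD(3)[OF sa]
              inner_commute power2_eq_square algebra_simps)
        then have "b\<^sup>2 * (norm x * norm x) \<le> inner x (poly_blinfun d A x)"
          by (simp add: dot_square_norm power2_eq_square)
        also have "\<dots> \<le> norm x * norm (poly_blinfun d A x)" by (rule norm_cauchy_schwarz)
        finally have "norm x * (b\<^sup>2 * norm x) \<le> norm x * norm (poly_blinfun d A x)"
          by (simp add: mult_ac)
        then show ?thesis using False by (metis mult_left_le_imp_le zero_less_norm_iff)
      qed simp
      moreover have "b\<^sup>2 > 0" using False by (simp add: b_def)
      ultimately have "\<exists>\<delta>>0. \<forall>x. \<delta> * norm x \<le> norm (poly_blinfun d A x)" by blast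
      then show ?thesis by (intro factor[OF q']) (simp_all add: d_def)
    qed
  qed
qed

text \<open>
  Spectral radius argument: if \<open>N = norm (p(A))\<close> exceeded the bound, then \<open>p\<^sup>2 - N\<^sup>2\<close> would have no
  zero on the spectrum, although \<open>p(A)\<^sup>2 - N\<^sup>2\<close> is not bounded below.
\<close>

lemma norm_poly_blinfun_le:
  assumes A: "A \<in> positive_ops"
    and p: "\<And>t. 0 \<le> t \<Longrightarrow> t \<le> norm A \<Longrightarrow> \<bar>poly p t\<bar> \<le> M"
  shows "norm (poly_blinfun p A) \<le> M"
proof (rule ccontr)
  define S where "S = poly_blinfun p A"
  define N where "N = norm S"
  assume "\<not> norm (poly_blinfun p A) \<le> M"
  then have NM: "M < N" by (simp add: N_def S_def)
  have "0 \<le> M" using p[of 0] by auto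
  with NM have N0: "0 < N" by simp
  note S_sa = poly_blinfun_selfadjoint[OF positive_ops_selfadjoint[OF A], of p, folded S_def]
  define q where "q = p * p - [:N\<^sup>2:]"
  have "poly q t \<noteq> 0" if "0 \<le> t" "t \<le> norm A" for t
  proof -
    have "\<bar>poly p t\<bar>\<^sup>2 < N\<^sup>2"
      using p[OF that] NM by (intro power_strict_mono) auto
    then show ?thesis by (simp add: q_def power2_eq_square)
  qed
  then obtain \<delta> where \<delta>: "\<delta> > 0" "\<And>x. \<delta> * norm x \<le> norm (poly_blinfun q A x)"
    using poly_blinfun_bounded_below[OF A, of q] by blast
  have ap: "poly_blinfun q A x = S (S x) - N\<^sup>2 *\<^sub>R x" for x
    by (simp add: q_def poly_blinfun_diff poly_blinfun_mult S_def poly_blinfun_pCons_apply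
        blinfun.diff_left)
  define K where "K = max (N\<^sup>2 - \<delta>\<^sup>2 / N\<^sup>2) 0"
  have "(norm (S x))\<^sup>2 \<le> K * (norm x)\<^sup>2" for x
  proof -
    have "(\<delta> * norm x)\<^sup>2 \<le> (norm (S (S x) - N\<^sup>2 *\<^sub>R x))\<^sup>2"
      using \<delta>(2)[of x] \<delta>(1) unfolding ap by (intro power_mono) auto
    also have "\<dots> = (norm (S (S x)))\<^sup>2 - 2 * N\<^sup>2 * (norm (S x))\<^sup>2 + N\<^sup>2 * N\<^sup>2 * (norm x)\<^sup>2"
      unfolding power2_norm_eq_inner
      by (simp add: inner_diff_left inner_diff_right selfadjoint_opsD(3)[OF S_sa] inner_commute
          algebra_simps)
    also have "\<dots> \<le> N\<^sup>2 * (norm (S x))\<^sup>2 - 2 * N\<^sup>2 * (norm (S x))\<^sup>2 + N\<^sup>2 * N\<^sup>2 * (norm x)\<^sup>2"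
      using norm_blinfun[of S "S x"]
      by (simp add: N_def power_mono flip: power_mult_distrib)
    finally have "N\<^sup>2 * (norm (S x))\<^sup>2 \<le> (N\<^sup>2 * N\<^sup>2 - \<delta>\<^sup>2) * (norm x)\<^sup>2"
      by (simp add: algebra_simps power_mult_distrib)
    also have "\<dots> = N\<^sup>2 * ((N\<^sup>2 - \<delta>\<^sup>2 / N\<^sup>2) * (norm x)\<^sup>2)"
      using N0 by (simp add: field_simps)
    finally have "(norm (S x))\<^sup>2 \<le> (N\<^sup>2 - \<delta>\<^sup>2 / N\<^sup>2) * (norm x)\<^sup>2"
      using N0 by simp
    also have "\<dots> \<le> K * (norm x)\<^sup>2" by (intro mult_right_mono) (auto simp: K_def)
    finally show ?thesis .
  qed
  then have "norm (S x) \<le> sqrt K * norm x" for x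
    by (metis norm_ge_zero real_le_rsqrt real_sqrt_abs real_sqrt_mult abs_of_nonneg)
  then have "N \<le> sqrt K"
    unfolding N_def by (intro norm_blinfun_bound) (auto simp: K_def)
  then have "N\<^sup>2 \<le> K" using N0 by (metis K_def less_imp_le max.cobounded2 power_mono real_sqrt_pow2)
  moreover have "K < N\<^sup>2" using N0 \<delta>(1) by (auto simp: K_def)
  ultimately show False by simp
qed

lemma norm_poly_blinfun_diff_le:
  assumes A: "A \<in> positive_ops"
    and "\<And>t. t \<in> {0..norm A} \<Longrightarrow> dist (poly p t) (poly q t) \<le> M"
  shows "dist (poly_blinfun p A) (poly_blinfun q A) \<le> M"
  unfolding dist_norm poly_blinfun_diff[symmetric]
  by (rule norm_poly_blinfun_le[OF A]) (use assms(2) in \<open>auto simp: dist_real_def\<close>)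

lemma uniform_limit_poly_exists:
  fixes f :: "real \<Rightarrow> real"
  assumes "continuous_on {a..b} f"
  obtains p where "uniform_limit {a..b} (\<lambda>n. poly (p n)) f sequentially"
proof -
  have "\<exists>p. \<forall>x\<in>{a..b}. dist (poly p x) (f x) < 1 / real (Suc n)" for n
  proof -
    obtain h where h: "real_polynomial_function h" "\<And>x. x \<in> {a..b} \<Longrightarrow> \<bar>f x - h x\<bar> < 1 / real (Suc n)"
      using Stone_Weierstrass_real_polynomial_function[OF compact_Icc assms, of "1 / real (Suc n)"]
      by auto
    then obtain c m where "h = (\<lambda>x. \<Sum>i\<le>m::nat. c i * x ^ i)"
      by (auto simp: real_polynomial_function_iff_sum)
    then have "poly (\<Sum>i\<le>m. monom (c i) i) x = h x" for x
      by (simp add: poly_sum poly_monom)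
    with h(2) show ?thesis
      by (intro exI[of _ "\<Sum>i\<le>m. monom (c i) i"]) (simp add: dist_real_def abs_minus_commute)
  qed
  then obtain p where p: "\<And>n x. x \<in> {a..b} \<Longrightarrow> dist (poly (p n) x) (f x) < 1 / real (Suc n)"
    by metis
  have "uniform_limit {a..b} (\<lambda>n. poly (p n)) f sequentially"
  proof (rule uniform_limitI)
    fix e :: real assume "e > 0"
    then obtain N where N: "inverse (real (Suc N)) < e" using reals_Archimedean by blast
    have "dist (poly (p n) x) (f x) < e" if "n \<ge> N" "x \<in> {a..b}" for n x
    proof -
      have "1 / real (Suc n) \<le> inverse (real (Suc N))"
        using that by (simp add: inverse_eq_divide frac_le)
      with p[OF that(2), of n] N show ?thesis by linarith
    qed
    then show "\<forall>\<^sub>F n in sequentially. \<forall>x\<in>{a..b}. dist (poly (p n) x) (f x) < e"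
      unfolding eventually_sequentially by blast
  qed
  then show thesis by (rule that)
qed

lemma fun_calc_tendsto:
  assumes A: "A \<in> positive_ops" and f: "continuous_on {0..norm A} f"
    and p: "uniform_limit {0..norm A} (\<lambda>n. poly (p n)) f sequentially"
  shows "(\<lambda>n. poly_blinfun (p n) A) \<longlonglongrightarrow> fun_calc f A"
proof -
  let ?I = "{0..norm A}"
  obtain q where q: "uniform_limit ?I (\<lambda>n. poly (q n)) f sequentially"
    using uniform_limit_poly_exists[OF f] .
  have "Cauchy (\<lambda>n. poly_blinfun (q n) A)"
  proof (rule metric_CauchyI)
    fix e :: real assume e: "e > 0"
    have "uniformly_Cauchy_on ?I (\<lambda>n. poly (q n))"
      using q uniformly_convergent_Cauchy uniformly_convergent_on_def by blast
    then obtain M where M: "\<And>m n x. m \<ge> M \<Longrightarrow> n \<ge> M \<Longrightarrow> x \<in> ?I \<Longrightarrow> dist (poly (q m) x) (poly (q n) x) < e / 2"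
      unfolding uniformly_Cauchy_on_def using e by (meson half_gt_zero)
    show "\<exists>M. \<forall>m\<ge>M. \<forall>n\<ge>M. dist (poly_blinfun (q m) A) (poly_blinfun (q n) A) < e"
    proof (intro exI allI impI)
      fix m n assume mn: "M \<le> m" "M \<le> n"
      have "dist (poly_blinfun (q m) A) (poly_blinfun (q n) A) \<le> e / 2"
        by (rule norm_poly_blinfun_diff_le[OF A]) (use M[OF mn] in \<open>auto intro: less_imp_le\<close>)
      then show "dist (poly_blinfun (q m) A) (poly_blinfun (q n) A) < e" using e by simp
    qed
  qed
  then obtain S where S: "(\<lambda>n. poly_blinfun (q n) A) \<longlonglongrightarrow> S"
    using Cauchy_convergent convergent_def by blast
  have all: "(\<lambda>n. poly_blinfun (p n) A) \<longlonglongrightarrow> S"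
    if p: "uniform_limit ?I (\<lambda>n. poly (p n)) f sequentially" for p
  proof -
    have "(\<lambda>n. dist (poly_blinfun (p n) A) (poly_blinfun (q n) A)) \<longlonglongrightarrow> 0"
    proof (rule tendstoI)
      fix e :: real assume e: "e > 0"
      have "\<forall>\<^sub>F n in sequentially. \<forall>x\<in>?I. dist (poly (p n) x) (f x) < e / 4"
        "\<forall>\<^sub>F n in sequentially. \<forall>x\<in>?I. dist (poly (q n) x) (f x) < e / 4"
        using p q e by (auto dest!: uniform_limitD[of _ _ _ _ "e / 4"])
      then show "\<forall>\<^sub>F n in sequentially. dist (dist (poly_blinfun (p n) A) (poly_blinfun (q n) A)) 0 < e"
      proof eventually_elim
        case (elim n)
        have "dist (poly_blinfun (p n) A) (poly_blinfun (q n) A) \<le> e / 2"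
        proof (rule norm_poly_blinfun_diff_le[OF A])
          fix t assume "t \<in> ?I"
          with elim show "dist (poly (p n) t) (poly (q n) t) \<le> e / 2"
            using dist_triangle2[of "poly (p n) t" "poly (q n) t" "f t"] by fastforce
        qed
        then show ?case using e by simp
      qed
    qed
    then have "(\<lambda>n. poly_blinfun (p n) A - poly_blinfun (q n) A) \<longlonglongrightarrow> 0"
      by (simp add: dist_norm tendsto_norm_zero_iff)
    with S show ?thesis by (rule Lim_transform)
  qed
  have "fun_calc f A = S"
    unfolding fun_calc_def
  proof (rule the_equality)
    fix S' assume "\<forall>p. uniform_limit ?I (\<lambda>n. poly (p n)) f sequentially
        \<longrightarrow> (\<lambda>n. poly_blinfun (p n) A) \<longlonglongrightarrow> S'"
    then show "S' = S" using q S LIMSEQ_unique by blast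
  qed (use all in blast)
  with all[OF p] show ?thesis by simp
qed

lemma norm_fun_calc_le:
  assumes A: "A \<in> positive_ops" and f: "continuous_on {0..norm A} f"
    and M: "\<And>t. t \<in> {0..norm A} \<Longrightarrow> \<bar>f t\<bar> \<le> M"
  shows "norm (fun_calc f A) \<le> M"
proof -
  obtain p where p: "uniform_limit {0..norm A} (\<lambda>n. poly (p n)) f sequentially"
    using uniform_limit_poly_exists[OF f] .
  have lim: "(\<lambda>n. norm (poly_blinfun (p n) A)) \<longlonglongrightarrow> norm (fun_calc f A)"
    by (intro tendsto_norm fun_calc_tendsto A f p)
  show ?thesis
  proof (rule field_le_epsilon)
    fix e :: real assume "e > 0"
    with p have "\<forall>\<^sub>F n in sequentially. \<forall>t\<in>{0..norm A}. dist (poly (p n) t) (f t) < e"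
      by (rule uniform_limitD)
    then have "\<forall>\<^sub>F n in sequentially. norm (poly_blinfun (p n) A) \<le> M + e"
    proof eventually_elim
      case (elim n)
      show ?case
      proof (rule norm_poly_blinfun_le[OF A])
        fix t assume t: "0 \<le> t" "t \<le> norm A"
        then have "\<bar>poly (p n) t - f t\<bar> < e" "\<bar>f t\<bar> \<le> M"
          using elim M by (auto simp: dist_real_def)
        then show "\<bar>poly (p n) t\<bar> \<le> M + e" by linarith
      qed
    qed
    then show "norm (fun_calc f A) \<le> M + e"
      by (intro tendsto_upperbound[OF lim]) auto
  qed
qed

lemma fun_calc_cong:
  assumes "\<And>t. t \<in> {0..norm A} \<Longrightarrow> f t = h t"
  shows "fun_calc f A = fun_calc h A"
proof -
  have "uniform_limit {0..norm A} (\<lambda>n. poly (p n)) f sequentially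
    \<longleftrightarrow> uniform_limit {0..norm A} (\<lambda>n. poly (p n)) h sequentially" for p
    by (intro uniform_limit_cong') (use assms in auto)
  then show ?thesis by (simp add: fun_calc_def)
qed

lemma fun_calc_poly:
  assumes A: "A \<in> positive_ops"
  shows "fun_calc (poly p) A = poly_blinfun p A"
proof -
  have "(\<lambda>n. poly_blinfun p A) \<longlonglongrightarrow> fun_calc (poly p) A"
    by (rule fun_calc_tendsto[OF A]) (auto intro!: continuous_intros uniform_limit_const)
  then show ?thesis using LIMSEQ_unique tendsto_const by blast
qed

text \<open>
  Multiplicativity passes to the limit, as products of uniformly convergent polynomials converge
  uniformly on the compact interval.
\<close>

lemma fun_calc_mult:
  assumes A: "A \<in> positive_ops"
    and f: "continuous_on {0..norm A} f" and h: "continuous_on {0..norm A} h"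
  shows "fun_calc (\<lambda>t. f t * h t) A = fun_calc f A o\<^sub>L fun_calc h A"
proof -
  obtain p where p: "uniform_limit {0..norm A} (\<lambda>n. poly (p n)) f sequentially"
    using uniform_limit_poly_exists[OF f] .
  obtain q where q: "uniform_limit {0..norm A} (\<lambda>n. poly (q n)) h sequentially"
    using uniform_limit_poly_exists[OF h] .
  have "uniform_limit {0..norm A} (\<lambda>n t. poly (p n) t * poly (q n) t) (\<lambda>t. f t * h t) sequentially"
    by (rule uniform_lim_mult[OF p q])
      (intro compact_imp_bounded compact_continuous_image f h compact_Icc)+
  moreover have "(\<lambda>n t. poly (p n) t * poly (q n) t) = (\<lambda>n. poly (p n * q n))"
    by (simp add: fun_eq_iff)
  ultimately have "uniform_limit {0..norm A} (\<lambda>n. poly (p n * q n)) (\<lambda>t. f t * h t) sequentially"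
    by simp
  then have "(\<lambda>n. poly_blinfun (p n * q n) A) \<longlonglongrightarrow> fun_calc (\<lambda>t. f t * h t) A"
    by (intro fun_calc_tendsto[OF A] continuous_intros f h)
  moreover have "(\<lambda>n. poly_blinfun (p n * q n) A) \<longlonglongrightarrow> (fun_calc f A o\<^sub>L fun_calc h A)"
    unfolding poly_blinfun_mult
    by (intro bounded_bilinear.tendsto[OF bounded_bilinear_blinfun_compose]
        fun_calc_tendsto A f h p q)
  ultimately show ?thesis by (rule LIMSEQ_unique)
qed

lemma bounded_linear_scaleC: "bounded_linear (\<lambda>x::'a::complex_hilbert. c *\<^sub>C x)"
  by (rule bounded_linear_intro[where K = "cmod c"])
    (simp_all add: scaleC_add_right scaleR_scaleC_commute norm_scaleC)

lemma bounded_linear_cinner_right: "bounded_linear (cinner (x::'a::complex_hilbert))"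
proof (rule bounded_linear_intro[where K = "2 * norm x"])
  show "cinner x (y + z) = cinner x y + cinner x z" for y z by (rule cinner_add_right)
  show "cinner x (r *\<^sub>R y) = r *\<^sub>R cinner x y" for r y
    by (simp add: cinner_scaleR_right scaleR_conv_of_real)
  fix y
  have "\<bar>Re (cinner x y)\<bar> \<le> norm x * norm y"
    using Cauchy_Schwarz_ineq2[of x y] by (simp add: inner_eq_Re_cinner)
  moreover have "\<bar>Im (cinner x y)\<bar> \<le> norm x * norm y"
    using Cauchy_Schwarz_ineq2[of "\<i> *\<^sub>C x" y] by (simp add: Im_cinner norm_scaleC)
  ultimately show "norm (cinner x y) \<le> norm y * (2 * norm x)"
    using cmod_le[of "cinner x y"] by (simp add: mult_ac)
qed

lemma fun_calc_selfadjoint: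
  assumes A: "A \<in> positive_ops" and f: "continuous_on {0..norm A} f"
  shows "fun_calc f A \<in> selfadjoint_ops"
proof -
  obtain p where p: "uniform_limit {0..norm A} (\<lambda>n. poly (p n)) f sequentially"
    using uniform_limit_poly_exists[OF f] .
  define P where "P n = poly_blinfun (p n) A" for n
  note Psa = poly_blinfun_selfadjoint[OF positive_ops_selfadjoint[OF A], of "p _", folded P_def]
  have lim: "P \<longlonglongrightarrow> fun_calc f A"
    unfolding P_def by (intro fun_calc_tendsto A f p)
  then have app: "(\<lambda>n. P n x) \<longlonglongrightarrow> fun_calc f A x" for x
    by (intro bounded_bilinear.tendsto[OF bounded_bilinear_blinfun_apply] tendsto_const)
  have "fun_calc f A (c *\<^sub>C x) = c *\<^sub>C fun_calc f A x" for c x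
  proof (rule LIMSEQ_unique[OF app])
    show "(\<lambda>n. P n (c *\<^sub>C x)) \<longlonglongrightarrow> c *\<^sub>C fun_calc f A x"
      using bounded_linear.tendsto[OF bounded_linear_scaleC app, of c x]
      by (simp add: bounded_opsD[OF selfadjoint_opsD(1)[OF Psa]])
  qed
  moreover have "cinner (fun_calc f A x) y = cinner x (fun_calc f A y)" for x y
  proof -
    have "(\<lambda>n. cnj (cinner y (P n x))) \<longlonglongrightarrow> cnj (cinner y (fun_calc f A x))"
      by (intro tendsto_cnj bounded_linear.tendsto[OF bounded_linear_cinner_right app])
    then have "(\<lambda>n. cinner x (P n y)) \<longlonglongrightarrow> cinner (fun_calc f A x) y"
      by (simp add: selfadjoint_opsD(2)[OF Psa] flip: cinner_commute)
    moreover have "(\<lambda>n. cinner x (P n y)) \<longlonglongrightarrow> cinner x (fun_calc f A y)"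
      by (rule bounded_linear.tendsto[OF bounded_linear_cinner_right app])
    ultimately show ?thesis by (rule LIMSEQ_unique)
  qed
  ultimately show ?thesis by (simp add: selfadjoint_ops_def bounded_ops_def)
qed

lemma continuous_on_powr_exponent:
  assumes "0 \<le> \<nu>"
  shows "continuous_on {0..c} (\<lambda>t::real. if \<nu> = 0 then 1 else t powr \<nu>)"
proof (cases "\<nu> = 0")
  case False
  have "continuous_on {0..c} (\<lambda>t::real. t powr \<nu>)"
    by (rule continuous_on_powr') (use assms False in \<open>auto intro!: continuous_intros\<close>)
  with False show ?thesis by simp
qed simp

lemma op_powr_selfadjoint:
  "A \<in> positive_ops \<Longrightarrow> 0 \<le> \<nu> \<Longrightarrow> op_powr A \<nu> \<in> selfadjoint_ops"
  unfolding op_powr_def by (intro fun_calc_selfadjoint continuous_on_powr_exponent)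

lemma op_powr_add:
  assumes A: "A \<in> positive_ops" and "0 \<le> \<mu>" "0 \<le> \<nu>"
  shows "op_powr A \<mu> o\<^sub>L op_powr A \<nu> = op_powr A (\<mu> + \<nu>)"
  unfolding op_powr_def
  by (subst fun_calc_mult[symmetric])
    (use assms in \<open>auto intro!: continuous_on_powr_exponent fun_calc_cong simp: powr_add\<close>)

lemma op_powr_add_apply:
  assumes "A \<in> positive_ops" "0 \<le> \<mu>" "0 \<le> \<nu>"
  shows "op_powr A \<mu> (op_powr A \<nu> x) = op_powr A (\<mu> + \<nu>) x"
  using op_powr_add[OF assms] by (metis blinfun_apply_blinfun_compose)

lemma op_powr_1:
  assumes A: "A \<in> positive_ops"
  shows "op_powr A 1 = A"
proof -
  have "op_powr A 1 = fun_calc (poly [:0, 1:]) A"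
    unfolding op_powr_def by (rule fun_calc_cong) auto
  also have "\<dots> = A"
    by (auto simp: fun_calc_poly[OF A] poly_blinfun_pCons_apply intro!: blinfun_eqI)
  finally show ?thesis .
qed

lemma norm_op_powr_le:
  assumes A: "A \<in> positive_ops" and "0 \<le> \<nu>" "\<nu> \<le> 1"
  shows "norm (op_powr A \<nu>) \<le> max 1 (norm A)"
  unfolding op_powr_def
proof (rule norm_fun_calc_le[OF A continuous_on_powr_exponent[OF assms(2)]])
  fix t assume t: "t \<in> {0..norm A}"
  have "t powr \<nu> \<le> max 1 (norm A)"
  proof (cases "t \<le> 1")
    case True
    then have "t powr \<nu> \<le> 1" using t assms by (simp add: powr_le1)
    then show ?thesis by simp
  next
    case False
    then have "t powr \<nu> \<le> t powr 1" using assms by (intro powr_mono) auto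
    also have "\<dots> \<le> norm A" using t by simp
    finally show ?thesis by simp
  qed
  then show "\<bar>if \<nu> = 0 then 1 else t powr \<nu>\<bar> \<le> max 1 (norm A)" by auto
qed

section \<open>Singular systems of compact operators\<close>

text \<open>
  Compactness in the form in which it is used and passes to sums, products and absolute values:
  images of bounded sequences have convergent subsequences.
\<close>

definition seq_compact_ops :: "('a::complex_hilbert \<Rightarrow>\<^sub>L 'a) set" where
  "seq_compact_ops = {T \<in> bounded_ops. \<forall>X :: nat \<Rightarrow> 'a. bounded (range X) \<longrightarrow>
     (\<exists>l r. strict_mono r \<and> (\<lambda>n. blinfun_apply T (X (r n))) \<longlonglongrightarrow> l)}"

lemma seq_compact_opsE:
  assumes "T \<in> seq_compact_ops" "bounded (range X)"
  obtains l r where "strict_mono (r :: nat \<Rightarrow> nat)" "(\<lambda>n. blinfun_apply T (X (r n))) \<longlonglongrightarrow> l"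
  using assms unfolding seq_compact_ops_def by blast

lemma seq_compact_ops_bounded_ops: "T \<in> seq_compact_ops \<Longrightarrow> T \<in> bounded_ops"
  by (simp add: seq_compact_ops_def)

lemma compact_ops_seq_compact:
  fixes T :: "'a::complex_hilbert \<Rightarrow>\<^sub>L 'a"
  assumes "T \<in> compact_ops"
  shows "T \<in> seq_compact_ops"
proof -
  have Tb: "T \<in> bounded_ops" and comp: "seq_compact (closure (T ` cball 0 1))"
    using assms by (auto simp: compact_ops_def compact_eq_seq_compact_metric)
  have "\<exists>l r. strict_mono r \<and> (\<lambda>n. T (X (r n))) \<longlonglongrightarrow> l" if "bounded (range X)" for X :: "nat \<Rightarrow> 'a"
  proof -
    obtain K where K: "K > 0" "\<And>n. norm (X n) \<le> K"
      using \<open>bounded (range X)\<close> by (auto simp: bounded_pos)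
    have "(1 / K) *\<^sub>R X n \<in> cball 0 1" for n
      using K by (simp add: divide_le_eq)
    then have "T ((1 / K) *\<^sub>R X n) \<in> closure (T ` cball 0 1)" for n
      using closure_subset by blast
    then obtain l r where lr: "strict_mono r" "((\<lambda>n. T ((1 / K) *\<^sub>R X n)) \<circ> r) \<longlonglongrightarrow> l"
      using seq_compactE[OF comp, of "\<lambda>n. T ((1 / K) *\<^sub>R X n)"] by blast
    have "(\<lambda>n. K *\<^sub>R T ((1 / K) *\<^sub>R X (r n))) \<longlonglongrightarrow> K *\<^sub>R l"
      using lr(2) by (intro tendsto_intros) (simp add: o_def)
    then have "(\<lambda>n. T (X (r n))) \<longlonglongrightarrow> K *\<^sub>R l"
      using K(1) by (simp add: blinfun.scaleR_right)
    with lr(1) show ?thesis by blast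
  qed
  with Tb show ?thesis by (simp add: seq_compact_ops_def)
qed

lemma seq_compact_ops_compose_left:
  fixes S T :: "'a::complex_hilbert \<Rightarrow>\<^sub>L 'a"
  assumes T: "T \<in> seq_compact_ops" and S: "S \<in> bounded_ops"
  shows "S o\<^sub>L T \<in> seq_compact_ops"
proof -
  have "\<exists>l r. strict_mono r \<and> (\<lambda>n. (S o\<^sub>L T) (X (r n))) \<longlonglongrightarrow> l" if X: "bounded (range X)" for X :: "nat \<Rightarrow> 'a"
  proof -
    obtain l r where r: "strict_mono r" and l: "(\<lambda>n. T (X (r n))) \<longlonglongrightarrow> l"
      using seq_compact_opsE[OF T X] .
    then show ?thesis
      using blinfun.tendsto[OF tendsto_const l, of S] by auto
  qed
  with assms show ?thesis
    by (simp add: seq_compact_ops_def bounded_ops_compose)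
qed

lemma seq_compact_ops_compose_right:
  fixes S T :: "'a::complex_hilbert \<Rightarrow>\<^sub>L 'a"
  assumes T: "T \<in> seq_compact_ops" and S: "S \<in> bounded_ops"
  shows "T o\<^sub>L S \<in> seq_compact_ops"
proof -
  have "\<exists>l r. strict_mono r \<and> (\<lambda>n. (T o\<^sub>L S) (X (r n))) \<longlonglongrightarrow> l" if X: "bounded (range X)" for X :: "nat \<Rightarrow> 'a"
  proof -
    have "bounded (range (\<lambda>n. S (X n)))"
      using bounded_linear_image[OF X blinfun.bounded_linear_right, of S]
      by (simp add: image_image)
    from seq_compact_opsE[OF T this] obtain l r
      where "strict_mono r" "(\<lambda>n. T (S (X (r n)))) \<longlonglongrightarrow> l" .
    then show ?thesis by (intro exI[of _ l] exI[of _ r]) simp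
  qed
  with assms show ?thesis
    by (simp add: seq_compact_ops_def bounded_ops_compose)
qed

lemma seq_compact_ops_add:
  fixes S T :: "'a::complex_hilbert \<Rightarrow>\<^sub>L 'a"
  assumes S: "S \<in> seq_compact_ops" and T: "T \<in> seq_compact_ops"
  shows "S + T \<in> seq_compact_ops"
proof -
  have "\<exists>l r. strict_mono r \<and> (\<lambda>n. (S + T) (X (r n))) \<longlonglongrightarrow> l" if X: "bounded (range X)" for X :: "nat \<Rightarrow> 'a"
  proof -
    obtain l r where r: "strict_mono r" "(\<lambda>n. S (X (r n))) \<longlonglongrightarrow> l"
      using seq_compact_opsE[OF S X] .
    have "bounded (range (\<lambda>n. X (r n)))" using X by (rule bounded_subset) auto
    then obtain l' r' where r': "strict_mono r'" "(\<lambda>n. T (X (r (r' n)))) \<longlonglongrightarrow> l'"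
      using seq_compact_opsE[OF T, of "\<lambda>n. X (r n)"] by metis
    have "(\<lambda>n. S (X (r (r' n)))) \<longlonglongrightarrow> l"
      using LIMSEQ_subseq_LIMSEQ[OF r(2) r'(1)] by (simp add: o_def)
    then have "(\<lambda>n. (S + T) (X ((r \<circ> r') n))) \<longlonglongrightarrow> l + l'"
      using r'(2) by (auto simp: blinfun.add_left intro!: tendsto_add)
    moreover have "strict_mono (r \<circ> r')" using r(1) r'(1) by (rule strict_mono_o)
    ultimately show ?thesis by blast
  qed
  with assms show ?thesis
    by (simp add: seq_compact_ops_def bounded_ops_add)
qed

lemma id_bounded_ops: "id_blinfun \<in> bounded_ops"
  by (simp add: bounded_ops_def)

lemma seq_compact_ops_scaleR:
  assumes "T \<in> seq_compact_ops"
  shows "r *\<^sub>R T \<in> seq_compact_ops"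
proof -
  have "r *\<^sub>R T = (r *\<^sub>R id_blinfun) o\<^sub>L T"
    by (auto intro!: blinfun_eqI simp: blinfun.scaleR_left)
  then show ?thesis
    using seq_compact_ops_compose_left[OF assms] bounded_ops_scaleR[OF id_bounded_ops] by metis
qed

lemma
  fixes T :: "'a::complex_hilbert \<Rightarrow>\<^sub>L 'a"
  assumes T: "T \<in> bounded_ops"
  shows op_abs_selfadjoint: "op_abs T \<in> selfadjoint_ops"
    and op_abs_square: "op_abs T (op_abs T x) = cadjoint T (T x)"
    and inner_op_abs_nonneg: "0 \<le> inner x (op_abs T x)"
proof -
  let ?P = "cadjoint T o\<^sub>L T"
  have P: "?P \<in> positive_ops"
  proof (rule positive_opsI)
    show "?P \<in> bounded_ops" by (intro bounded_ops_compose cadjoint_bounded_ops T)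
    show "\<exists>y::'a. cinner x (?P x) = cinner y y" for x
      using cinner_cadjoint[OF T, of x "T x"] by (auto intro!: exI[of _ "T x"])
  qed
  show "op_abs T \<in> selfadjoint_ops"
    unfolding op_abs_def by (rule op_powr_selfadjoint[OF P]) simp
  show "op_abs T (op_abs T x) = cadjoint T (T x)"
    using op_powr_add_apply[OF P, of "1/2" "1/2" x] op_powr_1[OF P]
    by (simp add: op_abs_def)
  have sa: "op_powr ?P (1/4) \<in> selfadjoint_ops" by (rule op_powr_selfadjoint[OF P]) simp
  have "op_abs T x = op_powr ?P (1/4) (op_powr ?P (1/4) x)"
    using op_powr_add_apply[OF P, of "1/4" "1/4" x] by (simp add: op_abs_def)
  then have "inner x (op_abs T x) = inner (op_powr ?P (1/4) x) (op_powr ?P (1/4) x)"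
    by (simp add: selfadjoint_opsD(3)[OF sa])
  then show "0 \<le> inner x (op_abs T x)" by simp
qed

lemma cinner_op_abs:
  assumes T: "T \<in> bounded_ops"
  shows "cinner (op_abs T x) (op_abs T y) = cinner (T x) (T y)"
  by (simp add: selfadjoint_opsD(2)[OF op_abs_selfadjoint[OF T]] op_abs_square[OF T]
      cinner_cadjoint[OF T])

lemma norm_op_abs:
  assumes T: "T \<in> bounded_ops"
  shows "norm (op_abs T x) = norm (T x)"
  using cinner_op_abs[OF T, of x x]
  by (simp add: cinner_self power2_eq_iff_nonneg flip: of_real_power)

text \<open>\<open>op_abs T\<close> maps a sequence to a Cauchy sequence whenever \<open>T\<close> does, as the two images have the same
  mutual distances.\<close>

lemma op_abs_seq_compact:
  fixes T :: "'a::complex_hilbert \<Rightarrow>\<^sub>L 'a"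
  assumes T: "T \<in> seq_compact_ops"
  shows "op_abs T \<in> seq_compact_ops"
proof -
  have Tb: "T \<in> bounded_ops" using T by (rule seq_compact_ops_bounded_ops)
  have "\<exists>l r. strict_mono r \<and> (\<lambda>n. op_abs T (X (r n))) \<longlonglongrightarrow> l"
    if X: "bounded (range X)" for X :: "nat \<Rightarrow> 'a"
  proof -
    obtain l r where r: "strict_mono r" "(\<lambda>n. T (X (r n))) \<longlonglongrightarrow> l"
      using seq_compact_opsE[OF T X] .
    have "Cauchy (\<lambda>n. T (X (r n)))" using r(2) by (rule LIMSEQ_imp_Cauchy)
    moreover have "dist (op_abs T (X (r m))) (op_abs T (X (r n))) = dist (T (X (r m))) (T (X (r n)))"
      for m n
      using norm_op_abs[OF Tb, of "X (r m) - X (r n)"] by (simp add: dist_norm blinfun.diff_right)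
    ultimately have "Cauchy (\<lambda>n. op_abs T (X (r n)))" by (simp add: Cauchy_def)
    then show ?thesis using r(1) by (meson Cauchy_convergent convergent_def)
  qed
  with selfadjoint_opsD(1)[OF op_abs_selfadjoint[OF Tb]] show ?thesis
    by (simp add: seq_compact_ops_def)
qed

lemma norm_square_minus_scaleR:
  assumes "S \<in> selfadjoint_ops"
  shows "(norm (S (S x) - c *\<^sub>R x))\<^sup>2
    = (norm (S (S x)))\<^sup>2 - 2 * c * (norm (S x))\<^sup>2 + c * c * (norm x)\<^sup>2"
proof -
  have 1: "inner (S (S x)) x = (norm (S x))\<^sup>2"
    by (simp add: selfadjoint_opsD(3)[OF assms] power2_norm_eq_inner)
  then have 2: "inner x (S (S x)) = (norm (S x))\<^sup>2" by (simp add: inner_commute)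
  have "(norm (S (S x) - c *\<^sub>R x))\<^sup>2 = inner (S (S x)) (S (S x)) - c * inner (S (S x)) x
      - c * inner x (S (S x)) + c * c * inner x x"
    by (simp add: power2_norm_eq_inner[of "_ - _"] inner_diff_left inner_diff_right
        right_diff_distrib)
  then show ?thesis unfolding 1 2 by (simp add: power2_norm_eq_inner)
qed

text \<open>
  A compact positive operator attains its norm on a closed invariant subspace, and it does so at an
  eigenvector: along a maximising sequence \<open>Y\<close> in the unit ball \<open>R (R (Y n)) - s\<^sup>2 *\<^sub>R Y n\<close> tends to \<open>0\<close>.
\<close>

lemma compact_positive_eigenvector:
  fixes R :: "'a::complex_hilbert \<Rightarrow>\<^sub>L 'a"
  assumes R: "R \<in> seq_compact_ops" "R \<in> selfadjoint_ops" "\<And>x. 0 \<le> inner x (R x)"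
    and V: "closed V" "0 \<in> V" "\<And>x. x \<in> V \<Longrightarrow> R x \<in> V" "\<And>x c. x \<in> V \<Longrightarrow> c *\<^sub>R x \<in> V"
  obtains s e where "e \<in> V" "s = 0 \<and> e = 0 \<or> s > 0 \<and> norm e = 1" "R e = s *\<^sub>R e"
    "\<And>x. x \<in> V \<Longrightarrow> norm (R x) \<le> s * norm x"
proof -
  define D where "D = {norm (R x) | x. x \<in> V \<and> norm x \<le> 1}"
  define s where "s = Sup D"
  have bdd: "bdd_above D"
  proof (rule bdd_aboveI)
    fix d assume "d \<in> D"
    then obtain x where x: "d = norm (R x)" "norm x \<le> 1" by (auto simp: D_def)
    have "norm (R x) \<le> norm R * norm x" by (rule norm_blinfun)
    also have "\<dots> \<le> norm R * 1" using x by (intro mult_left_mono) auto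
    finally show "d \<le> norm R" using x by simp
  qed
  have D0: "0 \<in> D" unfolding D_def using V(2) by (auto intro!: exI[of _ 0])
  then have s0: "0 \<le> s" unfolding s_def using bdd by (rule cSup_upper)
  have max: "norm (R x) \<le> s * norm x" if "x \<in> V" for x
  proof (cases "x = 0")
    case False
    have "(1 / norm x) *\<^sub>R x \<in> V" using V(4)[OF that] .
    then have "norm (R ((1 / norm x) *\<^sub>R x)) \<in> D" unfolding D_def using False by force
    then have "norm (R ((1 / norm x) *\<^sub>R x)) \<le> s" unfolding s_def using bdd by (rule cSup_upper)
    then show ?thesis using False by (simp add: blinfun.scaleR_right field_simps)
  qed simp
  show thesis
  proof (cases "s = 0")
    case True
    then show thesis using that[of 0 0] V(2) max by auto
  next
    case False
    then have s: "0 < s" using s0 by simp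
    have "\<exists>x\<in>V. norm x \<le> 1 \<and> s - 1 / real (Suc n) < norm (R x)" for n
    proof -
      have "\<exists>d\<in>D. s - 1 / real (Suc n) < d"
        using less_cSup_iff[OF _ bdd, of "s - 1 / real (Suc n)"] D0 by (auto simp: s_def)
      then show ?thesis by (auto simp: D_def)
    qed
    then obtain X where X: "\<And>n. X n \<in> V" "\<And>n. norm (X n) \<le> 1"
      "\<And>n. s - 1 / real (Suc n) < norm (R (X n))"
      by metis
    have le_s: "norm (R (X n)) \<le> s" for n
      using max[OF X(1), of n] mult_left_mono[OF X(2)[of n] s0] by simp
    have "(\<lambda>n. s - 1 / real (Suc n)) \<longlonglongrightarrow> s"
      using tendsto_diff[OF tendsto_const LIMSEQ_inverse_real_of_nat, of s]
      by (simp add: inverse_eq_divide)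
    then have normX: "(\<lambda>n. norm (R (X n))) \<longlonglongrightarrow> s"
      by (rule tendsto_sandwich[rotated 2, OF _ tendsto_const])
        (use X(3) le_s in \<open>auto intro!: always_eventually less_imp_le\<close>)
    have "bounded (range X)" using X(2) by (auto simp: bounded_iff)
    then obtain y r where r: "strict_mono r" and y: "(\<lambda>n. R (X (r n))) \<longlonglongrightarrow> y"
      using seq_compact_opsE[OF R(1)] by metis
    define Y where "Y n = X (r n)" for n
    have normY: "(\<lambda>n. norm (R (Y n))) \<longlonglongrightarrow> s"
      using LIMSEQ_subseq_LIMSEQ[OF normX r] by (simp add: o_def Y_def)
    have RY: "(\<lambda>n. R (Y n)) \<longlonglongrightarrow> y" unfolding Y_def by (rule y)
    have RRY: "(\<lambda>n. R (R (Y n))) \<longlonglongrightarrow> R y"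
      using blinfun.tendsto[OF tendsto_const[of R] RY] .
    have "y \<in> V"
      by (rule closed_sequentially[OF V(1) _ RY]) (unfold Y_def, rule V(3), rule X(1))
    have defect: "(norm (R (R (Y n)) - s\<^sup>2 *\<^sub>R Y n))\<^sup>2 \<le> s\<^sup>2 * (s\<^sup>2 - (norm (R (Y n)))\<^sup>2)" for n
    proof -
      have 1: "(norm (R (R (Y n))))\<^sup>2 \<le> (s * norm (R (Y n)))\<^sup>2"
        using max[OF V(3)[OF X(1)], of "r n"] by (simp add: Y_def power_mono)
      have "(norm (Y n))\<^sup>2 \<le> 1"
        using X(2)[of "r n"] by (simp add: Y_def abs_square_le_1)
      then have 2: "s\<^sup>2 * s\<^sup>2 * (norm (Y n))\<^sup>2 \<le> s\<^sup>2 * s\<^sup>2 * 1"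
        by (intro mult_left_mono) auto
      have "(norm (R (R (Y n)) - s\<^sup>2 *\<^sub>R Y n))\<^sup>2
          \<le> (s * norm (R (Y n)))\<^sup>2 - 2 * s\<^sup>2 * (norm (R (Y n)))\<^sup>2 + s\<^sup>2 * s\<^sup>2 * 1"
        using 1 2 norm_square_minus_scaleR[OF R(2), of "Y n" "s\<^sup>2"] by linarith
      also have "\<dots> = s\<^sup>2 * (s\<^sup>2 - (norm (R (Y n)))\<^sup>2)"
        by (simp add: algebra_simps power_mult_distrib)
      finally show ?thesis .
    qed
    have "(\<lambda>n. s\<^sup>2 * (s\<^sup>2 - (norm (R (Y n)))\<^sup>2)) \<longlonglongrightarrow> s\<^sup>2 * (s\<^sup>2 - s\<^sup>2)"
      by (intro tendsto_intros normY)
    then have "(\<lambda>n. s\<^sup>2 * (s\<^sup>2 - (norm (R (Y n)))\<^sup>2)) \<longlonglongrightarrow> 0" by simp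
    then have "(\<lambda>n. (norm (R (R (Y n)) - s\<^sup>2 *\<^sub>R Y n))\<^sup>2) \<longlonglongrightarrow> 0"
      by (rule Lim_null_comparison[rotated]) (simp add: defect)
    from tendsto_real_sqrt[OF this]
    have "(\<lambda>n. norm (R (R (Y n)) - s\<^sup>2 *\<^sub>R Y n)) \<longlonglongrightarrow> 0"
      by (simp only: real_sqrt_abs abs_norm_cancel real_sqrt_zero)
    then have "(\<lambda>n. R (R (Y n)) - s\<^sup>2 *\<^sub>R Y n) \<longlonglongrightarrow> 0"
      by (rule tendsto_norm_zero_cancel)
    from tendsto_diff[OF RRY this] have "(\<lambda>n. R (R (Y n)) - (R (R (Y n)) - s\<^sup>2 *\<^sub>R Y n)) \<longlonglongrightarrow> R y - 0"
      .
    then have "(\<lambda>n. s\<^sup>2 *\<^sub>R Y n) \<longlonglongrightarrow> R y" by simp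
    then have "(\<lambda>n. (1 / s\<^sup>2) *\<^sub>R (s\<^sup>2 *\<^sub>R Y n)) \<longlonglongrightarrow> (1 / s\<^sup>2) *\<^sub>R R y"
      by (intro tendsto_scaleR tendsto_const)
    then have Ye: "Y \<longlonglongrightarrow> (1 / s\<^sup>2) *\<^sub>R R y" using s by simp
    define e where "e = (1 / s\<^sup>2) *\<^sub>R R y"
    have Re: "R e = y"
      using LIMSEQ_unique[OF blinfun.tendsto[OF tendsto_const[of R] Ye] RY] by (simp add: e_def)
    have "e \<in> V" unfolding e_def by (intro V(3,4) \<open>y \<in> V\<close>)
    define d where "d = R e - s *\<^sub>R e"
    have "R d + s *\<^sub>R d = 0"
      using s by (simp add: d_def blinfun.diff_right blinfun.scaleR_right Re algebra_simps)
        (simp add: e_def power2_eq_square)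
    then have "inner d (R d) + s * inner d d = 0"
      by (metis inner_add_right inner_scaleR_right inner_zero_right)
    then have "s * inner d d \<le> 0" using R(3)[of d] by linarith
    then have "inner d d \<le> 0" using s by (simp add: mult_le_0_iff)
    then have "d = 0" by (metis inner_ge_zero inner_eq_zero_iff order_antisym)
    then have eig: "R e = s *\<^sub>R e" by (simp add: d_def)
    have "norm y = s" using LIMSEQ_unique[OF tendsto_norm[OF RY] normY] .
    then have "norm e = 1" using eig s by (simp add: Re)
    with eig s \<open>e \<in> V\<close> max show thesis by (intro that[of e s]) auto
  qed
qed

text \<open>
  The outcome of choosing \<open>e n\<close> as a unit vector that maximises \<open>norm (R x)\<close> on the orthogonal
  complement of the previous choices; once \<open>R\<close> vanishes there, all further entries are zero.
\<close>

definition eigen_system :: "('a::complex_hilbert \<Rightarrow>\<^sub>L 'a) \<Rightarrow> (nat \<Rightarrow> real) \<Rightarrow> (nat \<Rightarrow> 'a) \<Rightarrow> bool" where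
  "eigen_system R s e \<longleftrightarrow>
     (\<forall>n. (s n = 0 \<and> e n = 0 \<or> s n > 0 \<and> norm (e n) = 1) \<and> R (e n) = s n *\<^sub>R e n \<and>
          (\<forall>m<n. cinner (e m) (e n) = 0) \<and>
          (\<forall>x. (\<forall>m<n. cinner (e m) x = 0) \<longrightarrow> norm (R x) \<le> s n * norm x))"

lemma eigen_system_exists:
  fixes R :: "'a::complex_hilbert \<Rightarrow>\<^sub>L 'a"
  assumes R: "R \<in> seq_compact_ops" "R \<in> selfadjoint_ops" "\<And>x. 0 \<le> inner x (R x)"
  obtains s e where "eigen_system R s e"
proof -
  define P where "P f n r \<longleftrightarrow>
      (fst r = 0 \<and> snd r = 0 \<or> fst r > 0 \<and> norm (snd r) = 1) \<and> R (snd r) = fst r *\<^sub>R snd r \<and>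
      (\<forall>m<n. cinner (snd (f m)) (snd r) = 0) \<and>
      (\<forall>x. (\<forall>m<n. cinner (snd (f m)) x = 0) \<longrightarrow> norm (R x) \<le> fst r * norm x)"
    for f :: "nat \<Rightarrow> real \<times> 'a" and n r
  have "\<exists>f. \<forall>n. P f n (f n)"
  proof (rule dependent_wellorder_choice)
    show "P f n r = P g n r" if "\<And>m. m < n \<Longrightarrow> f m = g m" for f g n r
      using that by (simp add: P_def)
    fix n and f :: "nat \<Rightarrow> real \<times> 'a"
    assume IH: "\<And>m. m < n \<Longrightarrow> P f m (f m)"
    define V where "V = (\<Inter>m<n. {x. cinner (snd (f m)) x = 0})"
    have V_iff: "x \<in> V \<longleftrightarrow> (\<forall>m<n. cinner (snd (f m)) x = 0)" for x by (auto simp: V_def)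
    have "closed V"
      unfolding V_def
      by (intro closed_INT ballI closed_Collect_eq continuous_on_const
          linear_continuous_on bounded_linear_cinner_right)
    moreover have "0 \<in> V" by (simp add: V_iff)
    moreover have "R x \<in> V" if "x \<in> V" for x
      unfolding V_iff
    proof (intro allI impI)
      fix m assume m: "m < n"
      have "cinner (snd (f m)) (R x) = cinner (R (snd (f m))) x"
        by (simp add: selfadjoint_opsD(2)[OF R(2)])
      also have "\<dots> = 0"
        using IH[OF m] that m by (simp add: P_def V_iff cinner_scaleR_left)
      finally show "cinner (snd (f m)) (R x) = 0" .
    qed
    moreover have "c *\<^sub>R x \<in> V" if "x \<in> V" for x c
      using that by (simp add: V_iff cinner_scaleR_right)
    ultimately obtain s e where "e \<in> V" "s = 0 \<and> e = 0 \<or> s > 0 \<and> norm e = 1" "R e = s *\<^sub>R e"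
        "\<And>x. x \<in> V \<Longrightarrow> norm (R x) \<le> s * norm x"
      using compact_positive_eigenvector[OF R, of V] by metis
    then have "P f n (s, e)" by (simp add: P_def V_iff)
    then show "\<exists>r. P f n r" by blast
  qed
  then obtain f where "\<And>n. P f n (f n)" by blast
  then have "eigen_system R (\<lambda>n. fst (f n)) (\<lambda>n. snd (f n))"
    unfolding eigen_system_def P_def by blast
  then show thesis by (rule that)
qed

context
  fixes R :: "'a::complex_hilbert \<Rightarrow>\<^sub>L 'a" and s e
  assumes es: "eigen_system R s e"
begin

lemma eigen_system_nonneg: "0 \<le> s n"
  using es unfolding eigen_system_def by (metis less_imp_le order_refl)

lemma eigen_system_norm: "s n > 0 \<Longrightarrow> norm (e n) = 1"
  using es unfolding eigen_system_def by (metis less_irrefl)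

lemma eigen_system_zero: "s n = 0 \<Longrightarrow> e n = 0"
  using es unfolding eigen_system_def by (metis less_irrefl)

lemma eigen_system_eigen: "R (e n) = s n *\<^sub>R e n"
  using es unfolding eigen_system_def by blast

lemma eigen_system_max: "(\<And>m. m < n \<Longrightarrow> cinner (e m) x = 0) \<Longrightarrow> norm (R x) \<le> s n * norm x"
  using es unfolding eigen_system_def by blast

lemma eigen_system_orthogonal: "m \<noteq> n \<Longrightarrow> cinner (e m) (e n) = 0"
proof (induction m n rule: linorder_wlog)
  case (le m n)
  then show ?case using es unfolding eigen_system_def by (meson le_neq_implies_less)
next
  case (sym m n)
  then show ?case using cinner_commute[of "e n" "e m"] by simp
qed

lemma eigen_system_orthonormal0: "orthonormal0 k e"
  unfolding orthonormal0_def
  using eigen_system_orthogonal eigen_system_norm eigen_system_zero eigen_system_nonneg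
  by (metis order_le_less)

lemma eigen_system_decseq: "decseq s"
  unfolding decseq_def
proof (intro allI impI)
  fix m n :: nat assume "m \<le> n"
  show "s n \<le> s m"
  proof (cases "s n = 0 \<or> m = n")
    case False
    then have 1: "norm (e n) = 1" using eigen_system_norm eigen_system_nonneg[of n] by simp
    have "norm (R (e n)) \<le> s m * norm (e n)"
      using eigen_system_orthogonal False \<open>m \<le> n\<close> by (intro eigen_system_max) auto
    then show ?thesis using 1 eigen_system_nonneg[of n] by (simp add: eigen_system_eigen)
  qed (use eigen_system_nonneg in auto)
qed

text \<open>Otherwise the images of the orthonormal eigenvectors would have no convergent subsequence.\<close>

lemma eigen_system_tendsto_0:
  assumes R: "R \<in> seq_compact_ops"
  shows "s \<longlonglongrightarrow> 0"
proof (rule ccontr)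
  assume not: "\<not> s \<longlonglongrightarrow> 0"
  have "\<exists>\<epsilon>>0. \<forall>n. \<epsilon> \<le> s n"
  proof (rule ccontr)
    assume "\<not> (\<exists>\<epsilon>>0. \<forall>n. \<epsilon> \<le> s n)"
    then have small: "\<exists>N. s N < \<epsilon>" if "\<epsilon> > 0" for \<epsilon> using that by (meson not_le)
    have "s \<longlonglongrightarrow> 0"
    proof (rule LIMSEQ_I)
      fix \<epsilon> :: real assume "\<epsilon> > 0"
      then obtain N where "s N < \<epsilon>" using small by blast
      then have "norm (s n - 0) < \<epsilon>" if "n \<ge> N" for n
        using decseqD[OF eigen_system_decseq that] eigen_system_nonneg[of n] by simp
      then show "\<exists>N. \<forall>n\<ge>N. norm (s n - 0) < \<epsilon>" by blast
    qed
    with not show False by simp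
  qed
  then obtain \<epsilon> where \<epsilon>: "\<epsilon> > 0" "\<And>n. \<epsilon> \<le> s n" by blast
  then have pos: "s n > 0" for n by (meson less_le_trans)
  have "bounded (range e)" using eigen_system_norm[OF pos] by (auto simp: bounded_iff)
  then obtain l r where r: "strict_mono r" "(\<lambda>n. R (e (r n))) \<longlonglongrightarrow> l"
    using seq_compact_opsE[OF R] by metis
  have "Cauchy (\<lambda>n. R (e (r n)))" using r(2) by (rule LIMSEQ_imp_Cauchy)
  then obtain M where M: "\<And>m n. m \<ge> M \<Longrightarrow> n \<ge> M \<Longrightarrow> dist (R (e (r m))) (R (e (r n))) < \<epsilon>"
    using \<epsilon>(1) unfolding Cauchy_def by meson
  have "r M \<noteq> r (Suc M)" using r(1) by (simp add: strict_mono_eq)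
  then have "cinner (R (e (r M))) (- R (e (r (Suc M)))) = 0"
    by (simp add: eigen_system_eigen cinner_minus_right cinner_scaleR_left cinner_scaleR_right
        eigen_system_orthogonal)
  from norm_add_orthogonal[OF this]
  have "(dist (R (e (r M))) (R (e (r (Suc M)))))\<^sup>2 = (s (r M))\<^sup>2 + (s (r (Suc M)))\<^sup>2"
    by (simp add: dist_norm eigen_system_eigen eigen_system_norm[OF pos])
  moreover have "\<epsilon>\<^sup>2 \<le> (s (r M))\<^sup>2" using \<epsilon> by (intro power_mono) auto
  moreover have "(dist (R (e (r M))) (R (e (r (Suc M)))))\<^sup>2 < \<epsilon>\<^sup>2"
    using M[of M "Suc M"] by (intro power_strict_mono) auto
  ultimately show False by (smt (verit) zero_le_power2)
qed

lemma eigen_system_level_finite: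
  assumes R: "R \<in> seq_compact_ops" and "\<mu> > 0"
  shows "finite {n. s n = \<mu>}"
proof -
  obtain N where N: "\<And>n. n \<ge> N \<Longrightarrow> s n < \<mu>"
    using order_tendstoD(2)[OF eigen_system_tendsto_0[OF R] \<open>\<mu> > 0\<close>]
    by (auto simp: eventually_sequentially)
  have "n < N" if "s n = \<mu>" for n
    using N[of n] that by (cases "n < N") auto
  then have "{n. s n = \<mu>} \<subseteq> {..<N}" by auto
  then show ?thesis by (rule finite_subset) simp
qed

text \<open>
  The eigenvectors \<open>e n\<close> with \<open>s n = \<mu>\<close> are a basis of the eigenspace: the component of an
  eigenvector \<open>x\<close> orthogonal to the first \<open>N\<close> of the \<open>e n\<close>, where \<open>s N < \<mu>\<close>, is again an eigenvector for \<open>\<mu>\<close>,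
  but \<open>R\<close> shrinks it by the factor \<open>s N\<close>; so it vanishes.
\<close>

lemma eigen_system_card_level:
  assumes R: "R \<in> seq_compact_ops" "R \<in> selfadjoint_ops" and \<mu>: "\<mu> > 0"
  shows "card {n. s n = \<mu>} = complex_vector.dim (eigenspace R \<mu>)"
proof -
  define L where "L = {n. s n = \<mu>}"
  define B where "B = e ` L"
  have finL: "finite L" unfolding L_def using R(1) \<mu> by (rule eigen_system_level_finite)
  have unit: "norm (e n) = 1" if "n \<in> L" for n using that \<mu> eigen_system_norm by (simp add: L_def)
  have inj: "inj_on e L"
  proof (rule inj_onI, rule ccontr)
    fix m n assume "m \<in> L" "n \<in> L" "e m = e n" "m \<noteq> n"
    then have "cinner (e m) (e m) = 0" using eigen_system_orthogonal[of m n] by simp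
    then show False using unit[OF \<open>m \<in> L\<close>] by (simp add: cinner_self)
  qed
  have eig: "eigenspace R \<mu> = {x. R x = \<mu> *\<^sub>R x}"
    by (simp add: eigenspace_def scaleR_eq_scaleC)
  have sub: "complex_vector.subspace (eigenspace R \<mu>)"
    unfolding eig complex_vector.subspace_def
    by (auto simp: blinfun.add_right scaleR_add_right scaleR_scaleC_commute
        bounded_opsD[OF selfadjoint_opsD(1)[OF R(2)]])
  have "B \<subseteq> eigenspace R \<mu>" unfolding eig B_def L_def by (auto simp: eigen_system_eigen)
  then have "complex_vector.span B \<subseteq> eigenspace R \<mu>"
    using sub by (rule complex_vector.span_minimal)
  moreover have "eigenspace R \<mu> \<subseteq> complex_vector.span B"
  proof
    fix x assume "x \<in> eigenspace R \<mu>"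
    then have Rx: "R x = \<mu> *\<^sub>R x" by (simp add: eig)
    have coeff: "cinner (e j) x = 0" if "s j \<noteq> \<mu>" for j
    proof -
      have "of_real (s j) * cinner (e j) x = cinner (R (e j)) x"
        by (simp add: eigen_system_eigen cinner_scaleR_left)
      also have "\<dots> = of_real \<mu> * cinner (e j) x"
        by (simp add: selfadjoint_opsD(2)[OF R(2)] Rx cinner_scaleR_right)
      finally show ?thesis using that by simp
    qed
    obtain N where N: "s N < \<mu>"
      using order_tendstoD(2)[OF eigen_system_tendsto_0[OF R(1)] \<mu>]
      by (auto simp: eventually_sequentially)
    define y where "y = proj_away N e x"
    have term_R: "R (cinner (e j) x *\<^sub>C e j) = \<mu> *\<^sub>R (cinner (e j) x *\<^sub>C e j)" for j
      using coeff[of j]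
      by (cases "s j = \<mu>") (simp_all add: bounded_opsD[OF selfadjoint_opsD(1)[OF R(2)]]
          eigen_system_eigen scaleR_scaleC_commute)
    have "R y = \<mu> *\<^sub>R y"
      unfolding y_def proj_away_def
      by (simp add: blinfun.diff_right blinfun.sum_right term_R Rx scaleR_diff_right
          flip: scaleR_sum_right)
    moreover have "norm (R y) \<le> s N * norm y"
      unfolding y_def by (intro eigen_system_max cinner_proj_away eigen_system_orthonormal0)
    ultimately have "\<mu> * norm y \<le> s N * norm y" using \<mu> by simp
    then have "y = 0" using N by (metis mult_le_cancel_right not_le norm_le_zero_iff)
    then have "x = (\<Sum>j<N. cinner (e j) x *\<^sub>C e j)" by (simp add: y_def proj_away_def)
    also have "\<dots> \<in> complex_vector.span B"
    proof (rule complex_vector.span_sum)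
      fix j
      show "cinner (e j) x *\<^sub>C e j \<in> complex_vector.span B"
      proof (cases "s j = \<mu>")
        case True
        then have "e j \<in> B" by (simp add: B_def L_def)
        then show ?thesis by (intro complex_vector.span_scale complex_vector.span_base)
      qed (simp add: coeff complex_vector.span_zero)
    qed
    finally show "x \<in> complex_vector.span B" .
  qed
  ultimately have span: "complex_vector.span B = complex_vector.span (eigenspace R \<mu>)"
    using sub by (metis complex_vector.span_eq_iff subset_antisym)
  have "complex_vector.independent B"
  proof
    assume "complex_vector.dependent B"
    then obtain u v where uv: "v \<in> B" "u v \<noteq> 0" "(\<Sum>b\<in>B. u b *\<^sub>C b) = 0"
      using complex_vector.dependent_finite[of B] finL by (auto simp: B_def)
    obtain n where n: "n \<in> L" "v = e n" using uv(1) by (auto simp: B_def)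
    have "cinner (e n) (\<Sum>b\<in>B. u b *\<^sub>C b) = (\<Sum>m\<in>L. u (e m) * cinner (e n) (e m))"
      unfolding B_def by (simp add: sum.reindex[OF inj] cinner_sum_right cinner_scaleC_right)
    also have "\<dots> = (\<Sum>m\<in>L. if m = n then u (e n) else 0)"
      using unit n(1) by (intro sum.cong) (auto simp: eigen_system_orthogonal cinner_self)
    also have "\<dots> = u v" using n finL by simp
    finally show False using uv by simp
  qed
  then have "complex_vector.dim (eigenspace R \<mu>) = card B"
    using complex_vector.dim_eq_card[OF span] by simp
  also have "\<dots> = card L" unfolding B_def by (rule card_image[OF inj])
  finally show ?thesis by (simp add: L_def)
qed

end

text \<open>
  A decreasing sequence is determined by the multiplicities of its positive values: if \<open>n\<close> is the first
  index where they differ and \<open>t n < s n\<close>, the value \<open>s n\<close> occurs more often in \<open>s\<close> than in \<open>t\<close>.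
\<close>

lemma decseq_eq_if_card_levels_eq:
  fixes s t :: "nat \<Rightarrow> real"
  assumes s: "decseq s" "\<And>n. 0 \<le> s n" "\<And>\<mu>. \<mu> > 0 \<Longrightarrow> finite {n. s n = \<mu>}"
    and t: "decseq t" "\<And>n. 0 \<le> t n" "\<And>\<mu>. \<mu> > 0 \<Longrightarrow> finite {n. t n = \<mu>}"
    and card: "\<And>\<mu>. \<mu> > 0 \<Longrightarrow> card {n. s n = \<mu>} = card {n. t n = \<mu>}"
  shows "s = t"
proof (rule ccontr)
  have contra: False
    if s: "\<And>n. 0 \<le> s n" "\<And>\<mu>. \<mu> > 0 \<Longrightarrow> finite {n. s n = \<mu>}"
      and t: "decseq t" "\<And>n. 0 \<le> t n"
      and card: "\<And>\<mu>. \<mu> > 0 \<Longrightarrow> card {n. s n = \<mu>} = card {n. t n = \<mu>}"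
      and n: "t n < s n" "\<And>m. m < n \<Longrightarrow> s m = t m" for s t :: "nat \<Rightarrow> real" and n
  proof -
    have pos: "s n > 0" using n(1) t(2)[of n] by simp
    have "m < n" if "t m = s n" for m
      using n(1) that decseqD[OF t(1), of n m] by (metis not_le)
    then have "{m. t m = s n} \<subseteq> {m. s m = s n} - {n}" using n by auto
    then have "card {m. t m = s n} \<le> card ({m. s m = s n} - {n})"
      using s(2)[OF pos] by (intro card_mono) auto
    also have "\<dots> < card {m. s m = s n}"
      using s(2)[OF pos] by (intro psubset_card_mono) auto
    finally show False using card[OF pos] by simp
  qed
  assume "s \<noteq> t"
  then have ex: "\<exists>n. s n \<noteq> t n" by auto
  define n where "n = (LEAST n. s n \<noteq> t n)"
  have "s n \<noteq> t n" unfolding n_def using ex by (rule LeastI_ex)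
  moreover have "s m = t m" if "m < n" for m using not_less_Least that unfolding n_def by blast
  ultimately show False
    using contra[of s t n] contra[of t s n] assms by (metis linorder_neq_iff)
qed

lemma singular_values_eigen_system:
  fixes T :: "'a::complex_hilbert \<Rightarrow>\<^sub>L 'a"
  assumes T: "T \<in> seq_compact_ops"
  obtains e where "eigen_system (op_abs T) (singular_values T) e"
proof -
  have Tb: "T \<in> bounded_ops" using T by (rule seq_compact_ops_bounded_ops)
  note R = op_abs_seq_compact[OF T] op_abs_selfadjoint[OF Tb]
  obtain s e where es: "eigen_system (op_abs T) s e"
    using eigen_system_exists[OF R inner_op_abs_nonneg[OF Tb]] .
  have "singular_values T = s"
    unfolding singular_values_def
  proof (rule the_equality)
    show "decseq s \<and> (\<forall>n. 0 \<le> s n) \<and> (\<forall>\<mu>>0. finite {n. s n = \<mu>} \<and>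
        card {n. s n = \<mu>} = complex_vector.dim (eigenspace (op_abs T) \<mu>))"
      using eigen_system_decseq[OF es] eigen_system_nonneg[OF es]
        eigen_system_level_finite[OF es R(1)] eigen_system_card_level[OF es R] by blast
    fix t assume "decseq t \<and> (\<forall>n. 0 \<le> t n) \<and> (\<forall>\<mu>>0. finite {n. t n = \<mu>} \<and>
        card {n. t n = \<mu>} = complex_vector.dim (eigenspace (op_abs T) \<mu>))"
    then show "t = s"
      using eigen_system_decseq[OF es] eigen_system_nonneg[OF es]
        eigen_system_level_finite[OF es R(1)] eigen_system_card_level[OF es R]
      by (intro decseq_eq_if_card_levels_eq) auto
  qed
  with es show thesis using that by blast
qed

section \<open>Ky Fan norms\<close>

lemma cmod_cinner_commute: "cmod (cinner x y) = cmod (cinner y (x::'a::complex_hilbert))"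
  by (metis cinner_commute complex_mod_cnj)

definition ky_fan :: "nat \<Rightarrow> ('a::complex_hilbert \<Rightarrow>\<^sub>L 'a) \<Rightarrow> real" where
  "ky_fan k T = (\<Sum>i<k. singular_values T i)"

lemma
  fixes T :: "'a::complex_hilbert \<Rightarrow>\<^sub>L 'a"
  assumes T: "T \<in> seq_compact_ops"
  shows singular_values_decseq: "decseq (singular_values T)"
    and singular_values_nonneg: "0 \<le> singular_values T n"
    and singular_values_tendsto_0: "singular_values T \<longlonglongrightarrow> 0"
proof -
  obtain e where es: "eigen_system (op_abs T) (singular_values T) e"
    using singular_values_eigen_system[OF T] .
  show "decseq (singular_values T)" "0 \<le> singular_values T n" "singular_values T \<longlonglongrightarrow> 0"
    using eigen_system_decseq[OF es] eigen_system_nonneg[OF es]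
      eigen_system_tendsto_0[OF es op_abs_seq_compact[OF T]] by auto
qed

text \<open>
  The right singular vectors \<open>v n\<close> are the eigenvectors of \<open>op_abs T\<close>, the left ones \<open>u n\<close> their normalised
  images; orthogonality of the images follows from \<open>\<langle>T x, T y\<rangle> = \<langle>|T| x, |T| y\<rangle>\<close>.
\<close>

lemma singular_value_decomposition:
  fixes T :: "'a::complex_hilbert \<Rightarrow>\<^sub>L 'a"
  assumes T: "T \<in> seq_compact_ops"
  obtains u v where
    "\<And>k. orthonormal0 k u" "\<And>k. orthonormal0 k v"
    "\<And>n. T (v n) = singular_values T n *\<^sub>R u n"
    "\<And>n. cadjoint T (u n) = singular_values T n *\<^sub>R v n"
    "\<And>n. singular_values T n > 0 \<Longrightarrow> norm (u n) = 1"
    "\<And>n. singular_values T n > 0 \<Longrightarrow> norm (v n) = 1"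
    "\<And>N x. (\<And>m. m < N \<Longrightarrow> cinner (v m) x = 0) \<Longrightarrow> norm (T x) \<le> singular_values T N * norm x"
proof -
  have Tb: "T \<in> bounded_ops" using T by (rule seq_compact_ops_bounded_ops)
  let ?s = "singular_values T"
  obtain e where es: "eigen_system (op_abs T) ?s e"
    using singular_values_eigen_system[OF T] .
  note eig = eigen_system_eigen[OF es]
  define u where "u n = (1 / ?s n) *\<^sub>R T (e n)" for n
  have Te: "T (e n) = ?s n *\<^sub>R u n" for n
    using eigen_system_zero[OF es, of n] by (cases "?s n = 0") (simp_all add: u_def)
  have norm_Te: "norm (T (e n)) = ?s n * norm (e n)" for n
    using eigen_system_nonneg[OF es, of n] by (simp add: norm_op_abs[OF Tb, symmetric] eig)
  have u1: "norm (u n) = 1" if "?s n > 0" for n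
    using that eigen_system_norm[OF es that] by (simp add: u_def norm_Te)
  have "orthonormal0 k u" for k
    unfolding orthonormal0_def
  proof (intro conjI allI impI)
    show "u i = 0 \<or> norm (u i) = 1" for i
      using u1[of i] eigen_system_nonneg[OF es, of i] by (cases "?s i = 0") (auto simp: u_def)
    show "cinner (u i) (u j) = 0" if "i \<noteq> j" for i j
      using eigen_system_orthogonal[OF es that]
      by (simp add: u_def cinner_scaleR_left cinner_scaleR_right eig
          flip: cinner_op_abs[OF Tb])
  qed
  moreover have "cadjoint T (u n) = ?s n *\<^sub>R e n" for n
  proof -
    have "cadjoint T (T (e n)) = ?s n *\<^sub>R (?s n *\<^sub>R e n)"
      unfolding op_abs_square[OF Tb, symmetric] by (simp only: eig blinfun.scaleR_right)
    then show ?thesis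
      using eigen_system_zero[OF es, of n]
      by (cases "?s n = 0") (simp_all add: u_def blinfun.scaleR_right)
  qed
  moreover have "norm (T x) \<le> ?s N * norm x" if "\<And>m. m < N \<Longrightarrow> cinner (e m) x = 0" for N x
    using eigen_system_max[OF es that] by (simp add: norm_op_abs[OF Tb])
  ultimately show thesis
    using that[of u e] Te u1 eigen_system_orthonormal0[OF es] eigen_system_norm[OF es] by blast
qed

text \<open>
  The weights \<open>c\<close> are best spent on the \<open>k\<close> largest terms; subtracting \<open>s k\<close> from all terms makes
  those after the first \<open>k\<close> nonpositive.
\<close>

lemma weighted_sum_le_top_sum:
  fixes s c :: "nat \<Rightarrow> real"
  assumes s: "decseq s" "\<And>i. 0 \<le> s i" and c: "\<And>i. 0 \<le> c i" "\<And>i. c i \<le> 1"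
    and sum: "(\<Sum>i<N. c i) \<le> real k" and "k \<le> N"
  shows "(\<Sum>i<N. s i * c i) \<le> (\<Sum>i<k. s i)"
proof -
  have "(\<Sum>i<N. (s i - s k) * c i) \<le> (\<Sum>i<N. if i < k then s i - s k else 0)"
  proof (rule sum_mono)
    fix i
    show "(s i - s k) * c i \<le> (if i < k then s i - s k else 0)"
    proof (cases "i < k")
      case True
      then have "s k \<le> s i" using s(1) by (simp add: decseqD)
      then show ?thesis using True c(2)[of i] mult_left_mono[of "c i" 1 "s i - s k"] by simp
    next
      case False
      then have "s i \<le> s k" using s(1) by (simp add: decseqD)
      then show ?thesis using False c(1)[of i] by (simp add: mult_nonpos_nonneg)
    qed
  qed
  also have "\<dots> = (\<Sum>i<k. s i - s k)"
  proof -
    have "{..<N} \<inter> {i. i < k} = {..<k}" using \<open>k \<le> N\<close> by auto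
    then show ?thesis by (simp add: sum.If_cases)
  qed
  finally have "(\<Sum>i<N. s i * c i) - s k * (\<Sum>i<N. c i) \<le> (\<Sum>i<k. s i) - real k * s k"
    by (simp add: sum_subtractf left_diff_distrib sum_distrib_left)
  moreover have "s k * (\<Sum>i<N. c i) \<le> s k * real k"
    using sum s(2) by (intro mult_left_mono)
  ultimately show ?thesis by (simp add: mult.commute)
qed

lemma two_Re_mult_le: "2 * Re (a * b) \<le> (cmod (a + cnj b))\<^sup>2 / 2"
proof -
  have "0 \<le> (Re a - Re b)\<^sup>2 + (Im a + Im b)\<^sup>2" by simp
  then show ?thesis unfolding cmod_power2 by (simp add: power2_eq_square algebra_simps)
qed

text \<open>
  The operator \<open>(x, y) \<mapsto> (Z y, Z\<^sup>* x)\<close> on the doubled space is self-adjoint, its quadratic form at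
  \<open>(x, y)\<close> is \<open>2 Re \<langle>x, Z y\<rangle>\<close>, and its positive eigenvalues are the singular values of \<open>Z\<close>, with
  eigenvectors \<open>(u i, v i) / sqrt 2\<close>. The bound is the upper half of Ky Fan's maximum principle for it.
  Bessel families instead of orthonormal ones make the principle applicable to images of
  orthonormal families under contractions.
\<close>

lemma sum_Re_cinner_le_ky_fan:
  fixes Z :: "'a::complex_hilbert \<Rightarrow>\<^sub>L 'a" and q :: "nat \<Rightarrow> 'a \<times> 'a"
  assumes Z: "Z \<in> seq_compact_ops" and q: "bessel_family k q"
  shows "(\<Sum>j<k. 2 * Re (cinner (fst (q j)) (Z (snd (q j))))) \<le> ky_fan k Z"
proof -
  let ?s = "singular_values Z"
  have Zb: "Z \<in> bounded_ops" using Z by (rule seq_compact_ops_bounded_ops)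
  obtain u v where u: "\<And>k. orthonormal0 k u" and v: "\<And>k. orthonormal0 k v"
    and Zv: "\<And>n. Z (v n) = ?s n *\<^sub>R u n"
    and tail: "\<And>N x. (\<And>m. m < N \<Longrightarrow> cinner (v m) x = 0) \<Longrightarrow> norm (Z x) \<le> ?s N * norm x"
    using singular_value_decomposition[OF Z] by metis
  note s0 = singular_values_nonneg[OF Z]
  define w where "w i = (1 / sqrt 2) *\<^sub>R (u i, v i)" for i
  have w: "bessel_family N w" for N
    unfolding w_def by (intro bessel_family_pair orthonormal0_imp_bessel_family u v)
  \<comment> \<open>The weight of \<open>q\<close> on the \<open>i\<close>-th eigenvector: at most \<open>1\<close> each, at most \<open>k\<close> in total.\<close>
  define c where "c i = (\<Sum>j<k. (cmod (cinner (q j) (w i)))\<^sup>2)" for i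
  have c_le: "c i \<le> 1" for i
  proof -
    have "c i \<le> (norm (w i))\<^sup>2" unfolding c_def using q by (rule bessel_familyD)
    also have "\<dots> \<le> 1"
      using bessel_family_norm_le[OF w, of i "Suc i"] by (simp add: abs_square_le_1)
    finally show ?thesis .
  qed
  have q1: "norm (q j) \<le> 1" if "j < k" for j using bessel_family_norm_le[OF q that] .
  have c_sum: "(\<Sum>i<N. c i) \<le> real k" for N
  proof -
    have "(\<Sum>i<N. c i) = (\<Sum>j<k. \<Sum>i<N. (cmod (cinner (w i) (q j)))\<^sup>2)"
      unfolding c_def cmod_cinner_commute[of "q _"] by (rule sum.swap)
    also have "\<dots> \<le> (\<Sum>j<k. 1)"
    proof (rule sum_mono)
      fix j assume "j \<in> {..<k}"
      have "(\<Sum>i<N. (cmod (cinner (w i) (q j)))\<^sup>2) \<le> (norm (q j))\<^sup>2"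
        using w by (rule bessel_familyD)
      also have "\<dots> \<le> 1" using q1 \<open>j \<in> {..<k}\<close> by (simp add: abs_square_le_1)
      finally show "(\<Sum>i<N. (cmod (cinner (w i) (q j)))\<^sup>2) \<le> 1" .
    qed
    finally show ?thesis by simp
  qed
  have single: "2 * Re (cinner (fst (q j)) (Z (snd (q j))))
      \<le> (\<Sum>i<N. ?s i * (cmod (cinner (q j) (w i)))\<^sup>2) + 2 * ?s N" if "j < k" for j N
  proof -
    define x y where "x = fst (q j)" and "y = snd (q j)"
    have x1: "norm x \<le> 1" and y1: "norm y \<le> 1"
      using q1[OF that] norm_fst_le[of "fst (q j)" "snd (q j)"] norm_snd_le[of "snd (q j)" "fst (q j)"]
      by (auto simp: x_def y_def)
    define y' where "y' = proj_away N v y"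
    have "Z y = Z y' + (\<Sum>i<N. cinner (v i) y *\<^sub>C (?s i *\<^sub>R u i))"
      by (simp add: y'_def proj_away_def blinfun.diff_right blinfun.sum_right bounded_opsD[OF Zb]
          flip: Zv)
    then have "2 * Re (cinner x (Z y)) = 2 * Re (cinner x (Z y'))
        + (\<Sum>i<N. ?s i * (2 * Re (cinner x (u i) * cinner (v i) y)))"
      by (simp add: cinner_add_right cinner_sum_right cinner_scaleC_right cinner_scaleR_right
          sum_distrib_left algebra_simps)
    also have "\<dots> \<le> 2 * ?s N + (\<Sum>i<N. ?s i * (cmod (cinner (q j) (w i)))\<^sup>2)"
    proof (intro add_mono sum_mono mult_left_mono s0)
      have "norm (Z y') \<le> ?s N * norm y'"
        unfolding y'_def by (intro tail cinner_proj_away v)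
      also have "\<dots> \<le> ?s N * 1"
        using norm_proj_away_le[OF v, of N y] y1 s0 by (intro mult_left_mono) (auto simp: y'_def)
      finally have "norm x * norm (Z y') \<le> 1 * ?s N"
        using x1 s0 by (intro mult_mono) auto
      then show "Re (cinner x (Z y')) \<le> ?s N"
        using norm_cauchy_schwarz[of x "Z y'"] by (simp add: inner_eq_Re_cinner)
      fix i
      have "cinner (q j) (w i) = of_real (1 / sqrt 2) * (cinner x (u i) + cnj (cinner (v i) y))"
        unfolding w_def cinner_scaleR_right
        by (simp add: cinner_prod_def x_def y_def flip: cinner_commute)
      then have "(cmod (cinner (q j) (w i)))\<^sup>2 = (cmod (cinner x (u i) + cnj (cinner (v i) y)))\<^sup>2 / 2"
        by (simp only: norm_mult power_mult_distrib norm_of_real) (simp add: power_divide)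
      then show "2 * Re (cinner x (u i) * cinner (v i) y) \<le> (cmod (cinner (q j) (w i)))\<^sup>2"
        using two_Re_mult_le[of "cinner x (u i)" "cinner (v i) y"] by argo
    qed simp_all
    finally show ?thesis by (simp add: x_def y_def)
  qed
  have "(\<Sum>j<k. 2 * Re (cinner (fst (q j)) (Z (snd (q j))))) \<le> ky_fan k Z + real k * (2 * ?s N)"
    if "k \<le> N" for N
  proof -
    have "(\<Sum>j<k. 2 * Re (cinner (fst (q j)) (Z (snd (q j)))))
        \<le> (\<Sum>j<k. (\<Sum>i<N. ?s i * (cmod (cinner (q j) (w i)))\<^sup>2) + 2 * ?s N)"
      by (intro sum_mono single) simp
    also have "\<dots> = (\<Sum>i<N. ?s i * c i) + real k * (2 * ?s N)"
      unfolding sum.distrib c_def sum_distrib_left by (subst sum.swap) simp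
    also have "(\<Sum>i<N. ?s i * c i) \<le> ky_fan k Z"
      unfolding ky_fan_def
      using singular_values_decseq[OF Z] s0 _ c_le c_sum that
      by (rule weighted_sum_le_top_sum) (simp add: c_def sum_nonneg)
    finally show ?thesis by simp
  qed
  moreover have "(\<lambda>N. ky_fan k Z + real k * (2 * ?s N)) \<longlonglongrightarrow> ky_fan k Z + real k * (2 * 0)"
    by (intro tendsto_intros singular_values_tendsto_0[OF Z])
  ultimately show ?thesis
    by (intro LIMSEQ_le_const[where X = "\<lambda>N. ky_fan k Z + real k * (2 * ?s N)"]) auto
qed

lemma sum_Re_cinner_le_ky_fan':
  fixes Z :: "'a::complex_hilbert \<Rightarrow>\<^sub>L 'a"
  assumes Z: "Z \<in> seq_compact_ops" and uv: "bessel_family k u" "bessel_family k v"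
  shows "(\<Sum>j<k. Re (cinner (u j) (Z (v j)))) \<le> ky_fan k Z"
proof -
  have "2 * Re (cinner (fst ((1 / sqrt 2) *\<^sub>R (u j, v j))) (Z (snd ((1 / sqrt 2) *\<^sub>R (u j, v j)))))
      = Re (cinner (u j) (Z (v j)))" for j
    by (simp add: blinfun.scaleR_right cinner_scaleR_left cinner_scaleR_right
        flip: of_real_mult mult.assoc)
  with sum_Re_cinner_le_ky_fan[OF Z bessel_family_pair[OF uv]] show ?thesis by simp
qed

lemma ky_fan_attained:
  fixes T :: "'a::complex_hilbert \<Rightarrow>\<^sub>L 'a"
  assumes T: "T \<in> seq_compact_ops"
  obtains u v where "bessel_family k u" "bessel_family k v"
    "ky_fan k T = (\<Sum>j<k. Re (cinner (u j) (T (v j))))"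
proof -
  obtain u v where u: "\<And>k. orthonormal0 k u" and v: "\<And>k. orthonormal0 k v"
    and Tv: "\<And>n. T (v n) = singular_values T n *\<^sub>R u n"
    and u1: "\<And>n. singular_values T n > 0 \<Longrightarrow> norm (u n) = 1"
    using singular_value_decomposition[OF T] by metis
  have "Re (cinner (u j) (T (v j))) = singular_values T j" for j
    using u1[of j] singular_values_nonneg[OF T, of j]
    by (cases "singular_values T j = 0") (simp_all add: Tv cinner_scaleR_right cinner_self)
  then show thesis
    by (intro that[of u v] orthonormal0_imp_bessel_family u v) (simp add: ky_fan_def)
qed

lemma ky_fan_add_le:
  fixes S T :: "'a::complex_hilbert \<Rightarrow>\<^sub>L 'a"
  assumes S: "S \<in> seq_compact_ops" and T: "T \<in> seq_compact_ops"
  shows "ky_fan k (S + T) \<le> ky_fan k S + ky_fan k T"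
proof -
  obtain u v where uv: "bessel_family k u" "bessel_family k v"
    "ky_fan k (S + T) = (\<Sum>j<k. Re (cinner (u j) ((S + T) (v j))))"
    using ky_fan_attained[OF seq_compact_ops_add[OF S T]] by metis
  have "ky_fan k (S + T) = (\<Sum>j<k. Re (cinner (u j) (S (v j)))) + (\<Sum>j<k. Re (cinner (u j) (T (v j))))"
    by (simp add: uv(3) blinfun.add_left cinner_add_right sum.distrib)
  also have "\<dots> \<le> ky_fan k S + ky_fan k T"
    by (intro add_mono sum_Re_cinner_le_ky_fan' S T uv)
  finally show ?thesis .
qed

lemma bessel_family_image:
  assumes C: "C \<in> bounded_ops" "norm C \<le> c" "0 < c" and u: "bessel_family k u"
  shows "bessel_family k (\<lambda>j. (1 / c) *\<^sub>R cadjoint C (u j))"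
  unfolding bessel_family_def
proof
  fix w
  have eq: "cinner ((1 / c) *\<^sub>R cadjoint C (u j)) w = cinner (u j) ((1 / c) *\<^sub>R C w)" for j
    by (simp add: cinner_scaleR_left cinner_scaleR_right cinner_cadjoint'[OF C(1)])
  have "(\<Sum>j<k. (cmod (cinner ((1 / c) *\<^sub>R cadjoint C (u j)) w))\<^sup>2) \<le> (norm ((1 / c) *\<^sub>R C w))\<^sup>2"
    unfolding eq by (rule bessel_familyD[OF u])
  also have "\<dots> \<le> (norm w)\<^sup>2"
  proof (rule power_mono)
    have "norm (C w) \<le> c * norm w"
      using norm_blinfun[of C w] mult_right_mono[OF C(2) norm_ge_zero[of w]] by simp
    then show "norm ((1 / c) *\<^sub>R C w) \<le> norm w"
      using C(3) by (simp add: field_simps)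
  qed simp
  finally show "(\<Sum>j<k. (cmod (cinner ((1 / c) *\<^sub>R cadjoint C (u j)) w))\<^sup>2) \<le> (norm w)\<^sup>2" .
qed

lemma cadjoint_cadjoint:
  assumes "T \<in> bounded_ops"
  shows "cadjoint (cadjoint T) = T"
proof (rule blinfun_eqI, rule cinner_ext)
  fix x y
  show "cinner x (cadjoint (cadjoint T) y) = cinner x (T y)"
    using cinner_cadjoint[OF cadjoint_bounded_ops[OF assms], of x y] cinner_cadjoint'[OF assms, of x y]
    by simp
qed

text \<open>
  Moving \<open>C\<close> and \<open>D\<close> to the vectors turns Bessel families into Bessel families, up to the factors
  \<open>c\<close> and \<open>d\<close>. Upper bounds instead of the norms themselves avoid a division by zero.
\<close>

lemma ky_fan_compose_le:
  fixes C D T :: "'a::complex_hilbert \<Rightarrow>\<^sub>L 'a"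
  assumes T: "T \<in> seq_compact_ops"
    and C: "C \<in> bounded_ops" "norm C \<le> c" "0 < c"
    and D: "D \<in> bounded_ops" "norm D \<le> d" "0 < d"
  shows "ky_fan k (C o\<^sub>L T o\<^sub>L D) \<le> c * d * ky_fan k T"
proof -
  have "C o\<^sub>L T o\<^sub>L D \<in> seq_compact_ops"
    by (intro seq_compact_ops_compose_left seq_compact_ops_compose_right T C D)
  then obtain u v where uv: "bessel_family k u" "bessel_family k v"
    "ky_fan k (C o\<^sub>L T o\<^sub>L D) = (\<Sum>j<k. Re (cinner (u j) ((C o\<^sub>L T o\<^sub>L D) (v j))))"
    using ky_fan_attained by metis
  let ?u = "\<lambda>j. (1 / c) *\<^sub>R cadjoint C (u j)"
  let ?v = "\<lambda>j. (1 / d) *\<^sub>R D (v j)"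
  have "norm (cadjoint D) \<le> d"
  proof (rule norm_blinfun_bound)
    show "norm (cadjoint D x) \<le> d * norm x" for x
      using norm_cadjoint_apply_le[OF D(1), of x] mult_right_mono[OF D(2) norm_ge_zero[of x]]
      by linarith
  qed (use D(3) in simp)
  then have v: "bessel_family k ?v"
    using bessel_family_image[OF cadjoint_bounded_ops[OF D(1)] _ D(3) uv(2)]
    by (simp add: cadjoint_cadjoint[OF D(1)])
  have "ky_fan k (C o\<^sub>L T o\<^sub>L D) = (\<Sum>j<k. Re (cinner (cadjoint C (u j)) (T (D (v j)))))"
    by (simp add: uv(3) cinner_cadjoint'[OF C(1)])
  also have "\<dots> = c * d * (\<Sum>j<k. Re (cinner (?u j) (T (?v j))))"
    using C(3) D(3)
    by (simp add: blinfun.scaleR_right cinner_scaleR_left cinner_scaleR_right sum_divide_distrib[symmetric])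
  also have "\<dots> \<le> c * d * ky_fan k T"
    using C(3) D(3) by (intro mult_left_mono sum_Re_cinner_le_ky_fan' T v
        bessel_family_image[OF C uv(1)]) simp
  finally show ?thesis .
qed

section \<open>The arithmetic-geometric mean inequality\<close>

text \<open>
  Gram--Schmidt orthonormalisation of eigenvectors turns an operator into an upper triangular one
  with the eigenvalues on the diagonal.
\<close>

lemma eigenvectors_orthonormalize:
  fixes N :: "'b::complex_hilbert \<Rightarrow> 'b" and f :: "nat \<Rightarrow> 'b"
  assumes N_add: "\<And>x y. N (x + y) = N x + N y" and N_scaleC: "\<And>c x. N (c *\<^sub>C x) = c *\<^sub>C N x"
    and f: "\<And>j. j < k \<Longrightarrow> N (f j) = s j *\<^sub>R f j"
    and indep: "\<And>j. j < k \<Longrightarrow> f j \<notin> complex_vector.span (f ` {..<j})"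
  shows "\<exists>q. orthonormal0 k q \<and> (\<forall>j<k. cinner (q j) (N (q j)) = of_real (s j))"
proof -
  let ?sp = "\<lambda>k. complex_vector.span (f ` {..<k})"
  have N_0: "N 0 = 0" using N_scaleC[of 0 0] by simp
  have N_diff: "N (x - y) = N x - N y" for x y
    using N_add[of "x - y" y] by simp
  have N_sum: "N (\<Sum>j\<in>I. g j) = (\<Sum>j\<in>I. N (g j))" for g and I :: "nat set"
    by (induction I rule: infinite_finite_induct) (simp_all add: N_0 N_add)
  have N_span: "N x \<in> ?sp m" if "x \<in> ?sp m" "m \<le> k" for x m
    using that(1)
  proof (rule complex_vector.span_induct)
    show "complex_vector.subspace {x. N x \<in> ?sp m}"
      by (auto simp: complex_vector.subspace_def N_0 N_add N_scaleC complex_vector.span_zero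
          complex_vector.span_add complex_vector.span_scale)
    fix y assume "y \<in> f ` {..<m}"
    then obtain j where "j < m" "y = f j" by auto
    moreover from this have "f j \<in> ?sp m" by (intro complex_vector.span_base) auto
    ultimately show "N y \<in> ?sp m"
      using f[of j] \<open>m \<le> k\<close> by (simp add: scaleR_eq_scaleC complex_vector.span_scale)
  qed
  have "\<exists>q. orthonormal0 m q \<and> (\<forall>j<m. q j \<in> ?sp m) \<and>
      (\<forall>x. (\<forall>j<m. cinner x (q j) = 0) \<longrightarrow> (\<forall>y\<in>?sp m. cinner x y = 0)) \<and>
      (\<forall>j<m. cinner (q j) (N (q j)) = of_real (s j))" if "m \<le> k" for m
    using that
  proof (induction m)
    case 0
    then show ?case by (simp add: orthonormal0_def)
  next
    case (Suc m)
    from Suc.IH[OF Suc_leD[OF Suc.prems]] obtain q where q: "orthonormal0 m q"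
      and q_span: "\<forall>j<m. q j \<in> ?sp m"
      and q_orth: "\<forall>x. (\<forall>j<m. cinner x (q j) = 0) \<longrightarrow> (\<forall>y\<in>?sp m. cinner x y = 0)"
      and q_diag: "\<forall>j<m. cinner (q j) (N (q j)) = of_real (s j)"
      by (elim exE conjE)
    define r where "r = (\<Sum>j<m. cinner (q j) (f m) *\<^sub>C q j)"
    define p where "p = proj_away m q (f m)"
    have fm: "f m = p + r" by (simp add: p_def r_def proj_away_def)
    have r: "r \<in> ?sp m"
      unfolding r_def by (intro complex_vector.span_sum complex_vector.span_scale q_span[rule_format]) simp
    have "p \<noteq> 0" using indep[of m] Suc.prems r fm by auto
    have pq: "cinner p (q j) = 0" if "j < m" for j
      using cinner_proj_away[OF q that, of "f m"] cinner_commute[of p "q j"] by (simp add: p_def)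
    have p_orth: "cinner p y = 0" if "y \<in> ?sp m" for y using q_orth pq that by blast
    have mono: "?sp m \<subseteq> ?sp (Suc m)" by (intro complex_vector.span_mono) auto
    have fm_span: "f m \<in> ?sp (Suc m)" by (intro complex_vector.span_base) simp
    have "f m - r \<in> ?sp (Suc m)"
      using fm_span r mono by (intro complex_vector.span_diff) auto
    then have p_span: "p \<in> ?sp (Suc m)" by (simp add: fm)
    define q' where "q' = q(m := (1 / norm p) *\<^sub>R p)"
    have q'_less: "q' j = q j" if "j < m" for j using that by (simp add: q'_def)
    have q'_m: "q' m = (1 / norm p) *\<^sub>R p" by (simp add: q'_def)
    have "orthonormal0 (Suc m) q'"
      unfolding orthonormal0_def
    proof (intro conjI allI impI)
      show "q' i = 0 \<or> norm (q' i) = 1" if "i < Suc m" for i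
        using q that \<open>p \<noteq> 0\<close> by (cases "i = m") (auto simp: q'_m q'_less orthonormal0_def less_Suc_eq)
      have qp: "cinner (q j) p = 0" if "j < m" for j
        using pq[OF that] cinner_commute[of "q j" p] by simp
      show "cinner (q' i) (q' j) = 0" if "i < Suc m" "j < Suc m" "i \<noteq> j" for i j
        using q that pq qp
        by (auto simp: q'_m q'_less orthonormal0_def less_Suc_eq cinner_scaleR_left
            cinner_scaleR_right)
    qed
    moreover have "q' j \<in> ?sp (Suc m)" if "j < Suc m" for j
    proof (cases "j = m")
      case True
      show ?thesis
        unfolding True q'_m scaleR_eq_scaleC using p_span by (rule complex_vector.span_scale)
    next
      case False
      then have "j < m" using that by simp
      then show ?thesis using q_span mono by (auto simp: q'_less)
    qed
    moreover have "cinner x y = 0"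
      if x: "\<forall>j<Suc m. cinner x (q' j) = 0" and "y \<in> ?sp (Suc m)" for x y
      using that(2)
    proof (rule complex_vector.span_induct)
      show "complex_vector.subspace {y. cinner x y = 0}"
        by (auto simp: complex_vector.subspace_def cinner_add_right cinner_scaleC_right)
      have old: "cinner x y = 0" if "y \<in> ?sp m" for y
      proof -
        have "cinner x (q j) = 0" if "j < m" for j
          using x[rule_format, of j] q'_less[OF that] that by simp
        then show ?thesis using q_orth \<open>y \<in> ?sp m\<close> by blast
      qed
      have "cinner x p = 0"
        using x[rule_format, of m] \<open>p \<noteq> 0\<close> by (simp add: q'_m cinner_scaleR_right)
      then have "cinner x (f m) = 0" unfolding fm using old[OF r] by (simp add: cinner_add_right)
      moreover have "cinner x (f j) = 0" if "j < m" for j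
        using that by (intro old complex_vector.span_base) auto
      ultimately show "cinner x y = 0" if "y \<in> f ` {..<Suc m}" for y
        using that by (auto simp: less_Suc_eq)
    qed
    moreover have "cinner (q' j) (N (q' j)) = of_real (s j)" if "j < Suc m" for j
    proof (cases "j = m")
      case True
      have "N r \<in> ?sp m" using r Suc.prems by (intro N_span) auto
      moreover have "N p = s m *\<^sub>R f m - N r"
      proof -
        have "N (f m - r) = s m *\<^sub>R f m - N r" using f[of m] Suc.prems by (simp add: N_diff)
        then show ?thesis by (simp add: fm)
      qed
      ultimately have "cinner p (N p) = of_real (s m) * cinner p p"
        using p_orth[OF r] p_orth[of "N r"]
        by (simp add: cinner_diff_right cinner_scaleR_right fm cinner_add_right)
      moreover have "N ((1 / norm p) *\<^sub>R p) = (1 / norm p) *\<^sub>R N p"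
        unfolding scaleR_eq_scaleC by (rule N_scaleC)
      ultimately show ?thesis
        using True \<open>p \<noteq> 0\<close>
        by (simp add: q'_m cinner_scaleR_left cinner_scaleR_right cinner_self power2_eq_square)
    next
      case False
      then show ?thesis using that q_diag by (simp add: q'_less)
    qed
    ultimately show ?case by blast
  qed
  then show ?thesis by blast
qed

text \<open>Beyond the rank of \<open>S\<close> the Ky Fan norms of \<open>S\<close> are constant, whereas those of \<open>T\<close> cannot decrease.\<close>

lemma ky_fan_leI:
  fixes S T :: "'a::complex_hilbert \<Rightarrow>\<^sub>L 'a"
  assumes S: "S \<in> seq_compact_ops" and T: "T \<in> seq_compact_ops"
    and le: "\<And>k. (\<And>j. j < k \<Longrightarrow> 0 < singular_values S j) \<Longrightarrow> ky_fan k S \<le> ky_fan k T"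
  shows "ky_fan k S \<le> ky_fan k T"
proof (induction k)
  case (Suc k)
  show ?case
  proof (cases "singular_values S k = 0")
    case True
    then show ?thesis using Suc.IH singular_values_nonneg[OF T, of k] by (simp add: ky_fan_def)
  next
    case False
    then have "0 < singular_values S k" using singular_values_nonneg[OF S, of k] by simp
    moreover have "singular_values S k \<le> singular_values S j" if "j < Suc k" for j
      using singular_values_decseq[OF S] that by (simp add: decseqD)
    ultimately show ?thesis by (intro le) (meson less_le_trans)
  qed
qed (simp add: ky_fan_def)

text \<open>
  Let \<open>u j\<close>, \<open>v j\<close> be the singular vectors of \<open>M = a Y b\<close>. Then \<open>f j = (a (u j), b (v j))\<close> are
  eigenvectors of \<open>N (x, y) = (a\<^sup>2 Y y, b\<^sup>2 Y\<^sup>* x)\<close> for the singular values of \<open>M\<close>. After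
  orthonormalisation, the sum of the eigenvalues is a sum of values of the quadratic form of
  the real part of \<open>N\<close>, which is the form \<open>2 Re \<langle>x, Z y\<rangle>\<close> for \<open>Z = (a\<^sup>2 Y + Y b\<^sup>2) / 2\<close>.
\<close>

lemma ky_fan_agm:
  fixes a b Y :: "'a::complex_hilbert \<Rightarrow>\<^sub>L 'a"
  assumes a: "a \<in> selfadjoint_ops" and b: "b \<in> selfadjoint_ops" and Y: "Y \<in> seq_compact_ops"
  shows "ky_fan k (a o\<^sub>L Y o\<^sub>L b) \<le> ky_fan k ((1/2) *\<^sub>R ((a o\<^sub>L a o\<^sub>L Y) + (Y o\<^sub>L b o\<^sub>L b)))"
proof -
  note ab = selfadjoint_opsD(1)[OF a] selfadjoint_opsD(1)[OF b]
  note Yb = seq_compact_ops_bounded_ops[OF Y]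
  define M where "M = a o\<^sub>L Y o\<^sub>L b"
  define Z where "Z = (1/2) *\<^sub>R ((a o\<^sub>L a o\<^sub>L Y) + (Y o\<^sub>L b o\<^sub>L b))"
  have M: "M \<in> seq_compact_ops"
    unfolding M_def by (intro seq_compact_ops_compose_left seq_compact_ops_compose_right Y ab)
  have Z: "Z \<in> seq_compact_ops"
    unfolding Z_def by (intro seq_compact_ops_scaleR seq_compact_ops_add
        seq_compact_ops_compose_left seq_compact_ops_compose_right Y ab bounded_ops_compose)
  note Mb = seq_compact_ops_bounded_ops[OF M]
  have M_apply: "M x = a (Y (b x))" for x by (simp add: M_def)
  have adj_M: "cadjoint M x = b (cadjoint Y (a x))" for x
  proof (rule cinner_ext)
    fix y
    show "cinner y (cadjoint M x) = cinner y (b (cadjoint Y (a x)))"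
      by (simp add: cinner_cadjoint[OF Mb, symmetric] M_apply selfadjoint_opsD(2)[OF a]
          cinner_cadjoint[OF Yb] selfadjoint_opsD(2)[OF b])
  qed
  let ?s = "singular_values M"
  obtain u v where v_on: "\<And>k. orthonormal0 k v"
    and Mv: "\<And>n. M (v n) = ?s n *\<^sub>R u n" and Mu: "\<And>n. cadjoint M (u n) = ?s n *\<^sub>R v n"
    and v1: "\<And>n. ?s n > 0 \<Longrightarrow> norm (v n) = 1"
    using singular_value_decomposition[OF M] by metis
  define N where "N p = (a (a (Y (snd p))), b (b (cadjoint Y (fst p))))" for p
  define f where "f j = (a (u j), b (v j))" for j
  have Nf: "N (f j) = ?s j *\<^sub>R f j" for j
    using Mv[of j] Mu[of j, unfolded adj_M]
    by (simp add: N_def f_def M_def blinfun.scaleR_right)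
  have N_add: "N (x + y) = N x + N y" for x y
    by (simp add: N_def blinfun.add_right)
  have N_scaleC: "N (c *\<^sub>C x) = c *\<^sub>C N x" for c x
    by (simp add: N_def scaleC_prod_def bounded_opsD[OF ab(1)] bounded_opsD[OF ab(2)]
        bounded_opsD[OF Yb] bounded_opsD[OF cadjoint_bounded_ops[OF Yb]])
  have main: "ky_fan k M \<le> ky_fan k Z" if pos: "\<And>j. j < k \<Longrightarrow> 0 < ?s j" for k
  proof -
    have "f m \<notin> complex_vector.span (f ` {..<m})" if "m < k" for m
    proof
      \<comment> \<open>The functional \<open>p \<mapsto> \<langle>v m, b Y\<^sup>* (fst p)\<rangle>\<close> kills \<open>f j\<close> for \<open>j < m\<close> but not \<open>f m\<close>.\<close>
      assume "f m \<in> complex_vector.span (f ` {..<m})"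
      then have "cinner (v m) (b (cadjoint Y (fst (f m)))) = 0"
      proof (rule complex_vector.span_induct)
        show "complex_vector.subspace {p. cinner (v m) (b (cadjoint Y (fst p))) = 0}"
          by (auto simp: complex_vector.subspace_def scaleC_prod_def blinfun.add_right
              bounded_opsD[OF ab(2)] bounded_opsD[OF cadjoint_bounded_ops[OF Yb]]
              cinner_add_right cinner_scaleC_right)
        fix p assume "p \<in> f ` {..<m}"
        then obtain j where j: "j < m" "p = f j" by auto
        have "cinner (v m) (v j) = 0" using v_on[of "Suc m"] j by (auto simp: orthonormal0_def)
        then show "cinner (v m) (b (cadjoint Y (fst p))) = 0"
          using Mu[of j, unfolded adj_M] j by (simp add: f_def cinner_scaleR_right)
      qed
      then show False
        using Mu[of m, unfolded adj_M] pos[OF that] v1[OF pos[OF that]]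
        by (simp add: f_def cinner_scaleR_right cinner_self)
    qed
    then obtain q where q: "orthonormal0 k q" "\<And>j. j < k \<Longrightarrow> cinner (q j) (N (q j)) = of_real (?s j)"
      using eigenvectors_orthonormalize[of N k f ?s, OF N_add N_scaleC Nf] by blast
    have "Re (cinner p (N p)) = 2 * Re (cinner (fst p) (Z (snd p)))" for p
    proof -
      have "cinner (snd p) (b (b (cadjoint Y (fst p)))) = cinner (Y (b (b (snd p)))) (fst p)"
        by (simp add: cinner_cadjoint[OF Yb] selfadjoint_opsD(2)[OF b])
      then have "Re (cinner (snd p) (b (b (cadjoint Y (fst p))))) = Re (cinner (fst p) (Y (b (b (snd p)))))"
        using cinner_commute[of "Y (b (b (snd p)))" "fst p"] by simp
      then show ?thesis
        by (simp add: N_def cinner_prod_def Z_def blinfun.add_left blinfun.scaleR_left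
            cinner_scaleR_right cinner_add_right)
    qed
    then have "?s j = 2 * Re (cinner (fst (q j)) (Z (snd (q j))))" if "j < k" for j
      using q(2)[OF that] by (metis Re_complex_of_real)
    then have "ky_fan k M = (\<Sum>j<k. 2 * Re (cinner (fst (q j)) (Z (snd (q j)))))"
      unfolding ky_fan_def by (intro sum.cong) auto
    also have "\<dots> \<le> ky_fan k Z"
      by (intro sum_Re_cinner_le_ky_fan Z orthonormal0_imp_bessel_family q)
    finally show ?thesis .
  qed
  show ?thesis
    using ky_fan_leI[OF M Z main] by (simp add: M_def Z_def)
qed

section \<open>Symmetric gauge functions and weak majorization\<close>

lemma fin_seqs_combine:
  assumes "x \<in> fin_seqs" "y \<in> fin_seqs" "\<And>n. x n = 0 \<Longrightarrow> y n = 0 \<Longrightarrow> z n = 0"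
  shows "z \<in> fin_seqs"
proof -
  have "{n. z n \<noteq> 0} \<subseteq> {n. x n \<noteq> 0} \<union> {n. y n \<noteq> 0}" using assms(3) by auto
  then show ?thesis using assms(1,2) unfolding fin_seqs_def by (auto intro: finite_subset)
qed

context
  fixes g :: "(nat \<Rightarrow> real) \<Rightarrow> real"
  assumes g: "symmetric_gauge g"
begin

lemma gauge_nonneg: "x \<in> fin_seqs \<Longrightarrow> 0 \<le> g x"
  using g by (auto simp: symmetric_gauge_def)

lemma gauge_scale: "x \<in> fin_seqs \<Longrightarrow> g (\<lambda>n. c * x n) = \<bar>c\<bar> * g x"
  using g by (auto simp: symmetric_gauge_def)

lemma gauge_add: "x \<in> fin_seqs \<Longrightarrow> y \<in> fin_seqs \<Longrightarrow> g (\<lambda>n. x n + y n) \<le> g x + g y"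
  using g by (auto simp: symmetric_gauge_def)

lemma gauge_perm: "x \<in> fin_seqs \<Longrightarrow> bij \<pi> \<Longrightarrow> g (\<lambda>n. x (\<pi> n)) = g x"
  using g by (auto simp: symmetric_gauge_def)

lemma gauge_sign: "x \<in> fin_seqs \<Longrightarrow> (\<And>n. \<epsilon> n = 1 \<or> \<epsilon> n = -1) \<Longrightarrow> g (\<lambda>n. \<epsilon> n * x n) = g x"
  using g by (auto simp: symmetric_gauge_def)

lemma gauge_convex_comb_le:
  assumes x: "x \<in> fin_seqs" and y: "y \<in> fin_seqs" and "g y = g x" and l: "0 \<le> l" "l \<le> 1"
    and z: "\<And>n. z n = (1 - l) * x n + l * y n"
  shows "g z \<le> g x"
proof -
  have "g z = g (\<lambda>n. (1 - l) * x n + l * y n)" using z by (intro arg_cong[where f = g]) auto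
  also have "\<dots> \<le> g (\<lambda>n. (1 - l) * x n) + g (\<lambda>n. l * y n)"
    by (intro gauge_add fin_seqs_combine[OF x x] fin_seqs_combine[OF y y]) auto
  also have "\<dots> = \<bar>1 - l\<bar> * g x + \<bar>l\<bar> * g x"
    by (simp only: gauge_scale[OF x] gauge_scale[OF y] assms(3))
  also have "\<dots> = g x" using l by (simp add: algebra_simps)
  finally show ?thesis .
qed

text \<open>Shrinking one coordinate averages \<open>x\<close> with a sign change of \<open>x\<close>.\<close>

lemma gauge_shrink:
  assumes x: "x \<in> fin_seqs" and t: "0 \<le> t" "t \<le> x i"
  shows "g (x(i := t)) \<le> g x"
proof (cases "x i = 0")
  case True
  then have "x(i := t) = x" using t by (simp add: fun_eq_iff)
  then show ?thesis by simp
next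
  case False
  then have pos: "0 < x i" using t by simp
  define y where "y n = (if n = i then -1 else 1) * x n" for n
  show ?thesis
  proof (rule gauge_convex_comb_le[OF x, of y "(1 - t / x i) / 2"])
    show "y \<in> fin_seqs" by (rule fin_seqs_combine[OF x x]) (simp add: y_def)
    show "g y = g x" unfolding y_def by (rule gauge_sign[OF x]) auto
    show "(x(i := t)) n = (1 - (1 - t / x i) / 2) * x n + (1 - t / x i) / 2 * y n" for n
      using pos by (simp add: y_def field_simps)
    show "0 \<le> (1 - t / x i) / 2" "(1 - t / x i) / 2 \<le> 1"
      using t pos by (simp_all add: field_simps)
  qed
qed

lemma gauge_mono:
  assumes x: "x \<in> fin_seqs" and y: "y \<in> fin_seqs" and xy: "\<And>n. 0 \<le> x n" "\<And>n. x n \<le> y n"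
  shows "g x \<le> g y"
proof -
  have "g (\<lambda>n. if n \<in> S then x n else y n) \<le> g y" if "finite S" for S
    using that
  proof (induction S)
    case (insert i S)
    let ?z = "\<lambda>n. if n \<in> S then x n else y n"
    have "?z \<in> fin_seqs" by (rule fin_seqs_combine[OF x y]) auto
    then have "g (?z(i := x i)) \<le> g ?z"
      using xy insert.hyps by (intro gauge_shrink) auto
    also have "?z(i := x i) = (\<lambda>n. if n \<in> insert i S then x n else y n)" by auto
    finally show ?case using insert.IH by simp
  qed simp
  moreover have "finite {n. y n \<noteq> 0}" using y by (simp add: fin_seqs_def)
  ultimately have "g (\<lambda>n. if n \<in> {n. y n \<noteq> 0} then x n else y n) \<le> g y" by blast
  also have "(\<lambda>n. if n \<in> {n. y n \<noteq> 0} then x n else y n) = x"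
  proof
    show "(if n \<in> {n. y n \<noteq> 0} then x n else y n) = x n" for n
      using xy[of n] by (cases "y n = 0") auto
  qed
  finally show ?thesis .
qed

text \<open>
  A transfer of \<open>\<delta>\<close> from a larger to a smaller coordinate averages \<open>y\<close> with the sequence in which
  the two coordinates are exchanged.
\<close>

lemma gauge_transfer:
  assumes y: "y \<in> fin_seqs" and "i \<noteq> j" "0 \<le> \<delta>" "\<delta> \<le> y i - y j"
  shows "g (y(i := y i - \<delta>, j := y j + \<delta>)) \<le> g y"
proof (cases "\<delta> = 0")
  case False
  then have pos: "0 < y i - y j" using assms by simp
  let ?z = "\<lambda>n. y (Transposition.transpose i j n)"
  show ?thesis
  proof (rule gauge_convex_comb_le[OF y, of ?z "\<delta> / (y i - y j)"])
    have "{n. ?z n \<noteq> 0} = Transposition.transpose i j ` {n. y n \<noteq> 0}"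
      by (auto simp: image_iff) (metis transpose_involutory)
    then show "?z \<in> fin_seqs" using y by (simp add: fin_seqs_def)
    show "g ?z = g y" by (rule gauge_perm[OF y]) simp
    show "0 \<le> \<delta> / (y i - y j)" "\<delta> / (y i - y j) \<le> 1" using assms pos by auto
    define l where "l = \<delta> / (y i - y j)"
    have "l * (y i - y j) = \<delta>" using pos by (simp add: l_def)
    then have l: "l * y i - l * y j = \<delta>" by (simp only: right_diff_distrib)
    show "(y(i := y i - \<delta>, j := y j + \<delta>)) n
        = (1 - \<delta> / (y i - y j)) * y n + \<delta> / (y i - y j) * ?z n" for n
      unfolding l_def[symmetric] using \<open>i \<noteq> j\<close> l
      by (cases "n = i"; cases "n = j") (auto simp: left_diff_distrib)
  qed
qed simp

text \<open>
  Induction on the number of coordinates in which \<open>x\<close> and \<open>y\<close> differ. At the first \<open>j\<close> with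
  \<open>y j < x j\<close> the prefix sums provide some \<open>i < j\<close> with \<open>x i < y i\<close>, and a transfer from \<open>i\<close> to \<open>j\<close>
  makes \<open>y\<close> agree with \<open>x\<close> in one more coordinate.
\<close>

lemma gauge_weak_majorization:
  assumes x: "x \<in> fin_seqs" "decseq x" "\<And>n. 0 \<le> x n"
    and y: "y \<in> fin_seqs" "\<And>n. 0 \<le> y n"
    and le: "\<And>k. (\<Sum>n<k. x n) \<le> (\<Sum>n<k. y n)"
  shows "g x \<le> g y"
  using y le
proof (induction "card {n. x n \<noteq> y n}" arbitrary: y rule: less_induct)
  case (less y)
  show ?case
  proof (cases "\<forall>n. x n \<le> y n")
    case True
    then show ?thesis using x less.prems by (intro gauge_mono) auto
  next
    case False
    then have ex: "\<exists>n. y n < x n" by (auto simp: not_le)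
    define j where "j = (LEAST n. y n < x n)"
    have j: "y j < x j" unfolding j_def using ex by (rule LeastI_ex)
    have before: "x n \<le> y n" if "n < j" for n
      using not_less_Least that unfolding j_def by (metis not_le)
    have "\<exists>i<j. x i < y i"
    proof (rule ccontr)
      assume "\<not> (\<exists>i<j. x i < y i)"
      then have "(\<Sum>n<j. y n) \<le> (\<Sum>n<j. x n)" by (intro sum_mono) (metis lessThan_iff not_less)
      then show False using less.prems(3)[of "Suc j"] j by simp
    qed
    then obtain i where i: "i < j" "x i < y i" by blast
    define \<delta> where "\<delta> = min (y i - x i) (x j - y j)"
    define y' where "y' = y(i := y i - \<delta>, j := y j + \<delta>)"
    have \<delta>: "0 < \<delta>" "\<delta> \<le> y i - x i" "\<delta> \<le> x j - y j" using i j by (auto simp: \<delta>_def)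
    have "x j \<le> x i" using x(2) i(1) by (simp add: decseqD)
    then have "g y' \<le> g y"
      unfolding y'_def using less.prems(1) i(1) \<delta> j by (intro gauge_transfer) auto
    moreover have "g x \<le> g y'"
    proof (rule less.hyps)
      show "y' \<in> fin_seqs"
      proof -
        have "{n. y' n \<noteq> 0} \<subseteq> {n. y n \<noteq> 0} \<union> {i, j}" by (auto simp: y'_def)
        moreover have "finite ({n. y n \<noteq> 0} \<union> {i, j})"
          using less.prems(1) by (simp add: fin_seqs_def)
        ultimately show ?thesis unfolding fin_seqs_def by (auto intro: finite_subset)
      qed
      show "0 \<le> y' n" for n
        using less.prems(2)[of n] less.prems(2)[of j] x(3)[of i] \<delta> i(1) by (auto simp: y'_def)
      have "y' n = y n + ((if n = j then \<delta> else 0) - (if n = i then \<delta> else 0))" for n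
        using i(1) by (auto simp: y'_def)
      then have sum_y': "(\<Sum>n<k. y' n) = (\<Sum>n<k. y n) + ((if j < k then \<delta> else 0) - (if i < k then \<delta> else 0))" for k
        by (simp add: sum.distrib sum_subtractf)
      show "(\<Sum>n<k. x n) \<le> (\<Sum>n<k. y' n)" for k
      proof (cases "i < k \<and> k \<le> j")
        case True
        have "y i - x i \<le> (\<Sum>n<k. y n - x n)"
          using True before by (intro member_le_sum) auto
        then show ?thesis using True \<delta> by (simp add: sum_y' sum_subtractf)
      next
        case False
        then show ?thesis using less.prems(3)[of k] i(1) by (auto simp: sum_y')
      qed
      show "card {n. x n \<noteq> y' n} < card {n. x n \<noteq> y n}"
      proof (rule psubset_card_mono)
        have "{n. x n \<noteq> y n} \<subseteq> {n. x n \<noteq> 0} \<union> {n. y n \<noteq> 0}" by auto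
        then show "finite {n. x n \<noteq> y n}"
          using x(1) less.prems(1) unfolding fin_seqs_def by (auto intro: finite_subset)
        have "{n. x n \<noteq> y' n} \<subseteq> {n. x n \<noteq> y n}" using i j by (auto simp: y'_def split: if_splits)
        moreover have "x i = y' i \<or> x j = y' j" using i by (auto simp: y'_def \<delta>_def)
        ultimately show "{n. x n \<noteq> y' n} \<subset> {n. x n \<noteq> y n}" using i j by fastforce
      qed
    qed
    ultimately show ?thesis by simp
  qed
qed

lemma trunc_fin_seqs: "(\<lambda>k. if k < n then s k else 0) \<in> fin_seqs"
  unfolding fin_seqs_def by (auto intro: finite_subset[of _ "{..<n}"])

lemma gauge_ext_mono:
  assumes s: "decseq s" "\<And>n. 0 \<le> s n" and t: "\<And>n. 0 \<le> t n"
    and le: "\<And>k. (\<Sum>n<k. s n) \<le> (\<Sum>n<k. t n)"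
  shows "gauge_ext g s \<le> gauge_ext g t"
  unfolding gauge_ext_def
proof (intro SUP_mono' ennreal_leI gauge_weak_majorization trunc_fin_seqs)
  fix n
  show "decseq (\<lambda>k. if k < n then s k else 0)"
    using s by (auto simp: decseq_def)
  have trunc: "(\<Sum>i<k. if i < n then r i else 0) = (\<Sum>i<min k n. r i)" for k and r :: "nat \<Rightarrow> real"
  proof -
    have "{..<k} \<inter> {i. i < n} = {..<min k n}" by auto
    then show ?thesis by (simp add: sum.If_cases)
  qed
  show "(\<Sum>i<k. if i < n then s i else 0) \<le> (\<Sum>i<k. if i < n then t i else 0)" for k
    unfolding trunc by (rule le)
qed (use s t in auto)

lemma gauge_ext_add_le: "gauge_ext g (\<lambda>n. s n + t n) \<le> gauge_ext g s + gauge_ext g t"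
  unfolding gauge_ext_def
proof (rule SUP_least)
  fix n
  let ?t = "\<lambda>(r::nat \<Rightarrow> real) k. if k < n then r k else 0"
  have "g (?t (\<lambda>n. s n + t n)) = g (\<lambda>k. ?t s k + ?t t k)"
    by (intro arg_cong[where f = g]) auto
  also have "\<dots> \<le> g (?t s) + g (?t t)" by (intro gauge_add trunc_fin_seqs)
  finally have "ennreal (g (?t (\<lambda>n. s n + t n))) \<le> ennreal (g (?t s)) + ennreal (g (?t t))"
    by (simp add: gauge_nonneg trunc_fin_seqs ennreal_leI flip: ennreal_plus)
  also have "\<dots> \<le> (SUP n. ennreal (g (\<lambda>k. if k < n then s k else 0)))
      + (SUP n. ennreal (g (\<lambda>k. if k < n then t k else 0)))"
    by (intro add_mono SUP_upper) auto
  finally show "ennreal (g (?t (\<lambda>n. s n + t n))) \<le> \<dots>" .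
qed

lemma gauge_ext_scale_le:
  assumes "0 \<le> c"
  shows "gauge_ext g (\<lambda>n. c * s n) \<le> ennreal c * gauge_ext g s"
  unfolding gauge_ext_def
proof (rule SUP_least)
  fix n
  let ?t = "\<lambda>(r::nat \<Rightarrow> real) k. if k < n then r k else 0"
  have "g (?t (\<lambda>n. c * s n)) = g (\<lambda>k. c * ?t s k)"
    by (intro arg_cong[where f = g]) auto
  also have "\<dots> = c * g (?t s)" using assms by (simp add: gauge_scale[OF trunc_fin_seqs])
  finally have "ennreal (g (?t (\<lambda>n. c * s n))) = ennreal c * ennreal (g (?t s))"
    using assms by (simp add: ennreal_mult gauge_nonneg trunc_fin_seqs)
  also have "\<dots> \<le> ennreal c * (SUP n. ennreal (g (\<lambda>k. if k < n then s k else 0)))"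
    by (intro mult_left_mono SUP_upper) auto
  finally show "ennreal (g (?t (\<lambda>n. c * s n))) \<le> \<dots>" .
qed

lemma ui_norm_le_if_ky_fan_le:
  fixes S T :: "'a::complex_hilbert \<Rightarrow>\<^sub>L 'a"
  assumes S: "S \<in> seq_compact_ops" and T: "T \<in> seq_compact_ops" and "0 \<le> c"
    and le: "\<And>k. ky_fan k S \<le> c * ky_fan k T"
  shows "ui_norm g S \<le> ennreal c * ui_norm g T"
proof -
  have "gauge_ext g (singular_values S) \<le> gauge_ext g (\<lambda>n. c * singular_values T n)"
    using le assms(3) by (intro gauge_ext_mono singular_values_decseq singular_values_nonneg S)
      (simp_all add: ky_fan_def singular_values_nonneg[OF T] flip: sum_distrib_left)
  also have "\<dots> \<le> ennreal c * gauge_ext g (singular_values T)"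
    by (rule gauge_ext_scale_le) fact
  finally show ?thesis by (simp add: ui_norm_def)
qed

lemma ui_norm_add_le:
  fixes S T :: "'a::complex_hilbert \<Rightarrow>\<^sub>L 'a"
  assumes S: "S \<in> seq_compact_ops" and T: "T \<in> seq_compact_ops"
  shows "ui_norm g (S + T) \<le> ui_norm g S + ui_norm g T"
proof -
  have "gauge_ext g (singular_values (S + T))
      \<le> gauge_ext g (\<lambda>n. singular_values S n + singular_values T n)"
    using ky_fan_add_le[OF S T]
    by (intro gauge_ext_mono singular_values_decseq singular_values_nonneg seq_compact_ops_add S T
        add_nonneg_nonneg) (simp add: ky_fan_def sum.distrib)
  also have "\<dots> \<le> ui_norm g S + ui_norm g T"
    unfolding ui_norm_def by (rule gauge_ext_add_le)
  finally show ?thesis by (simp add: ui_norm_def)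
qed

lemma ui_norm_compose_le:
  fixes C D T :: "'a::complex_hilbert \<Rightarrow>\<^sub>L 'a"
  assumes T: "T \<in> seq_compact_ops"
    and C: "C \<in> bounded_ops" "norm C \<le> c" "0 < c"
    and D: "D \<in> bounded_ops" "norm D \<le> d" "0 < d"
  shows "ui_norm g (C o\<^sub>L T o\<^sub>L D) \<le> ennreal (c * d) * ui_norm g T"
  using C(3) D(3)
  by (intro ui_norm_le_if_ky_fan_le ky_fan_compose_le seq_compact_ops_compose_left
      seq_compact_ops_compose_right T C D) simp

lemma ui_norm_scaleR_le:
  fixes T :: "'a::complex_hilbert \<Rightarrow>\<^sub>L 'a"
  assumes T: "T \<in> seq_compact_ops" and "0 < r"
  shows "ui_norm g (r *\<^sub>R T) \<le> ennreal r * ui_norm g T"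
proof -
  have "r *\<^sub>R T = (r *\<^sub>R id_blinfun) o\<^sub>L T o\<^sub>L id_blinfun"
    by (auto intro!: blinfun_eqI simp: blinfun.scaleR_left)
  also have "ui_norm g \<dots> \<le> ennreal (r * 1) * ui_norm g T"
    using \<open>0 < r\<close>
    by (intro ui_norm_compose_le T bounded_ops_scaleR id_bounded_ops)
      (auto intro!: norm_blinfun_bound simp: blinfun.scaleR_left)
  finally show ?thesis by simp
qed

end

section \<open>Convexity and the refined inequalities\<close>

lemma ui_norm_agm:
  fixes a b Y :: "'a::complex_hilbert \<Rightarrow>\<^sub>L 'a"
  assumes g: "symmetric_gauge g"
    and a: "a \<in> selfadjoint_ops" and b: "b \<in> selfadjoint_ops" and Y: "Y \<in> seq_compact_ops"
  shows "ui_norm g (a o\<^sub>L Y o\<^sub>L b) \<le> ui_norm g ((1/2) *\<^sub>R ((a o\<^sub>L a o\<^sub>L Y) + (Y o\<^sub>L b o\<^sub>L b)))"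
proof -
  note ab = selfadjoint_opsD(1)[OF a] selfadjoint_opsD(1)[OF b]
  have "ui_norm g (a o\<^sub>L Y o\<^sub>L b)
      \<le> ennreal 1 * ui_norm g ((1/2) *\<^sub>R ((a o\<^sub>L a o\<^sub>L Y) + (Y o\<^sub>L b o\<^sub>L b)))"
  proof (rule ui_norm_le_if_ky_fan_le[OF g])
    show "a o\<^sub>L Y o\<^sub>L b \<in> seq_compact_ops"
      by (intro seq_compact_ops_compose_left seq_compact_ops_compose_right Y ab)
    show "(1/2) *\<^sub>R ((a o\<^sub>L a o\<^sub>L Y) + (Y o\<^sub>L b o\<^sub>L b)) \<in> seq_compact_ops"
      by (intro seq_compact_ops_scaleR seq_compact_ops_add
        seq_compact_ops_compose_left seq_compact_ops_compose_right Y ab bounded_ops_compose)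
    show "ky_fan k (a o\<^sub>L Y o\<^sub>L b) \<le> 1 * ky_fan k ((1/2) *\<^sub>R ((a o\<^sub>L a o\<^sub>L Y) + (Y o\<^sub>L b o\<^sub>L b)))" for k
      using ky_fan_agm[OF a b Y] by simp
  qed simp
  then show ?thesis by simp
qed

text \<open>
  Subtracting the chord gives a function \<open>D\<close> that vanishes at the end points; every point is the
  midpoint of an end point and another point, so that \<open>Sup D \<le> Sup D / 2\<close>.
\<close>

lemma midpoint_convex_bounded_le_chord:
  fixes \<psi> :: "real \<Rightarrow> real"
  assumes "a < b" and bdd: "\<And>x. x \<in> {a..b} \<Longrightarrow> \<psi> x \<le> K"
    and mid: "\<And>x y. x \<in> {a..b} \<Longrightarrow> y \<in> {a..b} \<Longrightarrow> \<psi> ((x + y) / 2) \<le> (\<psi> x + \<psi> y) / 2"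
    and x: "x \<in> {a..b}"
  shows "\<psi> x \<le> \<psi> a + (x - a) / (b - a) * (\<psi> b - \<psi> a)"
proof -
  define m where "m = (\<psi> b - \<psi> a) / (b - a)"
  define D where "D x = \<psi> x - (\<psi> a + (x - a) * m)" for x
  have ends: "D a = 0" "D b = 0" using \<open>a < b\<close> by (simp_all add: D_def m_def)
  have D_mid: "D ((x + y) / 2) \<le> (D x + D y) / 2" if "x \<in> {a..b}" "y \<in> {a..b}" for x y
    using mid[OF that] by (simp add: D_def field_simps)
  have D_bdd: "bdd_above (D ` {a..b})"
  proof (rule bdd_aboveI2)
    fix x assume x: "x \<in> {a..b}"
    have "\<bar>(x - a) * m\<bar> \<le> (b - a) * \<bar>m\<bar>"
      unfolding abs_mult using x by (intro mult_right_mono) auto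
    then show "D x \<le> K - \<psi> a + (b - a) * \<bar>m\<bar>" using bdd[OF x] by (simp add: D_def)
  qed
  define S where "S = Sup (D ` {a..b})"
  have D_le: "D y \<le> S" if "y \<in> {a..b}" for y
    unfolding S_def using D_bdd that by (intro cSup_upper) auto
  have half: "D y \<le> S / 2" if y: "y \<in> {a..b}" for y
  proof (cases "y \<le> (a + b) / 2")
    case True
    then have z: "2 * y - a \<in> {a..b}" using y by (auto simp: field_simps)
    then have "D y \<le> (D a + D (2 * y - a)) / 2"
      using D_mid[of a "2 * y - a"] \<open>a < b\<close> by simp
    then show ?thesis using D_le[OF z] ends by simp
  next
    case False
    then have z: "2 * y - b \<in> {a..b}" using y by (auto simp: field_simps)
    then have "D y \<le> (D b + D (2 * y - b)) / 2"
      using D_mid[of b "2 * y - b"] \<open>a < b\<close> by simp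
    then show ?thesis using D_le[OF z] ends by simp
  qed
  have "S \<le> S / 2"
    by (subst (1) S_def, rule cSup_least) (use \<open>a < b\<close> half in auto)
  then have "D x \<le> 0" using half[OF x] by simp
  then show ?thesis by (simp add: D_def m_def)
qed

definition heinz_op :: "('a::complex_hilbert \<Rightarrow>\<^sub>L 'a) \<Rightarrow> ('a \<Rightarrow>\<^sub>L 'a) \<Rightarrow> ('a \<Rightarrow>\<^sub>L 'a) \<Rightarrow> real \<Rightarrow> ('a \<Rightarrow>\<^sub>L 'a)" where
  "heinz_op A B X \<nu> = (op_powr A \<nu> o\<^sub>L X o\<^sub>L op_powr B (1 - \<nu>))
    + (op_powr A (1 - \<nu>) o\<^sub>L X o\<^sub>L op_powr B \<nu>)"

definition interp_op :: "('a::complex_hilbert \<Rightarrow>\<^sub>L 'a) \<Rightarrow> ('a \<Rightarrow>\<^sub>L 'a) \<Rightarrow> ('a \<Rightarrow>\<^sub>L 'a) \<Rightarrow> real \<Rightarrow> ('a \<Rightarrow>\<^sub>L 'a)" where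
  "interp_op A B X \<alpha> = (1 - \<alpha>) *\<^sub>R (op_powr A (1/2) o\<^sub>L X o\<^sub>L op_powr B (1/2))
    + \<alpha> *\<^sub>R ((1/2) *\<^sub>R ((A o\<^sub>L X) + (X o\<^sub>L B)))"

lemma F_mean_eq: "F_mean g A B X \<nu> = 1/2 * ui_norm g (heinz_op A B X \<nu>)"
  by (simp add: F_mean_def heinz_op_def)

lemma G_mean_eq: "G_mean g A B X \<alpha> = ui_norm g (interp_op A B X \<alpha>)"
  by (simp add: G_mean_def interp_op_def)

context
  fixes g :: "(nat \<Rightarrow> real) \<Rightarrow> real" and A B X :: "'a::complex_hilbert \<Rightarrow>\<^sub>L 'a"
  assumes g: "symmetric_gauge g" and A: "A \<in> positive_ops" and B: "B \<in> positive_ops"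
    and X: "X \<in> norm_ideal g"
begin

lemma X_seq_compact: "X \<in> seq_compact_ops"
  using X by (simp add: norm_ideal_def compact_ops_seq_compact)

lemma op_powr_bounded: "0 \<le> \<nu> \<Longrightarrow> op_powr A \<nu> \<in> bounded_ops" "0 \<le> \<nu> \<Longrightarrow> op_powr B \<nu> \<in> bounded_ops"
  using op_powr_selfadjoint[OF A] op_powr_selfadjoint[OF B] selfadjoint_opsD(1) by blast+

lemma positive_bounded: "A \<in> bounded_ops" "B \<in> bounded_ops"
  using A B by (auto simp: positive_ops_def)

lemma sandwich_seq_compact:
  "0 \<le> \<mu> \<Longrightarrow> 0 \<le> \<nu> \<Longrightarrow> op_powr A \<mu> o\<^sub>L X o\<^sub>L op_powr B \<nu> \<in> seq_compact_ops"
  by (intro seq_compact_ops_compose_left seq_compact_ops_compose_right X_seq_compact op_powr_bounded)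

lemma heinz_op_seq_compact: "0 \<le> \<nu> \<Longrightarrow> \<nu> \<le> 1 \<Longrightarrow> heinz_op A B X \<nu> \<in> seq_compact_ops"
  unfolding heinz_op_def by (intro seq_compact_ops_add sandwich_seq_compact) auto

lemma interp_op_seq_compact: "interp_op A B X \<alpha> \<in> seq_compact_ops"
  unfolding interp_op_def
  by (intro seq_compact_ops_add seq_compact_ops_scaleR sandwich_seq_compact
      seq_compact_ops_compose_left seq_compact_ops_compose_right X_seq_compact positive_bounded) auto

lemma powr_A: "0 \<le> \<mu> \<Longrightarrow> 0 \<le> \<nu> \<Longrightarrow> \<mu> + \<nu> = \<rho> \<Longrightarrow> op_powr A \<mu> (op_powr A \<nu> x) = op_powr A \<rho> x"
  using op_powr_add_apply[OF A] by auto

lemma powr_B: "0 \<le> \<mu> \<Longrightarrow> 0 \<le> \<nu> \<Longrightarrow> \<mu> + \<nu> = \<rho> \<Longrightarrow> op_powr B \<mu> (op_powr B \<nu> x) = op_powr B \<rho> x"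
  using op_powr_add_apply[OF B] by auto

definition F_bound :: real where
  "F_bound = max 1 (norm A) * max 1 (norm B) * enn2real (ui_norm g X)"

lemma F_mean_le_bound:
  assumes \<nu>: "0 \<le> \<nu>" "\<nu> \<le> 1"
  shows "F_mean g A B X \<nu> \<le> ennreal F_bound"
proof -
  let ?K = "max 1 (norm A) * max 1 (norm B)"
  have single: "ui_norm g (op_powr A \<mu> o\<^sub>L X o\<^sub>L op_powr B \<rho>) \<le> ennreal ?K * ui_norm g X"
    if "0 \<le> \<mu>" "\<mu> \<le> 1" "0 \<le> \<rho>" "\<rho> \<le> 1" for \<mu> \<rho>
    using that by (intro ui_norm_compose_le[OF g X_seq_compact] op_powr_bounded
        norm_op_powr_le A B) auto
  have "ui_norm g (heinz_op A B X \<nu>) \<le> ennreal ?K * ui_norm g X + ennreal ?K * ui_norm g X"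
    unfolding heinz_op_def
    by (rule order_trans[OF ui_norm_add_le[OF g]])
      (use \<nu> in \<open>auto intro!: sandwich_seq_compact add_mono single\<close>)
  also have "\<dots> = 2 * ennreal F_bound"
    using X by (simp add: F_bound_def norm_ideal_def ennreal_mult mult_2)
  finally have "1/2 * ui_norm g (heinz_op A B X \<nu>) \<le> 1/2 * (2 * ennreal F_bound)"
    by (rule mult_left_mono) simp
  also have "\<dots> = ennreal F_bound"
    by (simp add: mult.assoc[symmetric] ennreal_divide_times)
  finally show ?thesis by (simp add: F_mean_eq)
qed

definition F_real :: "real \<Rightarrow> real" where
  "F_real \<nu> = enn2real (F_mean g A B X \<nu>)"

lemma F_mean_ennreal: "0 \<le> \<nu> \<Longrightarrow> \<nu> \<le> 1 \<Longrightarrow> F_mean g A B X \<nu> = ennreal (F_real \<nu>)"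
  unfolding F_real_def using F_mean_le_bound[of \<nu>]
  by (metis ennreal_enn2real ennreal_less_top le_less_trans)

lemma F_real_nonneg: "0 \<le> F_real \<nu>"
  by (simp add: F_real_def)

lemma F_bound_nonneg: "0 \<le> F_bound"
  by (simp add: F_bound_def)

lemma F_real_le_bound: "0 \<le> \<nu> \<Longrightarrow> \<nu> \<le> 1 \<Longrightarrow> F_real \<nu> \<le> F_bound"
  using F_mean_le_bound[of \<nu>] F_bound_nonneg by (simp add: F_mean_ennreal)

lemma F_real_sym: "F_real (1 - \<nu>) = F_real \<nu>"
  by (simp add: F_real_def F_mean_eq heinz_op_def add.commute)

lemma heinz_op_eq:
  assumes "\<mu> + \<rho> = 1"
  shows "heinz_op A B X \<mu> = (op_powr A \<mu> o\<^sub>L X o\<^sub>L op_powr B \<rho>) + (op_powr A \<rho> o\<^sub>L X o\<^sub>L op_powr B \<mu>)"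
proof -
  have "\<rho> = 1 - \<mu>" using assms by simp
  then show ?thesis by (simp add: heinz_op_def)
qed

text \<open>
  The operator for \<open>\<nu>\<close> is \<open>A\<^sup>h Y B\<^sup>h\<close>, and the arithmetic-geometric mean inequality compares it with
  the average of the operators for \<open>\<nu> - h\<close> and \<open>\<nu> + h\<close>.
\<close>

lemma F_real_midpoint_step:
  assumes h: "0 \<le> h" "h \<le> \<nu>" "\<nu> + h \<le> 1"
  shows "F_real \<nu> \<le> (F_real (\<nu> - h) + F_real (\<nu> + h)) / 2"
proof -
  let ?a = "op_powr A h" and ?b = "op_powr B h" and ?H = "heinz_op A B X"
  define p0 p2 q0 q1 q2 where "p0 = \<nu> - h" and "p2 = \<nu> + h"
    and "q0 = 1 - \<nu> - h" and "q1 = 1 - \<nu>" and "q2 = 1 - \<nu> + h"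
  note defs = p0_def p2_def q0_def q1_def q2_def
  have nonneg: "0 \<le> p0" "0 \<le> \<nu>" "0 \<le> q0" "0 \<le> q1" using h by (auto simp: defs)
  define Y where "Y = (op_powr A p0 o\<^sub>L X o\<^sub>L op_powr B q0) + (op_powr A q0 o\<^sub>L X o\<^sub>L op_powr B p0)"
  have Y: "Y \<in> seq_compact_ops"
    unfolding Y_def using nonneg by (intro seq_compact_ops_add sandwich_seq_compact) auto
  have lin: "op_powr A \<mu> (x + y) = op_powr A \<mu> x + op_powr A \<mu> y" for \<mu> x y
    by (rule blinfun.add_right)
  have pa: "?a (op_powr A p0 x) = op_powr A \<nu> x" "?a (op_powr A \<nu> x) = op_powr A p2 x"
    "?a (op_powr A q0 x) = op_powr A q1 x" "?a (op_powr A q1 x) = op_powr A q2 x" for x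
    using h nonneg by (auto intro!: powr_A simp: defs)
  have pb: "op_powr B p0 (?b x) = op_powr B \<nu> x" "op_powr B \<nu> (?b x) = op_powr B p2 x"
    "op_powr B q0 (?b x) = op_powr B q1 x" "op_powr B q1 (?b x) = op_powr B q2 x" for x
    using h nonneg by (auto intro!: powr_B simp: defs)
  have H: "?H \<nu> = (op_powr A \<nu> o\<^sub>L X o\<^sub>L op_powr B q1) + (op_powr A q1 o\<^sub>L X o\<^sub>L op_powr B \<nu>)"
    "?H (\<nu> + h) = (op_powr A p2 o\<^sub>L X o\<^sub>L op_powr B q0) + (op_powr A q0 o\<^sub>L X o\<^sub>L op_powr B p2)"
    "?H (\<nu> - h) = (op_powr A p0 o\<^sub>L X o\<^sub>L op_powr B q2) + (op_powr A q2 o\<^sub>L X o\<^sub>L op_powr B p0)"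
    unfolding p2_def[symmetric] p0_def[symmetric]
    by (rule heinz_op_eq; simp add: defs)+
  have 1: "?a o\<^sub>L Y o\<^sub>L ?b = ?H \<nu>"
    unfolding H by (rule blinfun_eqI) (simp add: Y_def blinfun.add_left lin pa pb)
  have 2: "(?a o\<^sub>L ?a o\<^sub>L Y) + (Y o\<^sub>L ?b o\<^sub>L ?b) = ?H (\<nu> + h) + ?H (\<nu> - h)"
    unfolding H by (rule blinfun_eqI) (simp add: Y_def blinfun.add_left lin pa pb add_ac)
  have "ui_norm g (?H \<nu>) \<le> ui_norm g ((1/2) *\<^sub>R (?H (\<nu> + h) + ?H (\<nu> - h)))"
    using ui_norm_agm[OF g op_powr_selfadjoint[OF A h(1)] op_powr_selfadjoint[OF B h(1)] Y]
    unfolding 1 2 .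
  also have "\<dots> \<le> ennreal (1/2) * ui_norm g (?H (\<nu> + h) + ?H (\<nu> - h))"
    using h by (intro ui_norm_scaleR_le[OF g] seq_compact_ops_add heinz_op_seq_compact) auto
  also have "\<dots> \<le> ennreal (1/2) * (ui_norm g (?H (\<nu> + h)) + ui_norm g (?H (\<nu> - h)))"
    using h by (intro mult_left_mono ui_norm_add_le[OF g] heinz_op_seq_compact) auto
  finally have "1/2 * ui_norm g (?H \<nu>)
      \<le> 1/2 * (ennreal (1/2) * (ui_norm g (?H (\<nu> + h)) + ui_norm g (?H (\<nu> - h))))"
    by (rule mult_left_mono) simp
  also have "\<dots> = ennreal (1/2) * (F_mean g A B X (\<nu> + h) + F_mean g A B X (\<nu> - h))"
    by (simp add: F_mean_eq algebra_simps)
  finally have "F_mean g A B X \<nu> \<le> ennreal (1/2) * (F_mean g A B X (\<nu> + h) + F_mean g A B X (\<nu> - h))"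
    by (simp add: F_mean_eq)
  also have "F_mean g A B X (\<nu> + h) + F_mean g A B X (\<nu> - h)
      = ennreal (F_real (\<nu> + h) + F_real (\<nu> - h))"
    using h by (simp add: F_mean_ennreal F_real_nonneg)
  also have "ennreal (1/2) * \<dots> = ennreal (1/2 * (F_real (\<nu> + h) + F_real (\<nu> - h)))"
    by (rule ennreal_mult[symmetric]) (simp_all add: F_real_nonneg)
  finally have "ennreal (F_real \<nu>) \<le> ennreal (1/2 * (F_real (\<nu> + h) + F_real (\<nu> - h)))"
    using h by (simp only: F_mean_ennreal)
  then have "F_real \<nu> \<le> 1/2 * (F_real (\<nu> + h) + F_real (\<nu> - h))"
    using F_real_nonneg by (subst (asm) ennreal_le_iff) auto
  then show ?thesis by simp
qed

lemma F_real_le_chord: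
  assumes "1/4 \<le> \<nu>" "\<nu> \<le> 1/2"
  shows "F_real \<nu> \<le> (4 * \<nu> - 1) * F_real (1/2) + (2 - 4 * \<nu>) * F_real (1/4)"
proof -
  have "F_real \<nu> \<le> F_real (1/4) + (\<nu> - 1/4) / (1/2 - 1/4) * (F_real (1/2) - F_real (1/4))"
  proof (rule midpoint_convex_bounded_le_chord[where K = F_bound])
    show "F_real x \<le> F_bound" if "x \<in> {1/4..1/2}" for x
      using that by (intro F_real_le_bound) auto
    have step: "F_real ((x + y) / 2) \<le> (F_real x + F_real y) / 2"
      if "x \<in> {1/4..1/2}" "y \<in> {1/4..1/2}" "x \<le> y" for x y
    proof -
      have "(x + y) / 2 - (y - x) / 2 = x" "(x + y) / 2 + (y - x) / 2 = y"
        by (simp_all add: field_simps)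
      then show ?thesis using F_real_midpoint_step[of "(y - x) / 2" "(x + y) / 2"] that by simp
    qed
    show "F_real ((x + y) / 2) \<le> (F_real x + F_real y) / 2"
      if "x \<in> {1/4..1/2}" "y \<in> {1/4..1/2}" for x y
      using step[of x y] step[of y x] that by (cases "x \<le> y") (auto simp: add.commute)
  qed (use assms in auto)
  then show ?thesis by (simp add: algebra_simps)
qed

lemma F_half_le_F_quarter: "F_real (1/2) \<le> F_real (1/4)"
  using F_real_midpoint_step[of "1/4" "1/2"] F_real_sym[of "1/4"] by simp

text \<open>
  For \<open>T = A\<^sup>1\<^sup>/\<^sup>2 X + X B\<^sup>1\<^sup>/\<^sup>2\<close> the operator in \<open>F (1/4)\<close> is \<open>A\<^sup>1\<^sup>/\<^sup>4 T B\<^sup>1\<^sup>/\<^sup>4\<close>, while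
  \<open>A\<^sup>1\<^sup>/\<^sup>2 T + T B\<^sup>1\<^sup>/\<^sup>2 = A X + 2 A\<^sup>1\<^sup>/\<^sup>2 X B\<^sup>1\<^sup>/\<^sup>2 + X B\<close> is four times the operator in \<open>G (1/2)\<close>.
\<close>

lemma F_quarter_le_G_half: "F_mean g A B X (1/4) \<le> G_mean g A B X (1/2)"
proof -
  let ?a = "op_powr A (1/4)" and ?b = "op_powr B (1/4)"
  define T where "T = (op_powr A (1/2) o\<^sub>L X) + (X o\<^sub>L op_powr B (1/2))"
  have T: "T \<in> seq_compact_ops"
    unfolding T_def by (intro seq_compact_ops_add seq_compact_ops_compose_left
        seq_compact_ops_compose_right X_seq_compact op_powr_bounded) auto
  have lin: "op_powr A \<mu> (x + y) = op_powr A \<mu> x + op_powr A \<mu> y" for \<mu> x y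
    by (rule blinfun.add_right)
  have 1: "?a o\<^sub>L T o\<^sub>L ?b = heinz_op A B X (1/4)"
    by (intro blinfun_eqI)
      (simp add: T_def heinz_op_def blinfun.add_left lin powr_A[of "1/4" "1/2" "3/4"]
        powr_B[of "1/2" "1/4" "3/4"])
  have A1: "op_powr A (1/2) (op_powr A (1/2) x) = A x" for x
    using powr_A[of "1/2" "1/2" 1 x] by (simp add: op_powr_1[OF A])
  have B1: "op_powr B (1/2) (op_powr B (1/2) x) = B x" for x
    using powr_B[of "1/2" "1/2" 1 x] by (simp add: op_powr_1[OF B])
  have a: "?a (?a x) = op_powr A (1/2) x" for x by (rule powr_A) auto
  have b: "?b (?b x) = op_powr B (1/2) x" for x by (rule powr_B) auto
  have 2: "(1/2) *\<^sub>R ((?a o\<^sub>L ?a o\<^sub>L T) + (T o\<^sub>L ?b o\<^sub>L ?b)) = 2 *\<^sub>R interp_op A B X (1/2)"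
  proof (rule blinfun_eqI)
    fix x
    let ?m = "op_powr A (1/2) (X (op_powr B (1/2) x))"
    have "((1/2) *\<^sub>R ((?a o\<^sub>L ?a o\<^sub>L T) + (T o\<^sub>L ?b o\<^sub>L ?b))) x = (1/2) *\<^sub>R ((?m + ?m) + (A (X x) + X (B x)))"
      by (simp add: T_def blinfun.add_left blinfun.scaleR_left lin A1 B1 a b add_ac)
    also have "\<dots> = ?m + (1/2) *\<^sub>R (A (X x) + X (B x))"
      by (simp only: scaleR_add_right[of _ "?m + ?m"] scaleR_half_double)
    also have "\<dots> = 2 *\<^sub>R ((1/2) *\<^sub>R ?m + (1/2) *\<^sub>R ((1/2) *\<^sub>R (A (X x) + X (B x))))"
      unfolding scaleR_add_right[of 2] by simp
    also have "\<dots> = (2 *\<^sub>R interp_op A B X (1/2)) x"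
      by (simp add: interp_op_def blinfun.add_left blinfun.scaleR_left)
    finally show "((1/2) *\<^sub>R ((?a o\<^sub>L ?a o\<^sub>L T) + (T o\<^sub>L ?b o\<^sub>L ?b))) x = (2 *\<^sub>R interp_op A B X (1/2)) x" .
  qed
  have "ui_norm g (heinz_op A B X (1/4)) \<le> ui_norm g (2 *\<^sub>R interp_op A B X (1/2))"
    using ui_norm_agm[OF g op_powr_selfadjoint[OF A] op_powr_selfadjoint[OF B] T, of "1/4" "1/4"]
    unfolding 1 2 by simp
  also have "\<dots> \<le> ennreal 2 * G_mean g A B X (1/2)"
    unfolding G_mean_eq by (intro ui_norm_scaleR_le[OF g] interp_op_seq_compact) simp
  finally have "1/2 * ui_norm g (heinz_op A B X (1/4)) \<le> 1/2 * (ennreal 2 * G_mean g A B X (1/2))"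
    by (rule mult_left_mono) simp
  also have "\<dots> = G_mean g A B X (1/2)"
    by (simp add: mult.assoc[symmetric] ennreal_divide_times)
  finally show ?thesis by (simp add: F_mean_eq)
qed

lemma F_half_le_G_half: "ennreal (F_real (1/2)) \<le> G_mean g A B X (1/2)"
proof -
  have "ennreal (F_real (1/2)) \<le> ennreal (F_real (1/4))"
    using F_half_le_F_quarter by (rule ennreal_leI)
  also have "\<dots> \<le> G_mean g A B X (1/2)"
    using F_quarter_le_G_half F_mean_ennreal[of "1/4"] by simp
  finally show ?thesis .
qed

text \<open>
  \<open>G\<close> is convex, \<open>G 0 = F (1/2) \<le> G (1/2)\<close>, and \<open>1/2\<close> lies between \<open>0\<close> and \<open>\<alpha>\<close>.
\<close>

lemma G_half_le_G:
  assumes \<alpha>: "1/2 \<le> \<alpha>" and fin: "G_mean g A B X \<alpha> = ennreal \<gamma>" "0 \<le> \<gamma>"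
  shows "G_mean g A B X (1/2) \<le> ennreal \<gamma>"
proof (cases "\<alpha> = 1/2")
  case False
  define l where "l = 1 / (2 * \<alpha>)"
  have l: "0 < l" "l < 1" "l * \<alpha> = 1/2" using \<alpha> False by (auto simp: l_def field_simps)
  define c where "c = (1 - l) / 2"
  have c: "0 < c" using l by (simp add: c_def)
  have H: "heinz_op A B X (1/2) \<in> seq_compact_ops" by (rule heinz_op_seq_compact) auto
  have eq: "interp_op A B X (1/2) = c *\<^sub>R heinz_op A B X (1/2) + l *\<^sub>R interp_op A B X \<alpha>"
  proof (rule blinfun_eqI)
    fix x
    let ?m = "op_powr A (1/2) (X (op_powr B (1/2) x))" and ?n = "A (X x) + X (B x)"
    have interp: "interp_op A B X \<beta> x = (1 - \<beta>) *\<^sub>R ?m + (\<beta> / 2) *\<^sub>R ?n" for \<beta>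
      by (simp add: interp_op_def blinfun.add_left blinfun.scaleR_left)
    have heinz: "heinz_op A B X (1/2) x = 2 *\<^sub>R ?m"
      by (simp add: heinz_op_def blinfun.add_left scaleR_2)
    have "(c *\<^sub>R heinz_op A B X (1/2) + l *\<^sub>R interp_op A B X \<alpha>) x
        = c *\<^sub>R (2 *\<^sub>R ?m) + l *\<^sub>R ((1 - \<alpha>) *\<^sub>R ?m + (\<alpha> / 2) *\<^sub>R ?n)"
      by (simp only: blinfun.add_left blinfun.scaleR_left interp heinz)
    also have "\<dots> = (c * 2 + l * (1 - \<alpha>)) *\<^sub>R ?m + (l * (\<alpha> / 2)) *\<^sub>R ?n"
      by (simp only: scaleR_add_left scaleR_add_right[of l] scaleR_scaleR add.assoc)
    also have "c * 2 + l * (1 - \<alpha>) = 1 - 1/2"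
    proof -
      have "l * (1 - \<alpha>) = l - 1/2" using l(3) by (simp only: right_diff_distrib mult_1_right)
      then show ?thesis by (simp add: c_def field_simps)
    qed
    also have "l * (\<alpha> / 2) = 1/2/2" unfolding l(3)[symmetric] by simp
    also have "(1 - 1/2) *\<^sub>R ?m + (1/2/2) *\<^sub>R ?n = interp_op A B X (1/2) x"
      by (simp only: interp)
    finally show "interp_op A B X (1/2) x
        = (c *\<^sub>R heinz_op A B X (1/2) + l *\<^sub>R interp_op A B X \<alpha>) x" by simp
  qed
  have "G_mean g A B X (1/2)
      \<le> ui_norm g (c *\<^sub>R heinz_op A B X (1/2)) + ui_norm g (l *\<^sub>R interp_op A B X \<alpha>)"
    unfolding G_mean_eq eq
    by (intro ui_norm_add_le[OF g] seq_compact_ops_scaleR H interp_op_seq_compact)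
  also have "\<dots> \<le> ennreal c * ui_norm g (heinz_op A B X (1/2)) + ennreal l * G_mean g A B X \<alpha>"
    unfolding G_mean_eq using c l
    by (intro add_mono ui_norm_scaleR_le[OF g] H interp_op_seq_compact) auto
  also have "ennreal c * ui_norm g (heinz_op A B X (1/2)) = ennreal (1 - l) * F_mean g A B X (1/2)"
  proof -
    have "ennreal c = ennreal (1 - l) * ennreal (1/2)"
      using l by (subst ennreal_mult[symmetric]) (auto simp: c_def)
    then show ?thesis by (simp add: F_mean_eq mult.assoc divide_ennreal_def)
  qed
  also have "ennreal (1 - l) * F_mean g A B X (1/2) + ennreal l * G_mean g A B X \<alpha>
      = ennreal ((1 - l) * F_real (1/2) + l * \<gamma>)"
    using l fin(2) by (simp add: F_mean_ennreal fin(1) F_real_nonneg ennreal_mult)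
  finally have le: "G_mean g A B X (1/2) \<le> ennreal ((1 - l) * F_real (1/2) + l * \<gamma>)" .
  then obtain r where r: "G_mean g A B X (1/2) = ennreal r" "0 \<le> r"
    by (metis ennreal_cases ennreal_less_top not_le top.extremum_strict)
  have "r \<le> (1 - l) * F_real (1/2) + l * \<gamma>"
  proof -
    have "0 \<le> (1 - l) * F_real (1/2) + l * \<gamma>"
      using l fin(2) F_real_nonneg[of "1/2"] by simp
    then show ?thesis using le unfolding r(1) by (simp only: ennreal_le_iff)
  qed
  moreover have "F_real (1/2) \<le> r"
    using F_half_le_G_half r by simp
  then have "(1 - l) * F_real (1/2) \<le> (1 - l) * r" using l by (intro mult_left_mono) auto
  ultimately have "l * r \<le> l * \<gamma>" by (simp add: left_diff_distrib)
  then have "r \<le> \<gamma>" using l by simp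
  then show ?thesis by (simp add: r ennreal_leI)
next
  case True
  show ?thesis using fin(1) unfolding True by simp
qed

end

text \<open>
  The majorant of \<open>F\<close> is linear on either side of \<open>1/2\<close>; on each side the fundamental theorem of
  calculus applies with a quadratic primitive.
\<close>

lemma nn_integral_linear_bounds:
  fixes p c :: real
  assumes "0 \<le> p" "0 \<le> c"
  shows "(\<integral>\<^sup>+x. ennreal ((4 * x - 1) * p + (2 - 4 * x) * c) * indicator {1/4..1/2} x \<partial>lborel)
      = ennreal ((p + c) / 8)"
    and "(\<integral>\<^sup>+x. ennreal ((3 - 4 * x) * p + (4 * x - 2) * c) * indicator {1/2..3/4} x \<partial>lborel)
      = ennreal ((p + c) / 8)"
proof -
  have v1: "((2 * (1/2)\<^sup>2 - 1/2) * p + (2 * (1/2) - 2 * (1/2)\<^sup>2) * c)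
      - ((2 * (1/4)\<^sup>2 - 1/4) * p + (2 * (1/4) - 2 * (1/4)\<^sup>2) * c) = (p + c) / 8"
    by (simp add: power2_eq_square field_simps)
  have v2: "((3 * (3/4) - 2 * (3/4)\<^sup>2) * p + (2 * (3/4)\<^sup>2 - 2 * (3/4)) * c)
      - ((3 * (1/2) - 2 * (1/2)\<^sup>2) * p + (2 * (1/2)\<^sup>2 - 2 * (1/2)) * c) = (p + c) / 8"
    by (simp add: power2_eq_square field_simps)
  have "(\<integral>\<^sup>+x. ennreal ((4 * x - 1) * p + (2 - 4 * x) * c) * indicator {1/4..1/2} x \<partial>lborel)
      = ennreal (((2 * (1/2)\<^sup>2 - 1/2) * p + (2 * (1/2) - 2 * (1/2)\<^sup>2) * c)
        - ((2 * (1/4)\<^sup>2 - 1/4) * p + (2 * (1/4) - 2 * (1/4)\<^sup>2) * c))"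
    by (rule nn_integral_FTC_Icc[where F = "\<lambda>x. (2 * x\<^sup>2 - x) * p + (2 * x - 2 * x\<^sup>2) * c"])
      (use assms in \<open>auto intro!: derivative_eq_intros add_nonneg_nonneg mult_nonneg_nonneg\<close>)
  then show "(\<integral>\<^sup>+x. ennreal ((4 * x - 1) * p + (2 - 4 * x) * c) * indicator {1/4..1/2} x \<partial>lborel)
      = ennreal ((p + c) / 8)"
    by (simp only: v1)
  have "(\<integral>\<^sup>+x. ennreal ((3 - 4 * x) * p + (4 * x - 2) * c) * indicator {1/2..3/4} x \<partial>lborel)
      = ennreal (((3 * (3/4) - 2 * (3/4)\<^sup>2) * p + (2 * (3/4)\<^sup>2 - 2 * (3/4)) * c)
        - ((3 * (1/2) - 2 * (1/2)\<^sup>2) * p + (2 * (1/2)\<^sup>2 - 2 * (1/2)) * c))"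
    by (rule nn_integral_FTC_Icc[where F = "\<lambda>x. (3 * x - 2 * x\<^sup>2) * p + (2 * x\<^sup>2 - 2 * x) * c"])
      (use assms in \<open>auto intro!: derivative_eq_intros add_nonneg_nonneg mult_nonneg_nonneg\<close>)
  then show "(\<integral>\<^sup>+x. ennreal ((3 - 4 * x) * p + (4 * x - 2) * c) * indicator {1/2..3/4} x \<partial>lborel)
      = ennreal ((p + c) / 8)"
    by (simp only: v2)
qed

theorem theorem3p1:
  fixes g :: "(nat \<Rightarrow> real) \<Rightarrow> real"
    and A B X :: "'a::complex_hilbert \<Rightarrow>\<^sub>L 'a"
    and \<alpha> :: real
  assumes separable: "\<exists>D :: 'a set. countable D \<and> closure D = UNIV"
    and gauge: "symmetric_gauge g"
    and A: "A \<in> positive_ops"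
    and B: "B \<in> positive_ops"
    and X: "X \<in> norm_ideal g"
    and \<alpha>: "1/2 \<le> \<alpha>"
  defines "F \<equiv> F_mean g A B X"
    and "G \<equiv> G_mean g A B X"
  shows "(\<forall>\<nu>::real. 1/4 \<le> \<nu> \<and> \<nu> \<le> 3/4 \<longrightarrow>
            (let r\<^sub>0 = min \<nu> (1 - \<nu>);
                 M = ennreal (4 * r\<^sub>0 - 1) * F (1/2) + ennreal (2 * (1 - 2 * r\<^sub>0)) * G \<alpha>
             in F \<nu> \<le> M \<and> M \<le> G \<alpha>)) \<and>
         enn2ereal (F (1/2))
           + 2 * (2 * enn2ereal (\<integral>\<^sup>+\<nu>\<in>{1/4..3/4}. F \<nu> \<partial>lborel) - enn2ereal (F (1/2)))
         \<le> enn2ereal (G \<alpha>)"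
proof -
  let ?\<phi> = "F_real g A B X"
  define p where "p = ?\<phi> (1/2)"
  have p0: "0 \<le> p" by (simp add: p_def F_real_nonneg[OF gauge A B X])
  have F_eq: "F \<nu> = ennreal (?\<phi> \<nu>)" if "0 \<le> \<nu>" "\<nu> \<le> 1" for \<nu>
    unfolding F_def by (rule F_mean_ennreal[OF gauge A B X that])
  have F_half: "F (1/2) = ennreal p" by (simp add: F_eq p_def)
  show ?thesis
  proof (cases "G \<alpha> = \<infinity>")
    case True
    \<comment> \<open>The coefficient of \<open>G \<alpha>\<close> vanishes only for \<open>\<nu> = 1/2\<close>, and then \<open>0 * \<infinity> = 0\<close>.\<close>
    have "F \<nu> \<le> ennreal (4 * min \<nu> (1 - \<nu>) - 1) * F (1/2) + ennreal (2 * (1 - 2 * min \<nu> (1 - \<nu>))) * G \<alpha>"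
      for \<nu>
    proof (cases "\<nu> = 1/2")
      case False
      then have "0 < 2 * (1 - 2 * min \<nu> (1 - \<nu>))" by (auto simp: min_def)
      then show ?thesis by (simp add: True ennreal_mult_eq_top_iff)
    next
      case half: True
      show ?thesis unfolding half by simp
    qed
    then show ?thesis by (simp add: True Let_def)
  next
    case False
    then obtain c where c: "G \<alpha> = ennreal c" "0 \<le> c" by (metis ennreal_cases infinity_ennreal_def)
    have G_half: "G_mean g A B X (1/2) \<le> ennreal c"
      using G_half_le_G[OF gauge A B X \<alpha>] c unfolding G_def by blast
    have "ennreal (?\<phi> (1/4)) \<le> ennreal c"
      using F_quarter_le_G_half[OF gauge A B X] F_eq[of "1/4"] G_half by (simp add: F_def)
    then have quarter: "?\<phi> (1/4) \<le> c" using c by (simp add: ennreal_le_iff)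
    have pc: "p \<le> c"
      using F_half_le_F_quarter[OF gauge A B X] quarter by (simp add: p_def)
    have left: "?\<phi> \<nu> \<le> (4 * \<nu> - 1) * p + (2 - 4 * \<nu>) * c" if "1/4 \<le> \<nu>" "\<nu> \<le> 1/2" for \<nu>
    proof -
      have "(2 - 4 * \<nu>) * ?\<phi> (1/4) \<le> (2 - 4 * \<nu>) * c"
        using quarter that by (intro mult_left_mono) auto
      then show ?thesis using F_real_le_chord[OF gauge A B X that] by (simp add: p_def)
    qed
    have right: "?\<phi> \<nu> \<le> (3 - 4 * \<nu>) * p + (4 * \<nu> - 2) * c" if "1/2 \<le> \<nu>" "\<nu> \<le> 3/4" for \<nu>
    proof -
      have "?\<phi> (1 - \<nu>) \<le> (4 * (1 - \<nu>) - 1) * p + (2 - 4 * (1 - \<nu>)) * c"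
        using that by (intro left) auto
      then show ?thesis by (simp add: F_real_sym[OF gauge A B X])
    qed
    have pointwise: "let r\<^sub>0 = min \<nu> (1 - \<nu>);
        M = ennreal (4 * r\<^sub>0 - 1) * F (1/2) + ennreal (2 * (1 - 2 * r\<^sub>0)) * G \<alpha>
        in F \<nu> \<le> M \<and> M \<le> G \<alpha>" if \<nu>: "1/4 \<le> \<nu>" "\<nu> \<le> 3/4" for \<nu>
    proof -
      define r where "r = min \<nu> (1 - \<nu>)"
      have r: "1/4 \<le> r" "r \<le> 1/2" using \<nu> by (auto simp: r_def min_def)
      have "ennreal (4 * r - 1) * F (1/2) + ennreal (2 * (1 - 2 * r)) * G \<alpha>
          = ennreal ((4 * r - 1) * p) + ennreal (2 * (1 - 2 * r) * c)"
        unfolding F_half c(1) using r p0 c(2) by (intro arg_cong2[where f = "(+)"] ennreal_mult[symmetric]) auto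
      also have "\<dots> = ennreal ((4 * r - 1) * p + 2 * (1 - 2 * r) * c)"
        using r p0 c(2) by (intro ennreal_plus[symmetric] mult_nonneg_nonneg) auto
      finally have M: "ennreal (4 * r - 1) * F (1/2) + ennreal (2 * (1 - 2 * r)) * G \<alpha>
          = ennreal ((4 * r - 1) * p + 2 * (1 - 2 * r) * c)" .
      have "?\<phi> \<nu> \<le> (4 * r - 1) * p + 2 * (1 - 2 * r) * c"
      proof (cases "\<nu> \<le> 1/2")
        case True
        then have "r = \<nu>" by (simp add: r_def)
        then show ?thesis using left[OF \<nu>(1) True] by (simp add: algebra_simps)
      next
        case False
        then have eq: "r = 1 - \<nu>" by (simp add: r_def)
        have "?\<phi> \<nu> \<le> (3 - 4 * \<nu>) * p + (4 * \<nu> - 2) * c" using False \<nu> by (intro right) auto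
        also have "\<dots> = (4 * r - 1) * p + 2 * (1 - 2 * r) * c" unfolding eq by (simp add: algebra_simps)
        finally show ?thesis .
      qed
      moreover have "(4 * r - 1) * p + 2 * (1 - 2 * r) * c \<le> c"
        using mult_left_mono[OF pc, of "4 * r - 1"] r by (simp add: algebra_simps)
      moreover have "F \<nu> = ennreal (?\<phi> \<nu>)" using \<nu> by (simp add: F_eq)
      ultimately show ?thesis
        unfolding Let_def r_def[symmetric] M by (simp only: c(1)) (intro conjI ennreal_leI)
    qed
    have "(\<integral>\<^sup>+\<nu>\<in>{1/4..3/4}. F \<nu> \<partial>lborel)
        \<le> (\<integral>\<^sup>+x. ennreal ((4 * x - 1) * p + (2 - 4 * x) * c) * indicator {1/4..1/2} x
            + ennreal ((3 - 4 * x) * p + (4 * x - 2) * c) * indicator {1/2..3/4} x \<partial>lborel)"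
    proof (rule nn_integral_mono)
      fix x :: real
      show "F x * indicator {1/4..3/4} x \<le> ennreal ((4 * x - 1) * p + (2 - 4 * x) * c) * indicator {1/4..1/2} x
          + ennreal ((3 - 4 * x) * p + (4 * x - 2) * c) * indicator {1/2..3/4} x"
      proof (cases "x \<in> {1/4..3/4}")
        case x: True
        show ?thesis
        proof (cases "x \<le> 1/2")
          case True
          then have "F x * indicator {1/4..3/4} x
              \<le> ennreal ((4 * x - 1) * p + (2 - 4 * x) * c) * indicator {1/4..1/2} x"
            using x left[of x] by (simp add: F_eq ennreal_leI)
          then show ?thesis by (rule order_trans) simp
        next
          case False
          then have "F x * indicator {1/4..3/4} x
              \<le> ennreal ((3 - 4 * x) * p + (4 * x - 2) * c) * indicator {1/2..3/4} x"
            using x right[of x] by (simp add: F_eq ennreal_leI)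
          then show ?thesis by (rule order_trans) simp
        qed
      qed simp
    qed
    also have "\<dots> = ennreal ((p + c) / 8) + ennreal ((p + c) / 8)"
      by (subst nn_integral_add) (simp_all add: nn_integral_linear_bounds[OF p0 c(2)])
    also have "\<dots> = ennreal ((p + c) / 4)"
      using p0 c(2) by (subst ennreal_plus[symmetric]) auto
    finally have I: "(\<integral>\<^sup>+\<nu>\<in>{1/4..3/4}. F \<nu> \<partial>lborel) \<le> ennreal ((p + c) / 4)" .
    then obtain i where i: "(\<integral>\<^sup>+\<nu>\<in>{1/4..3/4}. F \<nu> \<partial>lborel) = ennreal i" "0 \<le> i"
      by (metis ennreal_cases ennreal_less_top not_le top.extremum_strict)
    have "0 \<le> (p + c) / 4" using p0 c(2) by simp
    then have i_le: "i \<le> (p + c) / 4" using I unfolding i(1) by (simp only: ennreal_le_iff)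
    have "ereal p + 2 * (2 * ereal i - ereal p) = ereal (p + 2 * (2 * i - p))"
    proof -
      have "(2::ereal) = ereal 2" by simp
      then show ?thesis by (simp only: times_ereal.simps ereal_minus(1) plus_ereal.simps)
    qed
    also have "\<dots> \<le> ereal c" using i_le by simp
    finally have "ereal p + 2 * (2 * ereal i - ereal p) \<le> ereal c" .
    then have "enn2ereal (F (1/2))
        + 2 * (2 * enn2ereal (\<integral>\<^sup>+\<nu>\<in>{1/4..3/4}. F \<nu> \<partial>lborel) - enn2ereal (F (1/2))) \<le> enn2ereal (G \<alpha>)"
      unfolding i(1) F_half c(1) using p0 c(2) i(2) by (simp only: enn2ereal_ennreal)
    with pointwise show ?thesis by blast
  qed
qed

end
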